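(* Suppose $((X_1,Y_1),\dots,(X_N,Y_N))$ is a sequence of i.i.d. random variables satisfying the linear Gaussian model described in the context, with $\Sigma$ and $\Gamma$ known and $\Sigma$ diagonal. Let $$g:\mathbb R^{D\times L}\to\mathbb R^{L\times D},\qquad A\mapsto A^\star=\Sigma^\star A^{T}\Sigma^{-1}=(\Gamma^{-1}+A^{T}\Sigma^{-1}A)^{-1}A^{T}\Sigma^{-1}.$$ Then, for the estimator $\widehat A^\star=g(\widehat A)=(\Gamma^{-1}+\widehat A^{T}\Sigma^{-1}\widehat A)^{-1}\widehat A^{T}\Sigma^{-1}$, $$\sqrt N\big(\mathrm{vec}(\widehat A^\star)-\mathrm{vec}(A^\star)\big)\;\underset{N\to+\infty}{\longrightarrow}\;\mathcal N_{DL}(0,\Theta(A)),$$ where $\Theta(A)=\mathrm{Cov}\big(\mathrm{vec}(Dg(A).(\widehat A-A))\big)$ is defined by $$ \begin{aligned} \Theta(A)=\;&\Big(\big(\Sigma^{-1}+(A^\star)^{T}A^{T}\Sigma^{-1}AA^\star-2\Sigma^{-1}AA^\star\big)\otimes\Sigma^\star\Gamma\Sigma^\star\Big)+\Big((A^\star)^{T}\Gamma A^\star\otimes A^\star\Sigma(A^\star)^{T}\Big)\\ &-2\Big((I\otimes\Sigma^\star\Gamma)+\big((A^\star)^{T}A^{T}\otimes\Sigma^\star\Gamma\big)\Big)\,T_{LD}^{-1}\,\big((A^\star)^{T}\otimes A^\star\big). \end{aligned} $$ Moreover, $\Theta(\widehat A)$ is a consistent estimator of $\Theta(A)$, and then,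 by Slutsky's lemma, $$\sqrt N\,\big(\mathrm{vec}(\widehat A^\star)-\mathrm{vec}(A^\star)\big)^{T}\,\Theta(\widehat A)^{-1}\,\big(\mathrm{vec}(\widehat A^\star)-\mathrm{vec}(A^\star)\big)\;\underset{N\to+\infty}{\longrightarrow}\;\chi^2_{DL}.$$ (Both limits are in distribution.)
   Context: Model. $L,D$ are positive integers. The pairs $(X_i,Y_i)\in\mathbb R^D\times\mathbb R^L$ are i.i.d. with $X_i\sim\mathcal N_D(0,\Gamma^\star)$ and $Y_i=A^\star X_i+\varepsilon_i$, with Gaussian noise $\varepsilon_i\sim\mathcal N_L(0,\Sigma^\star)$ independent of $X_i$. Equivalently (inverse regression) $Y_i\sim\mathcal N_L(0,\Gamma)$ and $X_i=AY_i+e_i$ with $e_i\sim\mathcal N_D(0,\Sigma)$ independent of $Y_i$, where $A\in\mathbb R^{D\times L}$, $\Gamma$ is $L\times L$, $\Sigma$ is $D\times D$, and $$\Gamma^\star=\Sigma+A\Gamma A^{T},\quad \Sigma^\star=(\Gamma^{-1}+A^{T}\Sigma^{-1}A)^{-1},\quad A^\star=\Sigma^\star A^{T}\Sigma^{-1}.$$ $Y$ is the $N\times L$ matrix with rows $Y_i^{T}$, $X$ the $N\times D$ matrix with rows $X_i^{T}$, and $\widehat A=X^{T}Y(Y^{T}Y)^{-1}$ is the least squares estimator of $A$. $\mathrm{vec}$ stacks the columns of a matrix; $\otimes$ is the Kronecker product; $I$ is the $D\times D$ identity; $T_{LD}$ is the commutation matrix, transforming the vectorized form of an $L\times D$ matrix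 into the vectorized form of its transpose. The differential of $g$ at $A$ applied to $\widehat A-A$ is $$Dg(A).(\widehat A-A)=\Sigma^\star(\widehat A-A)^{T}\Sigma^{-1}-\Sigma^\star(\widehat A-A)^{T}\Sigma^{-1}AA^\star-A^\star(\widehat A-A)A^\star .$$ $\Theta(\widehat A)$ is obtained by replacing $A$ by $\widehat A$ in $\Theta$ (including in $\Sigma^\star$ and $A^\star$, which are functions of $A$).
   Formalization: Θ(A) is the asymptotic covariance of √N vec(Dg(A).(Â−A)); in its formula Γ becomes Γ⁻¹ throughout, the plus inside the last term becomes minus, and (A⋆)ᵀ⊗A⋆ becomes A⋆⊗(A⋆)ᵀ. The quadratic form has factor N, not √N, and its χ² limit assumes Θ(A) invertible. *)

theory Defs
  imports "HOL-Probability.Probability"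
begin

section \<open>Vectorization, Kronecker product, commutation matrix\<close>

text \<open>
  A \<open>p \<times> q\<close> matrix has type \<open>real ^ 'q ^ 'p\<close>.  Vectorized matrices are indexed by pairs
  (column, row): ordering the pairs lexicographically gives the usual stacking of columns, and
  the entry of \<open>kron A B\<close> at block \<open>(i, j)\<close>, position \<open>(k, l)\<close> is \<open>A $ i $ j * B $ k $ l\<close>.
\<close>

definition vec_of :: "real ^ 'q ^ 'p \<Rightarrow> real ^ ('q \<times> 'p)" where
  "vec_of M = (\<chi> i. M $ snd i $ fst i)"

definition kron :: "real ^ 'n ^ 'm \<Rightarrow> real ^ 'q ^ 'p \<Rightarrow> real ^ ('n \<times> 'q) ^ ('m \<times> 'p)" where
  "kron A B = (\<chi> i j. A $ fst i $ fst j * B $ snd i $ snd j)"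

definition commutation :: "real ^ ('d::finite \<times> 'l::finite) ^ ('l \<times> 'd)" where
  "commutation = (\<chi> i j. if fst i = snd j \<and> snd i = fst j then 1 else 0)"

lemma commutation_vec_of:
  "commutation *v vec_of M = vec_of (transpose M)"
proof -
  have "(\<Sum>j\<in>UNIV. (if fst i = snd j \<and> snd i = fst j then 1 else 0) * M $ snd j $ fst j)
        = M $ fst i $ snd i" for i :: "'a \<times> 'b"
  proof -
    have "(\<Sum>j\<in>UNIV. (if fst i = snd j \<and> snd i = fst j then 1 else 0) * M $ snd j $ fst j)
        = (\<Sum>j\<in>UNIV. if j = (snd i, fst i) then M $ snd j $ fst j else 0)"
      by (intro sum.cong) auto
    then show ?thesis by simp
  qed
  then show ?thesis
    by (simp add: vec_eq_iff commutation_def vec_of_def matrix_vector_mult_def transpose_def)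
qed

lemma kron_vec_of:
  "kron A B *v vec_of M = vec_of (B ** M ** transpose A)"
proof -
  have "(\<Sum>j\<in>UNIV. A $ a $ fst j * B $ b $ snd j * M $ snd j $ fst j)
        = (\<Sum>k\<in>UNIV. (\<Sum>l\<in>UNIV. B $ b $ l * M $ l $ k) * A $ a $ k)" for a b
    by (simp add: UNIV_Times_UNIV[symmetric] sum.cartesian_product' sum_distrib_left sum_distrib_right mult_ac
        del: UNIV_Times_UNIV)
  then show ?thesis
    by (simp add: vec_eq_iff kron_def vec_of_def matrix_vector_mult_def matrix_matrix_mult_def
        transpose_def)
qed

definition pos_def_matrix :: "real ^ 'n ^ 'n \<Rightarrow> bool" where
  "pos_def_matrix V \<longleftrightarrow> transpose V = V \<and> (\<forall>u. u \<noteq> 0 \<longrightarrow> u \<bullet> (V *v u) > 0)"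

section \<open>Gaussian and chi-square laws, modes of convergence\<close>

definition normal_measure :: "real \<Rightarrow> real \<Rightarrow> real measure" where
  "normal_measure m v =
     (if v > 0 then density lborel (normal_density m (sqrt v)) else return borel m)"

text \<open>
  \<open>P\<close> is the (possibly degenerate) Gaussian law with mean \<open>m\<close> and covariance \<open>V\<close>.
\<close>
definition mv_normal :: "(real ^ 'n) measure \<Rightarrow> real ^ 'n \<Rightarrow> real ^ 'n ^ 'n \<Rightarrow> bool" where
  "mv_normal P m V \<longleftrightarrow>
     prob_space P \<and> sets P = sets borel \<and>
     transpose V = V \<and> (\<forall>u. u \<bullet> (V *v u) \<ge> 0) \<and>
     (\<forall>u. distr P borel (\<lambda>x. u \<bullet> x) = normal_measure (u \<bullet> m) (u \<bullet> (V *v u)))"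

definition chi_square :: "nat \<Rightarrow> real measure" where
  "chi_square k =
     distr (\<Pi>\<^sub>M i\<in>{..<k}. density lborel std_normal_density) borel (\<lambda>x. \<Sum>i<k. (x i)\<^sup>2)"

text \<open>
  Weak convergence of laws; the library's \<open>weak_conv_m\<close> covers the real line only.
\<close>
definition weak_conv_vec :: "(nat \<Rightarrow> (real ^ 'n) measure) \<Rightarrow> (real ^ 'n) measure \<Rightarrow> bool" where
  "weak_conv_vec P Q \<longleftrightarrow>
     (\<forall>f :: real ^ 'n \<Rightarrow> real. continuous_on UNIV f \<and> bounded (range f) \<longrightarrow>
        (\<lambda>N. integral\<^sup>L (P N) f) \<longlonglongrightarrow> integral\<^sup>L Q f)"

definition tends_in_prob ::
    "'o measure \<Rightarrow> (nat \<Rightarrow> 'o \<Rightarrow> 'b::metric_space) \<Rightarrow> 'b \<Rightarrow> bool" where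
  "tends_in_prob M Z c \<longleftrightarrow>
     (\<forall>N. Z N \<in> borel_measurable M) \<and>
     (\<forall>e>0. (\<lambda>N. measure M {\<omega> \<in> space M. dist (Z N \<omega>) c > e}) \<longlonglongrightarrow> 0)"

section \<open>The linear Gaussian model\<close>

text \<open>
  The inverse regression form of the model: \<open>X i = A Y i + e i\<close> with \<open>Y i\<close> and the noise \<open>e i\<close>
  independent Gaussian vectors.  Independence is stated for the generated sigma-algebras because
  \<open>indep_var\<close> requires both variables to have the same type.
\<close>
definition linear_gaussian_model ::
    "'o measure \<Rightarrow> real ^ 'l ^ 'd \<Rightarrow> real ^ 'l ^ 'l \<Rightarrow> real ^ 'd ^ 'd \<Rightarrow>
     (nat \<Rightarrow> 'o \<Rightarrow> real ^ 'd) \<Rightarrow> (nat \<Rightarrow> 'o \<Rightarrow> real ^ 'l) \<Rightarrow> bool" where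
  "linear_gaussian_model M A \<Gamma> \<Sigma> X Y \<longleftrightarrow>
     prob_space.indep_vars M (\<lambda>_. borel) (\<lambda>i \<omega>. (X i \<omega>, Y i \<omega>)) UNIV \<and>
     (\<forall>i. distr M borel (\<lambda>\<omega>. (X i \<omega>, Y i \<omega>)) = distr M borel (\<lambda>\<omega>. (X 0 \<omega>, Y 0 \<omega>))) \<and>
     (\<forall>i. mv_normal (distr M borel (Y i)) 0 \<Gamma> \<and>
          mv_normal (distr M borel (\<lambda>\<omega>. X i \<omega> - A *v Y i \<omega>)) 0 \<Sigma> \<and>
          prob_space.indep_set M
            (sets (vimage_algebra (space M) (Y i) borel))
            (sets (vimage_algebra (space M) (\<lambda>\<omega>. X i \<omega> - A *v Y i \<omega>) borel)))"

definition Sigma_star ::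
    "real ^ 'l ^ 'l \<Rightarrow> real ^ 'd ^ 'd \<Rightarrow> real ^ 'l ^ 'd \<Rightarrow> real ^ 'l ^ 'l" where
  "Sigma_star \<Gamma> \<Sigma> A = matrix_inv (matrix_inv \<Gamma> + transpose A ** matrix_inv \<Sigma> ** A)"

definition A_star ::
    "real ^ 'l ^ 'l \<Rightarrow> real ^ 'd ^ 'd \<Rightarrow> real ^ 'l ^ 'd \<Rightarrow> real ^ 'd ^ 'l" where
  "A_star \<Gamma> \<Sigma> A = Sigma_star \<Gamma> \<Sigma> A ** transpose A ** matrix_inv \<Sigma>"

text \<open>
  \<open>A_star_diff \<Gamma> \<Sigma> A\<close> is the differential at \<open>A\<close> of the map \<open>A_star \<Gamma> \<Sigma>\<close>.
\<close>
definition A_star_diff ::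
    "real ^ 'l ^ 'l \<Rightarrow> real ^ 'd ^ 'd \<Rightarrow> real ^ 'l ^ 'd \<Rightarrow> real ^ 'l ^ 'd \<Rightarrow> real ^ 'd ^ 'l" where
  "A_star_diff \<Gamma> \<Sigma> A H =
     (let S = Sigma_star \<Gamma> \<Sigma> A; B = A_star \<Gamma> \<Sigma> A in
        S ** transpose H ** matrix_inv \<Sigma>
        - S ** transpose H ** matrix_inv \<Sigma> ** A ** B
        - B ** H ** B)"

text \<open>
  For the sample matrices with rows \<open>x 0, \<dots>, x (N - 1)\<close> and \<open>y 0, \<dots>, y (N - 1)\<close>, the two sums
  are the entries of \<open>X\<^sup>T Y\<close> and \<open>Y\<^sup>T Y\<close>.
\<close>
definition least_squares ::
    "nat \<Rightarrow> (nat \<Rightarrow> real ^ 'd) \<Rightarrow> (nat \<Rightarrow> real ^ 'l) \<Rightarrow> real ^ 'l ^ 'd" where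
  "least_squares N x y =
     (\<chi> d l. \<Sum>i<N. x i $ d * y i $ l) ** matrix_inv (\<chi> l m. \<Sum>i<N. y i $ l * y i $ m)"

text \<open>
  Asymptotic covariance matrix of \<open>vec_of (A_star_diff \<Gamma> \<Sigma> A (A' - A))\<close>, where \<open>A'\<close> is the least
  squares estimator, the asymptotic covariance of \<open>vec_of (A' - A)\<close> being \<open>kron \<Gamma>\<^sup>-\<^sup>1 \<Sigma>\<close>.
  With \<open>H = A' - A\<close>, \<open>S = Sigma_star \<Gamma> \<Sigma> A\<close> and \<open>B = A_star \<Gamma> \<Sigma> A\<close>, the first summand comes from
  \<open>S H\<^sup>T \<Sigma>\<^sup>-\<^sup>1 (I - A B)\<close>, the second from \<open>B H B\<close>, the third from their cross-covariance, which is
  symmetric because \<open>B (I - A B) = S \<Gamma>\<^sup>-\<^sup>1 B\<close>.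

  The formula in the source reads differently in three places: it has \<open>\<Gamma>\<close> where \<open>\<Gamma>\<^sup>-\<^sup>1\<close> stands
  below, a plus sign between the two Kronecker products of the last summand, and \<open>kron B\<^sup>T B\<close> for
  \<open>kron B B\<^sup>T\<close>.  That version is not a covariance matrix: for scalar \<open>A = \<Gamma> = \<Sigma> = 1\<close> it has the
  value \<open>- 1 / 4\<close>.  Likewise the quadratic form that is asymptotically chi-square is
  normalized by \<open>N\<close>, not by \<open>sqrt N\<close>.
\<close>
definition Theta ::
    "real ^ 'l ^ 'l \<Rightarrow> real ^ 'd ^ 'd \<Rightarrow> real ^ 'l ^ 'd \<Rightarrow> real ^ ('d \<times> 'l) ^ ('d \<times> 'l)" where
  "Theta \<Gamma> \<Sigma> A =
     (let S = Sigma_star \<Gamma> \<Sigma> A; B = A_star \<Gamma> \<Sigma> A; \<Gamma>i = matrix_inv \<Gamma>; \<Sigma>i = matrix_inv \<Sigma> in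
        kron (\<Sigma>i + transpose B ** transpose A ** \<Sigma>i ** A ** B - 2 *\<^sub>R (\<Sigma>i ** A ** B))
             (S ** \<Gamma>i ** S)
        + kron (transpose B ** \<Gamma>i ** B) (B ** \<Sigma> ** transpose B)
        - 2 *\<^sub>R ((kron (mat 1) (S ** \<Gamma>i) - kron (transpose B ** transpose A) (S ** \<Gamma>i))
                 ** matrix_inv commutation ** kron B (transpose B)))"

end

theory Submission
  imports Defs
begin

text \<open>
  Let \<open>e i = X i - A Y i\<close>, \<open>Z N = N\<^sup>-\<^sup>1\<^sup>/\<^sup>2 \<Sum>i<N. e i (Y i)\<^sup>T\<close> and \<open>S N = N\<^sup>-\<^sup>1 \<Sum>i<N. Y i (Y i)\<^sup>T\<close>.  The
  one-dimensional central limit theorem and the Cramer-Wold device give \<open>Z N \<rightarrow> Q\<close> in law, where \<open>Q\<close>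
  is Gaussian with covariance \<open>kron \<Gamma> \<Sigma>\<close>, and Chebyshev's inequality gives \<open>S N \<rightarrow> \<Gamma>\<close> in
  probability.  As soon as \<open>S N\<close> is invertible, the estimator is \<open>A + t Z S\<^sup>-\<^sup>1\<close> with \<open>t = N\<^sup>-\<^sup>1\<^sup>/\<^sup>2\<close>, and
  the difference quotient of \<open>A_star \<Gamma> \<Sigma>\<close> at \<open>A\<close> in direction \<open>H\<close> with step \<open>t\<close> is an explicit
  expression that is jointly continuous up to \<open>t = 0\<close>, where it is the differential.  So every
  statistic in the theorem is one function of \<open>Z N\<close>, \<open>S N\<close> and \<open>t\<close>, continuous at all points
  \<open>(z, \<Gamma>, 0)\<close>, and a single Slutsky lemma yields all limits.  The law of the linearization is the
  image of \<open>Q\<close> under a linear map whose covariance is \<open>Theta \<Gamma> \<Sigma> A\<close>, because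
  \<open>B (I - A B) = Sigma_star \<Gamma> \<Sigma> A \<Gamma>\<^sup>-\<^sup>1 B\<close> makes the cross-covariance
  symmetric for \<open>B = A_star \<Gamma> \<Sigma> A\<close>.
\<close>

section \<open>The Cramer-Wold device\<close>

text \<open>\<open>mv_normal\<close> prescribes only the laws of projections, and these determine
  the integrals of the functions exp(i u x), whose span is \<open>trig_sum\<close>. Approximating
  bounded continuous functions by this span, with tails controlled coordinate by coordinate, gives
  the vector limit theorem and also the uniqueness of Gaussian laws, on which the chi-square limit
  depends. The main obstacle is that \<open>S N\<close> can be singular: for N below the dimension
  of \<open>Y\<close> it always is. The probability of this event is never estimated. The formula
  for the estimator is kept uncancelled, so that its representation through \<open>Z N\<close>,
  \<open>S N\<close> and t is exact on the whole sample space, default values of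
  \<open>matrix_inv\<close> included. Regularity is needed only at the limit points, where
  \<open>S N\<close> has become \<Gamma>. This fixes the form of Slutsky's lemma. The function is
  continuous only along the slice where the second argument has its limit value, so uniformity near
  that slice comes from compactness, and measurability is asked of the statistic \<open>T\<close>
  rather than of the composed function. Positive definiteness makes \<open>Sigma_star\<close> an
  honest inverse at every argument, hence also at the random value \<open>A_hat\<close>.\<close>

inductive trig_sum :: "('a::real_inner \<Rightarrow> complex) \<Rightarrow> bool" where
  trig_term: "trig_sum (\<lambda>x. c * iexp (u \<bullet> x))"
| trig_add: "trig_sum f \<Longrightarrow> trig_sum g \<Longrightarrow> trig_sum (\<lambda>x. f x + g x)"

lemma trig_sum_const: "trig_sum (\<lambda>x. c)"
  using trig_term[of c 0] by simp

text \<open>Exponentials multiply by adding their frequencies, so the span is an algebra. This is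
  what allows polynomials in sines to be handled below.\<close>

lemma trig_sum_mult:
  assumes "trig_sum f" "trig_sum g"
  shows "trig_sum (\<lambda>x. f x * g x)"
  using assms(1)
proof induction
  case (trig_term c u)
  from assms(2) show ?case
  proof induction
    case (trig_term d v)
    have "c * iexp (u \<bullet> x) * (d * iexp (v \<bullet> x)) = (c * d) * iexp ((u + v) \<bullet> x)" for x
      by (simp add: inner_add_left distrib_left exp_add)
    with trig_sum.trig_term[of "c * d" "u + v"] show ?case
      by presburger
  next
    case (trig_add f g)
    then show ?case
      using trig_sum.trig_add by (simp add: distrib_left)
  qed
next
  case (trig_add f1 f2)
  then show ?case
    using trig_sum.trig_add by (simp add: distrib_right)
qed

lemma trig_sum_sum:
  assumes "finite I" "\<And>i. i \<in> I \<Longrightarrow> trig_sum (f i)"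
  shows "trig_sum (\<lambda>x. \<Sum>i\<in>I. f i x)"
  using assms by (induction I rule: finite_induct) (auto intro: trig_sum_const trig_add)

lemma trig_sum_sin: "trig_sum (\<lambda>x. complex_of_real (sin (u \<bullet> x)))"
proof -
  have "complex_of_real (sin (u \<bullet> x)) = 1 / (2 * \<i>) * iexp (u \<bullet> x) + - 1 / (2 * \<i>) * iexp ((- u) \<bullet> x)" for x
    by (simp add: sin_of_real[symmetric] sin_exp_eq field_simps)
  then show ?thesis
    using trig_add[OF trig_term[of "1 / (2 * \<i>)" u] trig_term[of "- 1 / (2 * \<i>)" "- u"]]
    by simp
qed

text \<open>Real polynomial functions are generated from linear functionals and constants by sums
  and products. A linear functional of the vector of sines is a combination of sines, and
  trigonometric sums are closed under the other operations.\<close>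

lemma trig_sum_polynomial_sin:
  fixes p :: "'a::euclidean_space \<Rightarrow> real"
  assumes "real_polynomial_function p"
  shows "trig_sum (\<lambda>x. complex_of_real (p (\<Sum>b\<in>Basis. sin ((x \<bullet> b) / R) *\<^sub>R b)))"
  using assms
proof induction
  case (linear L)
  have eq: "complex_of_real (L (\<Sum>b\<in>Basis. sin ((x \<bullet> b) / R) *\<^sub>R b))
     = (\<Sum>b\<in>Basis. complex_of_real (L b) * complex_of_real (sin ((b /\<^sub>R R) \<bullet> x)))" for x
    using linear
    by (simp add: linear_sum[OF bounded_linear.linear] linear_scale[OF bounded_linear.linear]
        inner_commute divide_inverse mult_ac)
  show ?case
    unfolding eq by (intro trig_sum_sum trig_sum_mult trig_sum_const trig_sum_sin) simp
next
  case (add f g)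
  then show ?case
    using trig_add by simp
next
  case (mult f g)
  then show ?case
    using trig_sum_mult by simp
qed (rule trig_sum_const)

lemma integrable_trig_sum:
  fixes g :: "'a::euclidean_space \<Rightarrow> complex"
  assumes "trig_sum g" "prob_space P" "sets P = sets borel"
  shows "integrable P g"
  using assms(1)
proof induction
  case (trig_term c u)
  have "(\<lambda>x. complex_of_real (u \<bullet> x)) \<in> borel_measurable P"
    using assms(3) by (simp add: measurable_cong_sets[OF assms(3) refl])
  from prob_space.integrable_iexp[OF assms(2) this] show ?case
    by auto
qed auto

text \<open>The integral of one exponential is the characteristic function of the projection along
  \<open>u\<close> at the point 1, so the direct half of Levy's continuity theorem applies to each
  term.\<close>

lemma integral_trig_sum_tendsto:
  fixes P :: "nat \<Rightarrow> 'a::euclidean_space measure"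
  assumes P: "\<And>N. prob_space (P N)" "\<And>N. sets (P N) = sets borel"
    and Q: "prob_space Q" "sets Q = sets borel"
    and conv: "\<And>u. weak_conv_m (\<lambda>N. distr (P N) borel (\<lambda>x. u \<bullet> x)) (distr Q borel (\<lambda>x. u \<bullet> x))"
    and g: "trig_sum g"
  shows "(\<lambda>N. integral\<^sup>L (P N) g) \<longlonglongrightarrow> integral\<^sup>L Q g"
  using g
proof induction
  case (trig_term c u)
  have m: "(\<lambda>x. u \<bullet> x) \<in> borel_measurable R" if "sets R = sets borel" for R :: "'a measure"
    by (simp add: measurable_cong_sets[OF that refl])
  have rd: "real_distribution (distr R borel (\<lambda>x. u \<bullet> x))"
    if "prob_space R" "sets R = sets borel" for R :: "'a measure"
    using prob_space.real_distribution_distr[OF that(1) m[OF that(2)]] .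
  have ch: "char (distr R borel (\<lambda>x. u \<bullet> x)) 1 = (CLINT x|R. iexp (u \<bullet> x))"
    if "sets R = sets borel" for R :: "'a measure"
    unfolding char_def by (subst integral_distr[OF m[OF that]]) auto
  have "(\<lambda>N. char (distr (P N) borel (\<lambda>x. u \<bullet> x)) 1) \<longlonglongrightarrow> char (distr Q borel (\<lambda>x. u \<bullet> x)) 1"
    by (intro levy_continuity1 rd P Q conv)
  then show ?case
    by (simp add: ch P Q tendsto_mult)
next
  case (trig_add f g)
  then show ?case
    using P Q by (simp add: integrable_trig_sum tendsto_add)
qed

text \<open>
  On the box \<open>\<bar>x \<bullet> b\<bar> \<le> R\<close> the map \<open>x \<mapsto> (sin (x \<bullet> b / R))\<close> is injective, so \<open>f\<close> is there a continuous
  function of sines, and Stone-Weierstrass yields a trigonometric sum that is bounded everywhere.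
\<close>
lemma trig_sum_approx:
  fixes f :: "'a::euclidean_space \<Rightarrow> real"
  assumes cont: "continuous_on UNIV f" and bdd: "\<And>x. \<bar>f x\<bar> \<le> B" and e: "0 < e" and R: "0 < R"
  obtains g where "trig_sum (\<lambda>x. complex_of_real (g x))"
    and "\<And>x. \<bar>g x\<bar> \<le> B + e"
    and "\<And>x. (\<And>b. b \<in> Basis \<Longrightarrow> \<bar>x \<bullet> b\<bar> \<le> R) \<Longrightarrow> \<bar>f x - g x\<bar> \<le> e"
proof -
  \<comment> \<open>Clamping to [-1, 1] makes \<open>F\<close> continuous on the whole space, and it
    changes nothing at the points \<open>q x\<close>, whose coordinates are sines.\<close>
  define F where "F s = f (\<Sum>b\<in>Basis. (R * arcsin (max (- 1) (min 1 (s \<bullet> b)))) *\<^sub>R b)" for s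
  define q :: "'a \<Rightarrow> 'a" where "q x = (\<Sum>b\<in>Basis. sin ((x \<bullet> b) / R) *\<^sub>R b)" for x
  have "continuous_on UNIV (\<lambda>s. \<Sum>b\<in>Basis. (R * arcsin (max (- 1) (min 1 (s \<bullet> b)))) *\<^sub>R (b::'a))"
    by (intro continuous_intros) auto
  then have "continuous_on UNIV F"
    unfolding F_def by (rule continuous_on_compose2[OF cont]) auto
  then have "continuous_on (cbox (- One) One) F"
    by (rule continuous_on_subset) auto
  then obtain p where p: "real_polynomial_function p"
    and pF: "\<And>s. s \<in> cbox (- One) One \<Longrightarrow> \<bar>F s - p s\<bar> < e"
    using Stone_Weierstrass_real_polynomial_function[OF compact_cbox _ e] by metis
  have q_box: "q x \<in> cbox (- One) One" for x
    by (auto simp: q_def mem_box)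
  have Fq: "F (q x) = f x" if "\<And>b. b \<in> Basis \<Longrightarrow> \<bar>x \<bullet> b\<bar> \<le> R" for x
  proof -
    have "R * arcsin (max (- 1) (min 1 (q x \<bullet> b))) = x \<bullet> b" if b: "b \<in> Basis" for b
    proof -
      have "\<bar>x \<bullet> b / R\<bar> \<le> 1"
        using that \<open>\<And>b. b \<in> Basis \<Longrightarrow> \<bar>x \<bullet> b\<bar> \<le> R\<close>[OF b] R by (simp add: field_simps)
      \<comment> \<open>\<open>arcsin\<close> inverts \<open>sin\<close> here because 1 < pi / 2;
        this is why the coordinates are divided by \<open>R\<close>.\<close>
      then have "arcsin (sin (x \<bullet> b / R)) = x \<bullet> b / R"
        using pi_gt3 by (intro arcsin_sin) linarith+
      moreover have "q x \<bullet> b = sin (x \<bullet> b / R)"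
        using b by (simp add: q_def)
      moreover have "max (- 1) (min 1 (sin (x \<bullet> b / R))) = sin (x \<bullet> b / R)"
        using sin_le_one[of "x \<bullet> b / R"] sin_ge_minus_one[of "x \<bullet> b / R"] by linarith
      ultimately show ?thesis
        using R by simp
    qed
    then show ?thesis
      by (simp add: F_def euclidean_representation)
  qed
  show thesis
  proof (rule that[of "\<lambda>x. p (q x)"])
    show "trig_sum (\<lambda>x. complex_of_real (p (q x)))"
      unfolding q_def by (rule trig_sum_polynomial_sin[OF p])
    show "\<bar>p (q x)\<bar> \<le> B + e" for x
      using pF[OF q_box[of x]] bdd[of "\<Sum>b\<in>Basis. (R * arcsin (max (- 1) (min 1 (q x \<bullet> b)))) *\<^sub>R b"]
      unfolding F_def by linarith
    show "\<bar>f x - p (q x)\<bar> \<le> e" if "\<And>b. b \<in> Basis \<Longrightarrow> \<bar>x \<bullet> b\<bar> \<le> R" for x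
      using pF[OF q_box[of x]] Fq[OF that] by linarith
  qed
qed

text \<open>A continuous stand-in for the indicator of a tail: it vanishes up to \<open>n\<close>
  and equals 1 from \<open>n + 1\<close> on, so that weak convergence controls its integral.\<close>

definition ramp :: "nat \<Rightarrow> real \<Rightarrow> real" where
  "ramp n y = min 1 (max 0 (\<bar>y\<bar> - real n))"

lemma ramp_nonneg: "0 \<le> ramp n y" and ramp_le_1: "ramp n y \<le> 1"
  by (auto simp: ramp_def)

lemma continuous_on_ramp: "continuous_on S (ramp n)"
  unfolding ramp_def by (intro continuous_intros)

lemma borel_measurable_ramp[measurable]: "ramp n \<in> borel_measurable borel"
  by (rule borel_measurable_continuous_onI[OF continuous_on_ramp])

lemma (in prob_space) integrable_ramp:
  "f \<in> borel_measurable M \<Longrightarrow> integrable M (\<lambda>x. ramp n (f x))"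
  using ramp_nonneg ramp_le_1 by (intro integrable_const_bound[where B=1]) auto

lemma (in prob_space) integral_ramp_tendsto:
  assumes [measurable]: "f \<in> borel_measurable M"
  shows "(\<lambda>n. \<integral>x. ramp n (f x) \<partial>M) \<longlonglongrightarrow> 0"
proof -
  have "(\<lambda>n. \<integral>x. ramp n (f x) \<partial>M) \<longlonglongrightarrow> (\<integral>x. 0 \<partial>M)"
  proof (rule integral_dominated_convergence[where w="\<lambda>_. 1"])
    have "ramp n y = 0" if "n \<ge> nat \<lceil>\<bar>y\<bar>\<rceil>" for n y
      using that real_nat_ceiling_ge[of "\<bar>y\<bar>"] unfolding ramp_def by linarith
    then have "eventually (\<lambda>n. ramp n y = 0) sequentially" for y
      unfolding eventually_sequentially by blast
    then show "AE x in M. (\<lambda>n. ramp n (f x)) \<longlonglongrightarrow> 0"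
      by (auto intro: tendsto_eventually)
  qed (use ramp_nonneg ramp_le_1 in auto)
  then show ?thesis
    by simp
qed

text \<open>Projections along basis vectors bound the mass outside a large box, for the limit and
  for almost all \<open>P N\<close>. On the box \<open>f\<close> is close to a trigonometric sum
  \<open>g\<close>, whose integrals converge because all projections do. Off the box it suffices
  that \<open>g\<close> is bounded independently of the box.\<close>

theorem cramer_wold:
  fixes P :: "nat \<Rightarrow> 'a::euclidean_space measure"
  assumes P: "\<And>N. prob_space (P N)" "\<And>N. sets (P N) = sets borel"
    and Q: "prob_space Q" "sets Q = sets borel"
    and conv: "\<And>u. weak_conv_m (\<lambda>N. distr (P N) borel (\<lambda>x. u \<bullet> x)) (distr Q borel (\<lambda>x. u \<bullet> x))"
    and cont: "continuous_on UNIV f" and bdd: "\<And>x. \<bar>f x\<bar> \<le> (B::real)"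
  shows "(\<lambda>N. integral\<^sup>L (P N) f) \<longlonglongrightarrow> integral\<^sup>L Q f"
proof (rule LIMSEQ_I)
  fix \<epsilon> :: real assume \<epsilon>: "\<epsilon> > 0"
  have B: "B \<ge> 0"
    using bdd[of 0] by simp
  \<comment> \<open>At least 1 outside the box of half-width \<open>n + 1\<close>, since one of its
    ramps is 1 there; this is also the reason for taking \<open>R = n + 1\<close> in the
    approximation.\<close>
  define \<Psi> where "\<Psi> n x = (\<Sum>b\<in>Basis. ramp n (b \<bullet> x))" for n and x :: 'a
  have f_meas: "f \<in> borel_measurable borel"
    using cont by (rule borel_measurable_continuous_onI)
  have meas: "h \<in> borel_measurable R" if "h \<in> borel_measurable borel" "sets R = sets borel"
    for h :: "'a \<Rightarrow> real" and R
    using that by (simp add: measurable_cong_sets[OF that(2) refl])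
  have bdd_int: "integrable R h"
    if "prob_space R" "sets R = sets borel" "h \<in> borel_measurable borel" "\<And>x. \<bar>h x\<bar> \<le> C"
    for h :: "'a \<Rightarrow> real" and R C
  proof -
    interpret R: prob_space R by (rule that)
    show ?thesis
      using meas[OF that(3,2)] that(4) by (intro R.integrable_const_bound[where B=C]) auto
  qed
  have ramp_bound: "0 \<le> ramp n y" "ramp n y \<le> 1" for n y
    by (simp_all add: ramp_nonneg ramp_le_1)
  have int_ramp: "integrable R (\<lambda>x. ramp n (b \<bullet> x))" if "prob_space R" "sets R = sets borel"
    for R :: "'a measure" and n b
    using ramp_bound by (intro bdd_int[OF that, where C=1]) auto
  have int_\<Psi>: "integrable R (\<Psi> n)" if "prob_space R" "sets R = sets borel" for R :: "'a measure" and n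
    unfolding \<Psi>_def using int_ramp[OF that] by auto
  have int_f: "integrable R f" if "prob_space R" "sets R = sets borel" for R :: "'a measure"
    using that f_meas bdd by (rule bdd_int)
  have "(\<lambda>n. \<integral>x. ramp n (b \<bullet> x) \<partial>Q) \<longlonglongrightarrow> 0" for b
    by (rule prob_space.integral_ramp_tendsto[OF Q(1) meas[OF _ Q(2)]]) measurable
  then have "(\<lambda>n. integral\<^sup>L Q (\<Psi> n)) \<longlonglongrightarrow> (\<Sum>b\<in>(Basis::'a set). 0)"
    unfolding \<Psi>_def using int_ramp[OF Q] by (subst Bochner_Integration.integral_sum) (auto intro!: tendsto_sum tendsto_null_sum)
  then have "(\<lambda>n. integral\<^sup>L Q (\<Psi> n)) \<longlonglongrightarrow> 0"
    by simp
  \<comment> \<open>The errors for \<open>P N\<close>, for \<open>Q\<close> and for the integrals of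
    \<open>g\<close> add up to less than 3 e + 2 (2 B + e) e, which is at most (5 + 4 B) e because e
    is at most 1; the constant 10 leaves room.\<close>
  define e where "e = min 1 (\<epsilon> / (10 + 4 * B))"
  have e: "e > 0" "e \<le> 1" "e * (10 + 4 * B) \<le> \<epsilon>"
  proof -
    have pos: "10 + 4 * B > 0"
      using B by simp
    show "e > 0" "e \<le> 1"
      using \<epsilon> pos by (simp_all add: e_def)
    have "e * (10 + 4 * B) \<le> \<epsilon> / (10 + 4 * B) * (10 + 4 * B)"
      using pos by (intro mult_right_mono) (simp_all add: e_def)
    also have "\<dots> = \<epsilon>"
      using pos by simp
    finally show "e * (10 + 4 * B) \<le> \<epsilon>" .
  qed
  from order_tendstoD(2)[OF \<open>(\<lambda>n. integral\<^sup>L Q (\<Psi> n)) \<longlonglongrightarrow> 0\<close> e(1)]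
  obtain n where n: "integral\<^sup>L Q (\<Psi> n) < e"
    unfolding eventually_sequentially by blast
  have "(\<lambda>N. \<integral>x. ramp n (b \<bullet> x) \<partial>P N) \<longlonglongrightarrow> (\<integral>x. ramp n (b \<bullet> x) \<partial>Q)" for b
  proof -
    have m: "(\<lambda>x. b \<bullet> x) \<in> borel_measurable R" if "sets R = sets borel" for R :: "'a measure"
      by (simp add: measurable_cong_sets[OF that refl])
    have "(\<lambda>N. integral\<^sup>L (distr (P N) borel (\<lambda>x. b \<bullet> x)) (ramp n))
        \<longlonglongrightarrow> integral\<^sup>L (distr Q borel (\<lambda>x. b \<bullet> x)) (ramp n)"
      using ramp_bound continuous_on_ramp[of UNIV n]
      by (intro weak_conv_imp_integral_bdd_continuous_conv[where B=1] conv
          prob_space.real_distribution_distr P Q m) (auto simp: continuous_on_eq_continuous_at)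
    then show ?thesis
      by (simp add: integral_distr m P Q)
  qed
  then have "(\<lambda>N. integral\<^sup>L (P N) (\<Psi> n)) \<longlonglongrightarrow> integral\<^sup>L Q (\<Psi> n)"
    unfolding \<Psi>_def using int_ramp[OF Q] int_ramp[OF P]
    by (subst (1 2) Bochner_Integration.integral_sum) (auto intro!: tendsto_sum)
  from order_tendstoD(2)[OF this n] obtain N1 where N1: "\<And>N. N \<ge> N1 \<Longrightarrow> integral\<^sup>L (P N) (\<Psi> n) < e"
    unfolding eventually_sequentially by blast
  obtain g where g: "trig_sum (\<lambda>x. complex_of_real (g x))" "\<And>x. \<bar>g x\<bar> \<le> B + e"
    "\<And>x. (\<And>b. b \<in> Basis \<Longrightarrow> \<bar>x \<bullet> b\<bar> \<le> real n + 1) \<Longrightarrow> \<bar>f x - g x\<bar> \<le> e"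
    using trig_sum_approx[OF cont bdd e(1), of "real n + 1"] by auto
  have int_g: "integrable R g" if "prob_space R" "sets R = sets borel" for R :: "'a measure"
    using integrable_Re[OF integrable_trig_sum[OF g(1) that]] by simp
  \<comment> \<open>Inside the box the error is at most \<open>e\<close>; outside, \<Psi> is at
    least 1 and pays for the trivial bound 2 B + e.\<close>
  have diff: "\<bar>f x - g x\<bar> \<le> e + (2 * B + e) * \<Psi> n x" for x
  proof (cases "\<forall>b\<in>Basis. \<bar>x \<bullet> b\<bar> \<le> real n + 1")
    case True
    have "\<Psi> n x \<ge> 0"
      unfolding \<Psi>_def by (intro sum_nonneg ramp_bound)
    then have "(2 * B + e) * \<Psi> n x \<ge> 0"
      using B e by simp
    with g(3)[of x] True show ?thesis
      by fastforce
  next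
    case False
    then obtain b where b: "b \<in> Basis" "\<bar>b \<bullet> x\<bar> > real n + 1"
      by (auto simp: inner_commute not_le)
    then have "1 = ramp n (b \<bullet> x)"
      by (auto simp: ramp_def)
    also have "\<dots> \<le> \<Psi> n x"
      unfolding \<Psi>_def using b ramp_bound by (intro member_le_sum) auto
    finally have "(2 * B + e) * 1 \<le> (2 * B + e) * \<Psi> n x"
      using B e by (intro mult_left_mono) auto
    moreover have "\<bar>f x - g x\<bar> \<le> 2 * B + e"
      using bdd[of x] g(2)[of x] by linarith
    ultimately show ?thesis
      using e(1) by simp
  qed
  have close: "\<bar>integral\<^sup>L R f - integral\<^sup>L R g\<bar> \<le> e + (2 * B + e) * e"
    if R: "prob_space R" "sets R = sets borel" and small: "integral\<^sup>L R (\<Psi> n) < e"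
    for R :: "'a measure"
  proof -
    interpret R: prob_space R by (rule R)
    have "\<bar>integral\<^sup>L R f - integral\<^sup>L R g\<bar> = \<bar>\<integral>x. f x - g x \<partial>R\<bar>"
      by (simp add: int_f int_g R)
    also have "\<dots> \<le> (\<integral>x. \<bar>f x - g x\<bar> \<partial>R)"
      by (rule integral_abs_bound)
    also have "\<dots> \<le> (\<integral>x. e + (2 * B + e) * \<Psi> n x \<partial>R)"
      using diff int_f[OF R] int_g[OF R] int_\<Psi>[OF R]
      by (intro integral_mono) auto
    also have "\<dots> = e + (2 * B + e) * integral\<^sup>L R (\<Psi> n)"
      using int_\<Psi>[OF R] by (simp add: R.prob_space)
    also have "\<dots> \<le> e + (2 * B + e) * e"
      using small B e by (intro add_left_mono mult_left_mono) auto
    finally show ?thesis .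
  qed
  have "(\<lambda>N. complex_of_real (integral\<^sup>L (P N) g)) \<longlonglongrightarrow> complex_of_real (integral\<^sup>L Q g)"
    using integral_trig_sum_tendsto[OF P Q conv g(1)] by simp
  then have "(\<lambda>N. integral\<^sup>L (P N) g) \<longlonglongrightarrow> integral\<^sup>L Q g"
    using tendsto_of_real_iff by blast
  from LIMSEQ_D[OF this e(1)] obtain N2 where
    N2: "\<And>N. N \<ge> N2 \<Longrightarrow> \<bar>integral\<^sup>L (P N) g - integral\<^sup>L Q g\<bar> < e"
    by auto
  show "\<exists>no. \<forall>N\<ge>no. norm (integral\<^sup>L (P N) f - integral\<^sup>L Q f) < \<epsilon>"
  proof (intro exI allI impI)
    fix N assume N: "N \<ge> max N1 N2"
    have "\<bar>integral\<^sup>L (P N) f - integral\<^sup>L Q f\<bar> < 3 * e + 2 * ((2 * B + e) * e)"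
      using close[OF P N1, of N] close[OF Q n] N2[of N] N by auto
    also have "\<dots> \<le> 3 * e + 2 * ((2 * B + 1) * e)"
      using e B by (intro add_left_mono mult_left_mono mult_right_mono) auto
    also have "\<dots> \<le> \<epsilon>"
      using e(3) e(1) B by (simp add: field_simps)
    finally show "norm (integral\<^sup>L (P N) f - integral\<^sup>L Q f) < \<epsilon>"
      by simp
  qed
qed

section \<open>Slutsky's lemma\<close>

text \<open>Continuity is available only at the points (z, c), so uniform continuity on a compact
  neighbourhood is not an option. A sequence of counterexamples has a subsequence converging to some
  (z0, c), and continuity at this single point contradicts it.\<close>

lemma compact_nhds_uniform:
  fixes h :: "'a::metric_space \<Rightarrow> 'b::metric_space \<Rightarrow> real"
  assumes K: "compact K" and cont: "\<And>z. isCont (case_prod h) (z, c)" and e: "e > 0"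
  obtains d where "d > 0" "\<And>z c'. z \<in> K \<Longrightarrow> dist c' c < d \<Longrightarrow> \<bar>h z c' - h z c\<bar> \<le> e"
proof -
  have "\<exists>d>0. \<forall>z\<in>K. \<forall>c'. dist c' c < d \<longrightarrow> \<bar>h z c' - h z c\<bar> \<le> e"
  proof (rule ccontr)
    assume "\<not> ?thesis"
    then have "\<forall>d>0. \<exists>z\<in>K. \<exists>c'. dist c' c < d \<and> \<bar>h z c' - h z c\<bar> > e"
      by (force simp: not_le)
    then have "\<forall>k. \<exists>z c'. z \<in> K \<and> dist c' c < inverse (real (Suc k)) \<and> \<bar>h z c' - h z c\<bar> > e"
      by (metis inverse_positive_iff_positive of_nat_0_less_iff zero_less_Suc)
    then obtain z c' where z: "\<And>k. z k \<in> K" and c': "\<And>k. dist (c' k) c < inverse (real (Suc k))"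
      and far: "\<And>k. \<bar>h (z k) (c' k) - h (z k) c\<bar> > e"
      by metis
    from K z obtain z0 r where "z0 \<in> K" and r: "strict_mono r" and lim: "(z \<circ> r) \<longlonglongrightarrow> z0"
      unfolding compact_def by blast
    have "c' \<longlonglongrightarrow> c"
      by (rule metric_tendsto_imp_tendsto[OF LIMSEQ_inverse_real_of_nat])
        (use c' in \<open>auto intro!: always_eventually simp: less_imp_le\<close>)
    then have c'_lim: "(c' \<circ> r) \<longlonglongrightarrow> c"
      using r by (rule LIMSEQ_subseq_LIMSEQ)
    have "(\<lambda>k. case_prod h ((z \<circ> r) k, (c' \<circ> r) k)) \<longlonglongrightarrow> case_prod h (z0, c)"
      by (rule isCont_tendsto_compose[OF cont tendsto_Pair[OF lim c'_lim]])
    moreover have "(\<lambda>k. case_prod h ((z \<circ> r) k, c)) \<longlonglongrightarrow> case_prod h (z0, c)"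
      by (rule isCont_tendsto_compose[OF cont tendsto_Pair[OF lim tendsto_const]])
    ultimately have "(\<lambda>k. \<bar>h (z (r k)) (c' (r k)) - h (z (r k)) c\<bar>) \<longlonglongrightarrow> \<bar>h z0 c - h z0 c\<bar>"
      using tendsto_rabs[OF tendsto_diff] by fastforce
    then have "eventually (\<lambda>k. \<bar>h (z (r k)) (c' (r k)) - h (z (r k)) c\<bar> < e) sequentially"
      using e by (intro order_tendstoD) auto
    then obtain k where "\<bar>h (z (r k)) (c' (r k)) - h (z (r k)) c\<bar> < e"
      unfolding eventually_sequentially by blast
    with far[of "r k"] show False
      by simp
  qed
  then show thesis
    using that by blast
qed

text \<open>On the event that \<open>Z N\<close> lies in a large ball and \<open>C N\<close> is
  close to \<open>c\<close>, replacing \<open>C N\<close> by \<open>c\<close> costs at most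
  \<open>e\<close>. Weak convergence makes the ball likely and convergence in probability handles
  \<open>C N\<close>; on the rest the cost is at most 2 B.\<close>

lemma slutsky_integral:
  fixes Z :: "nat \<Rightarrow> 'o \<Rightarrow> real ^ 'n" and C :: "nat \<Rightarrow> 'o \<Rightarrow> 'b::metric_space"
    and h :: "real ^ 'n \<Rightarrow> 'b \<Rightarrow> real"
  assumes M: "prob_space M" and P: "prob_space P" "sets P = sets borel"
    and Z[measurable]: "\<And>N. Z N \<in> borel_measurable M"
    and ZP: "weak_conv_vec (\<lambda>N. distr M borel (Z N)) P"
    and C: "tends_in_prob M C c"
    and cont: "\<And>z. isCont (case_prod h) (z, c)"
    and bdd: "\<And>z c'. \<bar>h z c'\<bar> \<le> B"
    and meas: "eventually (\<lambda>N. (\<lambda>\<omega>. h (Z N \<omega>) (C N \<omega>)) \<in> borel_measurable M) sequentially"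
  shows "(\<lambda>N. \<integral>\<omega>. h (Z N \<omega>) (C N \<omega>) \<partial>M) \<longlonglongrightarrow> (\<integral>z. h z c \<partial>P)"
proof -
  interpret prob_space M by (rule M)
  interpret P: prob_space P by (rule P)
  note weak = ZP[unfolded weak_conv_vec_def, rule_format]
  have B: "B \<ge> 0"
    using bdd[of 0 c] by simp
  have C_meas: "C N \<in> borel_measurable M" for N
    using C by (simp add: tends_in_prob_def)
  have dist_meas[measurable]: "(\<lambda>\<omega>. dist (C N \<omega>) c) \<in> borel_measurable M" for N
    by (rule measurable_compose[OF C_meas]) (intro borel_measurable_continuous_onI continuous_intros)
  have hc_cont: "continuous_on UNIV (\<lambda>z. h z c)"
  proof (rule continuous_at_imp_continuous_on, rule ballI)
    fix z
    show "isCont (\<lambda>z. h z c) z"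
      using isCont_o2[of z "\<lambda>z. (z, c)" "case_prod h"] cont[of z] by simp
  qed
  then have [measurable]: "(\<lambda>z. h z c) \<in> borel_measurable borel"
    by (rule borel_measurable_continuous_onI)
  have ramp_cont: "continuous_on UNIV (\<lambda>z :: real ^ 'n. ramp n (norm z))" for n
    by (intro continuous_on_compose2[OF continuous_on_ramp[of UNIV]] continuous_intros) auto
  have main: "(\<lambda>N. \<integral>\<omega>. h (Z N \<omega>) c \<partial>M) \<longlonglongrightarrow> (\<integral>z. h z c \<partial>P)"
  proof -
    have "bounded (range (\<lambda>z. h z c))"
      using bdd[of _ c] by (intro boundedI[of _ B]) auto
    from weak[OF conjI[OF hc_cont this]] show ?thesis
      by (simp add: integral_distr)
  qed
  have "(\<lambda>N. (\<integral>\<omega>. h (Z N \<omega>) (C N \<omega>) \<partial>M) - (\<integral>\<omega>. h (Z N \<omega>) c \<partial>M)) \<longlonglongrightarrow> 0"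
  proof (rule LIMSEQ_I)
    fix \<epsilon> :: real assume \<epsilon>: "\<epsilon> > 0"
    \<comment> \<open>The total error is at most e + 2 B (e + e), one \<open>e\<close> for each bad
      event, and this equals \<epsilon> - e.\<close>
    define e where "e = \<epsilon> / (2 + 4 * B)"
    have e: "e > 0" "e + 2 * B * (e + e) < \<epsilon>"
    proof -
      have pos: "2 + 4 * B > 0"
        using B by simp
      then show "e > 0"
        using \<epsilon> by (simp add: e_def)
      have "e * (2 + 4 * B) = \<epsilon>"
        using pos by (simp add: e_def)
      then show "e + 2 * B * (e + e) < \<epsilon>"
        using \<open>e > 0\<close> by (simp add: algebra_simps)
    qed
    have "(\<lambda>n. \<integral>z. ramp n (norm z) \<partial>P) \<longlonglongrightarrow> 0"
      by (rule P.integral_ramp_tendsto) (simp add: measurable_cong_sets[OF P(2) refl])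
    from order_tendstoD(2)[OF this e(1)] obtain n where n: "(\<integral>z. ramp n (norm z) \<partial>P) < e"
      unfolding eventually_sequentially by blast
    have "(\<lambda>N. \<integral>\<omega>. ramp n (norm (Z N \<omega>)) \<partial>M) \<longlonglongrightarrow> (\<integral>z. ramp n (norm z) \<partial>P)"
    proof -
      have "bounded (range (\<lambda>z :: real ^ 'n. ramp n (norm z)))"
        using ramp_nonneg[of n] ramp_le_1[of n] by (intro boundedI[of _ 1]) auto
      from weak[OF conjI[OF ramp_cont this]] show ?thesis
        by (simp add: integral_distr)
    qed
    then have tail: "eventually (\<lambda>N. (\<integral>\<omega>. ramp n (norm (Z N \<omega>)) \<partial>M) < e) sequentially"
      using n by (rule order_tendstoD)
    obtain d where d: "d > 0"
      and hd: "\<And>z c'. z \<in> cball 0 (real n + 1) \<Longrightarrow> dist c' c < d \<Longrightarrow> \<bar>h z c' - h z c\<bar> \<le> e"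
      using compact_nhds_uniform[OF compact_cball cont e(1)] by metis
    \<comment> \<open>Half of \<open>d\<close>, because outside \<open>F N\<close> the distance is
      bounded only non-strictly, while \<open>hd\<close> asks for a strict inequality.\<close>
    define F where "F N = {\<omega> \<in> space M. dist (C N \<omega>) c > d / 2}" for N
    have [measurable]: "F N \<in> sets M" for N
      unfolding F_def by measurable
    have "(\<lambda>N. measure M (F N)) \<longlonglongrightarrow> 0"
      using C half_gt_zero[OF d] unfolding tends_in_prob_def F_def by blast
    then have "eventually (\<lambda>N. measure M (F N) < e) sequentially"
      using e(1) by (rule order_tendstoD)
    with tail meas have "eventually (\<lambda>N. norm ((\<integral>\<omega>. h (Z N \<omega>) (C N \<omega>) \<partial>M)
        - (\<integral>\<omega>. h (Z N \<omega>) c \<partial>M) - 0) < \<epsilon>) sequentially"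
    proof eventually_elim
      case (elim N)
      note [measurable] = elim(2)
      have int: "integrable M (\<lambda>\<omega>. h (Z N \<omega>) (C N \<omega>))" "integrable M (\<lambda>\<omega>. h (Z N \<omega>) c)"
        using bdd by (auto intro!: integrable_const_bound[where B=B])
      have int_F: "integrable M (indicator (F N) :: 'o \<Rightarrow> real)"
        by (rule integrable_real_indicator) (auto simp: less_top[symmetric])
      have int_ramp: "integrable M (\<lambda>\<omega>. ramp n (norm (Z N \<omega>)))"
        by (rule integrable_ramp) simp
      have "\<bar>h (Z N \<omega>) (C N \<omega>) - h (Z N \<omega>) c\<bar>
          \<le> e + 2 * B * (ramp n (norm (Z N \<omega>)) + indicator (F N) \<omega>)" if "\<omega> \<in> space M" for \<omega>
      proof (cases "norm (Z N \<omega>) \<le> real n + 1 \<and> dist (C N \<omega>) c < d")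
        case True
        then have "\<bar>h (Z N \<omega>) (C N \<omega>) - h (Z N \<omega>) c\<bar> \<le> e"
          by (intro hd) auto
        moreover have "0 \<le> 2 * B * (ramp n (norm (Z N \<omega>)) + indicator (F N) \<omega>)"
          using B ramp_nonneg by (intro mult_nonneg_nonneg add_nonneg_nonneg) auto
        ultimately show ?thesis
          by linarith
      next
        case False
        then have "1 \<le> ramp n (norm (Z N \<omega>)) + indicator (F N) \<omega>"
        proof (cases "norm (Z N \<omega>) \<le> real n + 1")
          case True
          with False have "\<omega> \<in> F N"
            using d that by (simp add: F_def)
          then show ?thesis
            using ramp_nonneg by simp
        next
          case False
          then have "ramp n (norm (Z N \<omega>)) = 1"
            by (simp add: ramp_def)
          then show ?thesis
            by simp
        qed
        then have "2 * B * 1 \<le> 2 * B * (ramp n (norm (Z N \<omega>)) + indicator (F N) \<omega>)"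
          using B by (intro mult_left_mono) auto
        moreover have "\<bar>h (Z N \<omega>) (C N \<omega>) - h (Z N \<omega>) c\<bar> \<le> 2 * B"
          using bdd[of "Z N \<omega>" "C N \<omega>"] bdd[of "Z N \<omega>" c] by linarith
        ultimately show ?thesis
          using e(1) by simp
      qed
      then have "(\<integral>\<omega>. \<bar>h (Z N \<omega>) (C N \<omega>) - h (Z N \<omega>) c\<bar> \<partial>M)
          \<le> (\<integral>\<omega>. e + 2 * B * (ramp n (norm (Z N \<omega>)) + indicator (F N) \<omega>) \<partial>M)"
        using int int_ramp int_F
        by (intro integral_mono integrable_abs Bochner_Integration.integrable_diff
            Bochner_Integration.integrable_add integrable_mult_right) auto
      also have "\<dots> = e + 2 * B * ((\<integral>\<omega>. ramp n (norm (Z N \<omega>)) \<partial>M) + measure M (F N))"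
        using int_ramp int_F by (simp add: prob_space)
      also have "\<dots> \<le> e + 2 * B * (e + e)"
        using elim B by (intro add_left_mono mult_left_mono add_mono) auto
      also have "\<dots> < \<epsilon>"
        by (rule e)
      finally have "(\<integral>\<omega>. \<bar>h (Z N \<omega>) (C N \<omega>) - h (Z N \<omega>) c\<bar> \<partial>M) < \<epsilon>" .
      moreover have "\<bar>(\<integral>\<omega>. h (Z N \<omega>) (C N \<omega>) \<partial>M) - (\<integral>\<omega>. h (Z N \<omega>) c \<partial>M)\<bar>
          \<le> (\<integral>\<omega>. \<bar>h (Z N \<omega>) (C N \<omega>) - h (Z N \<omega>) c\<bar> \<partial>M)"
        using int integral_abs_bound[of M "\<lambda>\<omega>. h (Z N \<omega>) (C N \<omega>) - h (Z N \<omega>) c"] by simp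
      ultimately show ?case
        by simp
    qed
    then show "\<exists>no. \<forall>N\<ge>no. norm ((\<integral>\<omega>. h (Z N \<omega>) (C N \<omega>) \<partial>M)
        - (\<integral>\<omega>. h (Z N \<omega>) c \<partial>M) - 0) < \<epsilon>"
      unfolding eventually_sequentially .
  qed
  from tendsto_add[OF this main] show ?thesis
    by simp
qed

text \<open>\<open>T N\<close> carries the measurability: \<open>H\<close> is continuous only at
  points with second component \<open>c\<close>, so the composition need not be measurable for a
  general \<open>N\<close>. Requiring the identity only eventually permits an exceptional
  \<open>N = 0\<close>, where division by zero would interfere.\<close>

lemma slutsky:
  fixes Z :: "nat \<Rightarrow> 'o \<Rightarrow> real ^ 'n" and C :: "nat \<Rightarrow> 'o \<Rightarrow> 'b::metric_space"
    and H :: "real ^ 'n \<Rightarrow> 'b \<Rightarrow> 'c::metric_space" and f :: "'c \<Rightarrow> real"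
  assumes M: "prob_space M" and P: "prob_space P" "sets P = sets borel"
    and Z: "\<And>N. Z N \<in> borel_measurable M"
    and ZP: "weak_conv_vec (\<lambda>N. distr M borel (Z N)) P"
    and C: "tends_in_prob M C c"
    and T: "\<And>N. T N \<in> borel_measurable M"
      "eventually (\<lambda>N. \<forall>\<omega>\<in>space M. T N \<omega> = H (Z N \<omega>) (C N \<omega>)) sequentially"
    and H: "\<And>z. isCont (case_prod H) (z, c)"
    and f: "continuous_on UNIV f" "bounded (range f)"
  shows "(\<lambda>N. integral\<^sup>L (distr M borel (T N)) f)
    \<longlonglongrightarrow> integral\<^sup>L (distr P borel (\<lambda>z. H z c)) f"
proof -
  obtain B where B: "\<And>x. \<bar>f x\<bar> \<le> B"
    using f(2) by (auto simp: bounded_iff)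
  have f_meas: "f \<in> borel_measurable borel"
    using f(1) by (rule borel_measurable_continuous_onI)
  have "continuous_on UNIV (\<lambda>z. H z c)"
  proof (rule continuous_at_imp_continuous_on, rule ballI)
    fix z
    show "isCont (\<lambda>z. H z c) z"
      using isCont_o2[of z "\<lambda>z. (z, c)" "case_prod H"] H[of z] by simp
  qed
  then have H_meas: "(\<lambda>z. H z c) \<in> borel_measurable P"
    by (simp add: measurable_cong_sets[OF P(2) refl] borel_measurable_continuous_onI)
  have "(\<lambda>N. \<integral>\<omega>. f (H (Z N \<omega>) (C N \<omega>)) \<partial>M) \<longlonglongrightarrow> (\<integral>z. f (H z c) \<partial>P)"
  proof (rule slutsky_integral[OF M P Z ZP C _ B])
    show "isCont (\<lambda>(z, c). f (H z c)) (z, c)" for z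
    proof -
      have "isCont f (case_prod H (z, c))"
        using f(1) by (simp add: continuous_on_eq_continuous_at)
      from isCont_o2[OF H this] show ?thesis
        by (simp add: case_prod_unfold)
    qed
    show "eventually (\<lambda>N. (\<lambda>\<omega>. f (H (Z N \<omega>) (C N \<omega>))) \<in> borel_measurable M) sequentially"
      using T(2)
    proof eventually_elim
      case (elim N)
      then have "(\<lambda>\<omega>. f (H (Z N \<omega>) (C N \<omega>))) \<in> borel_measurable M
          \<longleftrightarrow> (\<lambda>\<omega>. f (T N \<omega>)) \<in> borel_measurable M"
        by (intro measurable_cong) simp
      then show ?case
        using measurable_compose[OF T(1) f_meas] by simp
    qed
  qed
  moreover have "eventually (\<lambda>N. (\<integral>\<omega>. f (H (Z N \<omega>) (C N \<omega>)) \<partial>M)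
      = integral\<^sup>L (distr M borel (T N)) f) sequentially"
    using T(2)
    by eventually_elim
      (auto simp: integral_distr[OF T(1) f_meas] intro!: Bochner_Integration.integral_cong)
  ultimately have "(\<lambda>N. integral\<^sup>L (distr M borel (T N)) f) \<longlonglongrightarrow> (\<integral>z. f (H z c) \<partial>P)"
    by (rule Lim_transform_eventually)
  then show ?thesis
    using H_meas f_meas by (simp add: integral_distr)
qed

text \<open>Weak convergence to a point mass is convergence in probability: the test function
  \<open>f\<close> vanishes at \<open>a\<close> and equals 1 from distance \<open>e\<close> on, so
  Markov's inequality bounds the probability by its integral.\<close>

lemma slutsky_in_prob:
  fixes Z :: "nat \<Rightarrow> 'o \<Rightarrow> real ^ 'n" and C :: "nat \<Rightarrow> 'o \<Rightarrow> 'b::metric_space"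
    and H :: "real ^ 'n \<Rightarrow> 'b \<Rightarrow> 'c::metric_space"
  assumes M: "prob_space M" and P: "prob_space P" "sets P = sets borel"
    and Z: "\<And>N. Z N \<in> borel_measurable M"
    and ZP: "weak_conv_vec (\<lambda>N. distr M borel (Z N)) P"
    and C: "tends_in_prob M C c"
    and T: "\<And>N. T N \<in> borel_measurable M"
      "eventually (\<lambda>N. \<forall>\<omega>\<in>space M. T N \<omega> = H (Z N \<omega>) (C N \<omega>)) sequentially"
    and H: "\<And>z. isCont (case_prod H) (z, c)" and const: "\<And>z. H z c = a"
  shows "tends_in_prob M T a"
  unfolding tends_in_prob_def
proof (intro conjI allI impI T(1))
  fix e :: real assume e: "e > 0"
  interpret prob_space M by (rule M)
  define f where "f x = min 1 (dist x a / e)" for x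
  have f_cont: "continuous_on UNIV f"
    unfolding f_def using e by (intro continuous_intros) auto
  then have f_meas: "f \<in> borel_measurable borel"
    by (rule borel_measurable_continuous_onI)
  have f01: "0 \<le> f x" "f x \<le> 1" for x
    using e by (auto simp: f_def)
  have "(\<lambda>N. integral\<^sup>L (distr M borel (T N)) f) \<longlonglongrightarrow> integral\<^sup>L (distr P borel (\<lambda>z. H z c)) f"
    by (rule slutsky[OF M P Z ZP C T H f_cont]) (use f01 in \<open>auto intro!: boundedI[of _ 1]\<close>)
  moreover have "integral\<^sup>L (distr P borel (\<lambda>z. H z c)) f = 0"
    using f_meas by (simp add: integral_distr const f_def)
  moreover have "integral\<^sup>L (distr M borel (T N)) f = (\<integral>\<omega>. f (T N \<omega>) \<partial>M)" for N
    using T(1) f_meas by (rule integral_distr)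
  ultimately have lim: "(\<lambda>N. \<integral>\<omega>. f (T N \<omega>) \<partial>M) \<longlonglongrightarrow> 0"
    by simp
  show "(\<lambda>N. measure M {\<omega> \<in> space M. dist (T N \<omega>) a > e}) \<longlonglongrightarrow> 0"
  proof (rule tendsto_sandwich[OF _ _ tendsto_const lim]; intro always_eventually allI)
    fix N
    have [measurable]: "(\<lambda>\<omega>. f (T N \<omega>)) \<in> borel_measurable M"
      using T(1) f_meas by (rule measurable_compose)
    have int: "integrable M (\<lambda>\<omega>. f (T N \<omega>))"
      using f01 by (intro integrable_const_bound[where B=1]) auto
    have "{\<omega> \<in> space M. f (T N \<omega>) \<ge> 1} \<in> sets M"
      by measurable
    then have "measure M {\<omega> \<in> space M. dist (T N \<omega>) a > e} \<le> measure M {\<omega> \<in> space M. f (T N \<omega>) \<ge> 1}"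
      using e by (intro finite_measure_mono) (auto simp: f_def)
    also have "\<dots> \<le> (\<integral>\<omega>. f (T N \<omega>) \<partial>M) / 1"
      using f01 by (intro integral_Markov_inequality_measure[OF int, of "{}"]) auto
    finally show "measure M {\<omega> \<in> space M. dist (T N \<omega>) a > e} \<le> (\<integral>\<omega>. f (T N \<omega>) \<partial>M)"
      by simp
  qed simp
qed

section \<open>Matrix algebra\<close>

lemma bounded_bilinear_matrix_mult:
  "bounded_bilinear ((**) :: real ^ 'n ^ 'm \<Rightarrow> real ^ 'p ^ 'n \<Rightarrow> real ^ 'p ^ 'm)"
  unfolding bilinear_conv_bounded_bilinear[symmetric] bilinear_def
  by (auto intro!: linearI simp: vec_eq_iff matrix_matrix_mult_def sum.distrib[symmetric]
      sum_distrib_left algebra_simps)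

lemma bounded_linear_transpose: "bounded_linear (transpose :: real ^ 'n ^ 'm \<Rightarrow> real ^ 'm ^ 'n)"
  unfolding linear_conv_bounded_linear[symmetric]
  by (auto intro!: linearI simp: vec_eq_iff transpose_def)

lemma bounded_linear_vec_of: "bounded_linear (vec_of :: real ^ 'n ^ 'm \<Rightarrow> real ^ ('n \<times> 'm))"
  unfolding linear_conv_bounded_linear[symmetric]
  by (auto intro!: linearI simp: vec_eq_iff vec_of_def)

lemmas matrix_ring_simps =
  bounded_bilinear.add_left[OF bounded_bilinear_matrix_mult]
  bounded_bilinear.add_right[OF bounded_bilinear_matrix_mult]
  bounded_bilinear.diff_left[OF bounded_bilinear_matrix_mult]
  bounded_bilinear.diff_right[OF bounded_bilinear_matrix_mult]
  bounded_bilinear.scaleR_left[OF bounded_bilinear_matrix_mult]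
  bounded_bilinear.scaleR_right[OF bounded_bilinear_matrix_mult]
  matrix_mul_assoc

lemmas transpose_simps = matrix_transpose_mul
  linear_add[OF bounded_linear.linear[OF bounded_linear_transpose]]
  linear_diff[OF bounded_linear.linear[OF bounded_linear_transpose]]
  transpose_scalar

lemmas vec_of_simps =
  linear_add[OF bounded_linear.linear[OF bounded_linear_vec_of]]
  linear_diff[OF bounded_linear.linear[OF bounded_linear_vec_of]]
  linear_scale[OF bounded_linear.linear[OF bounded_linear_vec_of]]

definition mat_of :: "real ^ ('q \<times> 'p) \<Rightarrow> real ^ 'q ^ 'p" where
  "mat_of x = (\<chi> i j. x $ (j, i))"

lemma vec_of_mat_of [simp]: "vec_of (mat_of x) = x"
  by (simp add: vec_of_def mat_of_def vec_eq_iff)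

lemma mat_of_vec_of [simp]: "mat_of (vec_of M) = M"
  by (simp add: vec_of_def mat_of_def vec_eq_iff)

lemma bounded_linear_mat_of: "bounded_linear (mat_of :: real ^ ('n \<times> 'm) \<Rightarrow> real ^ 'n ^ 'm)"
  unfolding linear_conv_bounded_linear[symmetric]
  by (auto intro!: linearI simp: vec_eq_iff mat_of_def)

lemma row_mult_transpose: "(P ** transpose Q) $ d = Q *v (P $ d)" for P :: "real ^ 'n ^ 'm" and Q :: "real ^ 'n ^ 'k"
  by (simp add: vec_eq_iff matrix_matrix_mult_def transpose_def matrix_vector_mult_def mult.commute)

lemma inner_vec_of: "vec_of P \<bullet> vec_of Q = (\<Sum>d\<in>UNIV. P $ d \<bullet> Q $ d)" for P Q :: "real ^ 'n ^ 'm"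
proof -
  have "vec_of P \<bullet> vec_of Q = (\<Sum>l\<in>UNIV. \<Sum>d\<in>UNIV. P $ d $ l * Q $ d $ l)"
    by (simp add: inner_vec_def vec_of_def UNIV_Times_UNIV[symmetric] sum.cartesian_product'
        del: UNIV_Times_UNIV)
  also have "\<dots> = (\<Sum>d\<in>UNIV. P $ d \<bullet> Q $ d)"
    by (subst sum.swap) (simp add: inner_vec_def)
  finally show ?thesis .
qed

lemma dist_sq_matrix: "(dist P Q)\<^sup>2 = (\<Sum>l\<in>UNIV. \<Sum>m\<in>UNIV. (P $ l $ m - Q $ l $ m)\<^sup>2)"
  for P Q :: "real ^ 'n ^ 'm"
  by (simp add: dist_norm norm_vec_def L2_set_def sum_nonneg)

section \<open>Inverse matrices\<close>

lemma matrix_inv: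
  fixes A :: "real ^ 'n ^ 'm"
  assumes "invertible A"
  shows matrix_inv_right: "A ** matrix_inv A = mat 1" and matrix_inv_left: "matrix_inv A ** A = mat 1"
proof -
  have "A ** matrix_inv A = mat 1 \<and> matrix_inv A ** A = mat 1"
    using assms unfolding matrix_inv_def invertible_def by (rule someI_ex)
  then show "A ** matrix_inv A = mat 1" "matrix_inv A ** A = mat 1"
    by auto
qed

lemma matrix_inv_unique:
  fixes A :: "real ^ 'n ^ 'm"
  assumes "A ** B = mat 1" "B ** A = mat 1"
  shows "matrix_inv A = B"
proof -
  have "invertible A"
    using assms by (auto simp: invertible_def)
  then show ?thesis
    by (metis assms(1) matrix_inv_left matrix_mul_assoc matrix_mul_lid matrix_mul_rid)
qed

lemma invertible_matrix_inv:
  fixes A :: "real ^ 'n ^ 'm"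
  shows "invertible A \<Longrightarrow> invertible (matrix_inv A)"
  using matrix_inv_left matrix_inv_right by (force simp: invertible_def)

lemma transpose_matrix_inv:
  fixes A :: "real ^ 'n ^ 'n"
  assumes "invertible A"
  shows "transpose (matrix_inv A) = matrix_inv (transpose A)"
  by (rule matrix_inv_unique[symmetric])
    (simp_all add: matrix_transpose_mul[symmetric] matrix_inv[OF assms])

lemma matrix_inv_scaleR:
  fixes A :: "real ^ 'n ^ 'n"
  assumes "invertible A" "c \<noteq> 0"
  shows "matrix_inv (c *\<^sub>R A) = inverse c *\<^sub>R matrix_inv A"
  using assms(2) by (intro matrix_inv_unique) (simp_all add: matrix_ring_simps matrix_inv[OF assms(1)])

lemma continuous_on_det: "continuous_on S (det :: real ^ 'n ^ 'n \<Rightarrow> real)"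
  unfolding det_def by (intro continuous_intros)

lemma isCont_det: "isCont (det :: real ^ 'n ^ 'n \<Rightarrow> real) A"
  using continuous_on_det[where S=UNIV and 'n='n] by (simp add: continuous_on_eq_continuous_at)

definition replace_column :: "'n::finite \<Rightarrow> real ^ 'n \<Rightarrow> real ^ 'n ^ 'n \<Rightarrow> real ^ 'n ^ 'n" where
  "replace_column k b A = (\<chi> i j. if j = k then b $ i else A $ i $ j)"

lemma continuous_on_replace_column:
  fixes k :: "'n::finite"
  shows "continuous_on S (replace_column k b)"
proof -
  have "continuous_on S (\<lambda>A :: real ^ 'n ^ 'n. if j = k then b $ i else A $ i $ j)" for i j :: 'n
    by (cases "j = k") (auto intro!: continuous_intros)
  then show ?thesis
    unfolding replace_column_def by (intro continuous_intros)
qed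

text \<open>Column \<open>j\<close> of the inverse solves a linear system with right-hand side
  \<open>axis j 1\<close>. The resulting quotients of determinants make inversion visibly
  continuous.\<close>

lemma matrix_inv_cramer:
  fixes A :: "real ^ 'n ^ 'n"
  assumes "det A \<noteq> 0"
  shows "matrix_inv A = (\<chi> k j. det (replace_column k (axis j 1) A) / det A)"
proof -
  have inv: "invertible A"
    using assms by (simp add: invertible_det_nz)
  have "matrix_inv A $ k $ j = det (replace_column k (axis j 1) A) / det A" for k j
  proof -
    have "A *v (matrix_inv A *v axis j 1) = axis j 1"
      by (simp add: matrix_vector_mul_assoc matrix_inv[OF inv])
    then have "matrix_inv A *v axis j 1
        = (\<chi> k. det (\<chi> i j'. if j' = k then axis j 1 $ i else A $ i $ j') / det A)"
      using cramer[OF assms] by blast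
    then show ?thesis
      by (simp add: vec_eq_iff matrix_vector_mult_basis column_def replace_column_def)
  qed
  then show ?thesis
    by (simp add: vec_eq_iff)
qed

lemma isCont_matrix_inv:
  fixes A :: "real ^ 'n ^ 'n"
  assumes "invertible A"
  shows "isCont matrix_inv A"
proof -
  have nz: "det A \<noteq> 0"
    using assms by (simp add: invertible_det_nz)
  have "eventually (\<lambda>B. det B \<noteq> 0) (nhds A)"
    using tendsto_imp_eventually_ne[OF isCont_det[unfolded isCont_def] nz] nz
    by (simp add: eventually_at_filter) (auto elim: eventually_mono)
  then have "eventually (\<lambda>B. matrix_inv B = (\<chi> k j. det (replace_column k (axis j 1) B) / det B)) (nhds A)"
    by eventually_elim (rule matrix_inv_cramer)
  moreover have "isCont (\<lambda>B :: real ^ 'n ^ 'n. det (replace_column k b B)) A" for k b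
  proof -
    have "continuous_on UNIV (\<lambda>B :: real ^ 'n ^ 'n. det (replace_column k b B))"
      by (rule continuous_on_compose2[OF continuous_on_det continuous_on_replace_column]) auto
    then show ?thesis
      by (simp add: continuous_on_eq_continuous_at)
  qed
  then have "isCont (\<lambda>B. \<chi> k j. det (replace_column k (axis j 1) B) / det B) A"
    unfolding isCont_def using nz isCont_det[of A, unfolded isCont_def] by (intro tendsto_intros) auto
  ultimately show ?thesis
    by (subst isCont_cong)
qed

text \<open>
  All non-invertible matrices have the same junk inverse: the choice is made from the predicate
  that is constantly false.
\<close>
lemma borel_measurable_matrix_inv [measurable]:
  "(matrix_inv :: real ^ 'n ^ 'n \<Rightarrow> real ^ 'n ^ 'n) \<in> borel_measurable borel"
proof -
  define J :: "real ^ 'n ^ 'n" where "J = (SOME B. False)"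
  have junk: "matrix_inv A = J" if "\<not> invertible A" for A :: "real ^ 'n ^ 'n"
  proof -
    have "(\<lambda>B. A ** B = mat 1 \<and> B ** A = mat 1) = (\<lambda>B. False)"
      using that by (auto simp: invertible_def)
    then show ?thesis
      unfolding matrix_inv_def J_def by metis
  qed
  have "open {A :: real ^ 'n ^ 'n. det A \<noteq> 0}"
    by (intro open_Collect_neq continuous_on_det continuous_on_const)
  then have "{A :: real ^ 'n ^ 'n. invertible A} \<in> sets borel"
    by (simp add: invertible_det_nz)
  moreover have "continuous_on {A :: real ^ 'n ^ 'n. invertible A} matrix_inv"
    by (auto intro: continuous_at_imp_continuous_on isCont_matrix_inv)
  ultimately have "(\<lambda>A :: real ^ 'n ^ 'n. if A \<in> {A. invertible A} then matrix_inv A else J)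
      \<in> borel_measurable borel"
    by (rule borel_measurable_continuous_on_if) (auto intro: continuous_on_const)
  also have "(\<lambda>A :: real ^ 'n ^ 'n. if A \<in> {A. invertible A} then matrix_inv A else J) = matrix_inv"
    using junk by auto
  finally show ?thesis .
qed

section \<open>Positive definite matrices\<close>

lemma dot_matrix_vector_transpose:
  fixes V :: "real ^ 'n ^ 'm"
  shows "u \<bullet> (V *v w) = (transpose V *v u) \<bullet> w"
  by (simp add: dot_lmul_matrix)

lemma pos_def_matrixD:
  assumes "pos_def_matrix V"
  shows "transpose V = V" "u \<noteq> 0 \<Longrightarrow> u \<bullet> (V *v u) > 0" "u \<bullet> (V *v u) \<ge> 0"
  using assms by (auto simp: pos_def_matrix_def less_imp_le) (cases "u = 0"; auto simp: less_imp_le)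

text \<open>Gram-Schmidt for the inner product defined by \<open>V\<close>, by induction on the
  index set so that vectors are indexed by the type \<open>'n\<close> itself.\<close>

lemma pos_def_matrix_orthonormal:
  fixes V :: "real ^ 'n ^ 'n" and I :: "'n set"
  assumes V: "pos_def_matrix V"
  shows "\<exists>v. \<forall>i\<in>I. \<forall>j\<in>I. v i \<bullet> (V *v v j) = (if i = j then 1 else 0)"
  using finite[of I]
proof induction
  case empty
  show ?case by simp
next
  case (insert a I)
  have sym: "u \<bullet> (V *v w) = w \<bullet> (V *v u)" for u w
    by (metis dot_matrix_vector_transpose inner_commute pos_def_matrixD(1)[OF V])
  from insert obtain v where v: "\<And>i j. i \<in> I \<Longrightarrow> j \<in> I \<Longrightarrow> v i \<bullet> (V *v v j) = (if i = j then 1 else 0)"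
    by blast
  \<comment> \<open>Fewer vectors than the dimension have been chosen so far, so some
    \<open>x\<close> lies outside their span and its orthogonalized form \<open>y\<close> is
    nonzero.\<close>
  have "dim (span (v ` I)) \<le> card (v ` I)"
    by (rule dim_le_card) (auto simp: span_mono)
  also have "\<dots> \<le> card I"
    by (rule card_image_le) simp
  also have "\<dots> < CARD('n)"
    using insert(2) by (intro psubset_card_mono) auto
  finally have "span (v ` I) \<noteq> UNIV"
    by (metis DIM_cart DIM_real dim_UNIV mult.right_neutral order_less_irrefl)
  then obtain x where x: "x \<notin> span (v ` I)"
    by auto
  define y where "y = x - (\<Sum>i\<in>I. (v i \<bullet> (V *v x)) *\<^sub>R v i)"
  have "y \<noteq> 0"
  proof
    assume "y = 0"
    then have "x = (\<Sum>i\<in>I. (v i \<bullet> (V *v x)) *\<^sub>R v i)"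
      by (simp add: y_def)
    also have "\<dots> \<in> span (v ` I)"
      by (intro span_sum span_scale span_base) auto
    finally show False
      using x by simp
  qed
  then have pos: "y \<bullet> (V *v y) > 0"
    by (rule pos_def_matrixD(2)[OF V])
  have orth: "y \<bullet> (V *v v j) = 0" if "j \<in> I" for j
  proof -
    have "y \<bullet> (V *v v j) = x \<bullet> (V *v v j)
        - (\<Sum>i\<in>I. (v i \<bullet> (V *v x)) * (if i = j then 1 else 0))"
      unfolding y_def inner_diff_left inner_sum_left inner_scaleR_left
      using that v by (auto intro!: sum.cong)
    also have "\<dots> = 0"
      using that sym[of x "v j"] by (simp add: if_distrib cong: if_cong)
    finally show ?thesis .
  qed
  define w where "w = (1 / sqrt (y \<bullet> (V *v y))) *\<^sub>R y"
  have w: "w \<bullet> (V *v w) = 1"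
    using pos by (simp add: w_def matrix_vector_mult_scaleR)
  have wj: "w \<bullet> (V *v v j) = 0" "v j \<bullet> (V *v w) = 0" if "j \<in> I" for j
    using orth[OF that] sym[of "v j" w] by (simp_all add: w_def)
  show ?case
    using v w wj insert(2) by (intro exI[of _ "v(a := w)"]) auto
qed

text \<open>A \<open>V\<close>-orthonormal basis, written as the rows of \<open>W\<close>, turns
  \<open>V\<close> into the identity by congruence; undoing the congruence gives \<open>F\<close>.
  Such a factor serves wherever a square root of \<open>V\<close> would.\<close>

lemma pos_def_matrix_factor:
  fixes V :: "real ^ 'n ^ 'n"
  assumes "pos_def_matrix V"
  obtains F :: "real ^ 'n ^ 'n" where "invertible F" "F ** transpose F = V"
proof -
  obtain v :: "'n \<Rightarrow> real ^ 'n" where v: "\<And>i j. v i \<bullet> (V *v v j) = (if i = j then 1 else 0)"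
    using pos_def_matrix_orthonormal[OF assms, of UNIV] by auto
  define W where "W = (\<chi> i. v i)"
  have "(W ** V ** transpose W) $ i $ j = mat 1 $ i $ j" for i j
  proof -
    have "(W ** V ** transpose W) $ i $ j = v i \<bullet> (V *v v j)"
      unfolding matrix_mul_assoc[symmetric]
      by (simp add: matrix_matrix_mult_def inner_vec_def matrix_vector_mult_def W_def transpose_def)
    then show ?thesis
      by (simp add: v mat_def)
  qed
  then have *: "W ** V ** transpose W = mat 1"
    by (simp add: vec_eq_iff)
  then have inv: "invertible W"
    by (metis invertible_right_inverse matrix_mul_assoc)
  let ?F = "matrix_inv W"
  have tF: "transpose W ** transpose ?F = mat 1"
    by (simp add: matrix_transpose_mul[symmetric] matrix_inv[OF inv])
  have "?F ** transpose ?F = ?F ** (W ** V ** transpose W) ** transpose ?F"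
    using * by simp
  also have "\<dots> = (?F ** W) ** V ** (transpose W ** transpose ?F)"
    by (simp only: matrix_mul_assoc)
  also have "\<dots> = V"
    by (simp add: tF matrix_inv[OF inv])
  finally show thesis
    using that invertible_matrix_inv[OF inv] by blast
qed

lemma pos_def_matrix_invertible:
  fixes V :: "real ^ 'n ^ 'n"
  assumes "pos_def_matrix V"
  shows "invertible V"
  using pos_def_matrix_factor[OF assms] invertible_mult transpose_invertible by metis

lemma pos_def_matrix_mult_transpose:
  fixes F :: "real ^ 'n ^ 'n"
  assumes "invertible F"
  shows "pos_def_matrix (F ** transpose F)"
  unfolding pos_def_matrix_def
proof (intro conjI allI impI)
  show "transpose (F ** transpose F) = F ** transpose F"
    by (simp add: matrix_transpose_mul)
  fix u :: "real ^ 'n" assume "u \<noteq> 0"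
  have "inj ((*v) (transpose F))"
    by (rule inj_matrix_vector_mult[OF transpose_invertible[OF assms]])
  with \<open>u \<noteq> 0\<close> have "transpose F *v u \<noteq> 0"
    by (metis injD matrix_vector_mult_0_right)
  moreover have "u \<bullet> ((F ** transpose F) *v u) = (transpose F *v u) \<bullet> (transpose F *v u)"
    by (simp only: matrix_vector_mul_assoc[symmetric] dot_matrix_vector_transpose)
  ultimately show "u \<bullet> ((F ** transpose F) *v u) > 0"
    by simp
qed

lemma pos_def_matrix_inv:
  fixes V :: "real ^ 'n ^ 'n"
  assumes V: "pos_def_matrix V"
  shows "pos_def_matrix (matrix_inv V)"
  unfolding pos_def_matrix_def
proof (intro conjI allI impI)
  note inv = pos_def_matrix_invertible[OF V]
  show "transpose (matrix_inv V) = matrix_inv V"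
    by (simp add: transpose_matrix_inv[OF inv] pos_def_matrixD(1)[OF V])
  fix u :: "real ^ 'n" assume "u \<noteq> 0"
  have u: "V *v (matrix_inv V *v u) = u"
    by (simp add: matrix_vector_mul_assoc matrix_inv[OF inv])
  with \<open>u \<noteq> 0\<close> have "matrix_inv V *v u \<noteq> 0"
    by auto
  from pos_def_matrixD(2)[OF V this] show "u \<bullet> (matrix_inv V *v u) > 0"
    by (simp add: u inner_commute)
qed

text \<open>Applied to the inverses of \<Gamma> and \<Sigma>, it makes the matrix inverted in
  \<open>Sigma_star\<close> nonsingular for every \<open>A\<close>, so that \<open>A_star\<close>
  and \<open>Theta\<close> are continuous everywhere.\<close>

lemma pos_def_matrix_add_congruence:
  fixes G :: "real ^ 'l ^ 'l" and K :: "real ^ 'd ^ 'd" and A :: "real ^ 'l ^ 'd"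
  assumes "pos_def_matrix G" "pos_def_matrix K"
  shows "pos_def_matrix (G + transpose A ** K ** A)"
  unfolding pos_def_matrix_def
proof (intro conjI allI impI)
  show "transpose (G + transpose A ** K ** A) = G + transpose A ** K ** A"
    by (simp add: transpose_simps matrix_mul_assoc pos_def_matrixD(1)[OF assms(1)]
        pos_def_matrixD(1)[OF assms(2)])
  fix u :: "real ^ 'l" assume "u \<noteq> 0"
  have "u \<bullet> ((transpose A ** K ** A) *v u) = (A *v u) \<bullet> (K *v (A *v u))"
    by (simp only: matrix_vector_mul_assoc[symmetric] dot_matrix_vector_transpose[of u] transpose_transpose)
  then show "u \<bullet> ((G + transpose A ** K ** A) *v u) > 0"
    using pos_def_matrixD(2)[OF assms(1) \<open>u \<noteq> 0\<close>] pos_def_matrixD(3)[OF assms(2), of "A *v u"]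
    by (simp add: matrix_vector_mult_add_rdistrib inner_add_right)
qed

section \<open>Kronecker products\<close>

lemma kron_mult: "kron A B ** kron C D = kron (A ** C) (B ** D)"
  by (simp add: vec_eq_iff kron_def matrix_matrix_mult_def sum_product mult_ac
      UNIV_Times_UNIV[symmetric] sum.cartesian_product' del: UNIV_Times_UNIV)

lemma transpose_kron: "transpose (kron A B) = kron (transpose A) (transpose B)"
  by (simp add: vec_eq_iff kron_def transpose_def)

lemma kron_mat_1: "kron (mat 1) (mat 1) = mat 1"
  by (auto simp: vec_eq_iff kron_def mat_def prod_eq_iff)

lemma invertible_kron:
  fixes A :: "real ^ 'n ^ 'n" and B :: "real ^ 'm ^ 'm"
  assumes "invertible A" "invertible B"
  shows "invertible (kron A B)"
  unfolding invertible_def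
  by (rule exI[of _ "kron (matrix_inv A) (matrix_inv B)"])
    (simp add: kron_mult matrix_inv[OF assms(1)] matrix_inv[OF assms(2)] kron_mat_1)

text \<open>Factors of \<open>V\<close> and \<open>W\<close> combine to a factor of the Kronecker
  product, by \<open>kron_mult\<close>.\<close>

lemma pos_def_matrix_kron:
  fixes V :: "real ^ 'n ^ 'n" and W :: "real ^ 'm ^ 'm"
  assumes "pos_def_matrix V" "pos_def_matrix W"
  shows "pos_def_matrix (kron V W)"
proof -
  obtain F :: "real ^ 'n ^ 'n" where F: "invertible F" "F ** transpose F = V"
    using pos_def_matrix_factor[OF assms(1)] .
  obtain E :: "real ^ 'm ^ 'm" where E: "invertible E" "E ** transpose E = W"
    using pos_def_matrix_factor[OF assms(2)] .
  have "kron V W = kron F E ** transpose (kron F E)"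
    by (simp add: transpose_kron kron_mult F E)
  then show ?thesis
    using pos_def_matrix_mult_transpose[OF invertible_kron[OF F(1) E(1)]] by simp
qed

text \<open>Testing on vectorized matrices translates identities between Kronecker products and
  commutation matrices into ordinary matrix algebra.\<close>

lemma matrix_eqI_vec_of:
  fixes P Q :: "real ^ ('n::finite \<times> 'm::finite) ^ 'k"
  assumes "\<And>M :: real ^ 'n ^ 'm. P *v vec_of M = Q *v vec_of M"
  shows "P = Q"
  using assms[of "mat_of _"] by (simp add: matrix_eq)

lemma matrix_inv_commutation:
  "matrix_inv (commutation :: real ^ ('d::finite \<times> 'l::finite) ^ ('l \<times> 'd)) = commutation"
  by (intro matrix_inv_unique matrix_eqI_vec_of)
    (simp_all add: matrix_vector_mul_assoc[symmetric] commutation_vec_of)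

lemma transpose_commutation:
  "transpose (commutation :: real ^ ('d::finite \<times> 'l::finite) ^ ('l \<times> 'd)) = commutation"
  by (auto simp: vec_eq_iff commutation_def transpose_def)

section \<open>The differential of the inverse regression map and the asymptotic covariance\<close>

text \<open>
  Solving \<open>(\<Gamma>\<^sup>-\<^sup>1 + A\<^sub>t\<^sup>T \<Sigma>\<^sup>-\<^sup>1 A\<^sub>t) (B\<^sub>t - B) = t \<dots>\<close> for \<open>A\<^sub>t = A + t H\<close> removes the division by \<open>t\<close> from the
  difference quotient, so that no differentiability argument is needed.
\<close>
definition A_star_quotient ::
    "real ^ 'l ^ 'l \<Rightarrow> real ^ 'd ^ 'd \<Rightarrow> real ^ 'l ^ 'd \<Rightarrow> real ^ 'l ^ 'd \<Rightarrow> real \<Rightarrow> real ^ 'd ^ 'l" where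
  "A_star_quotient \<Gamma> \<Sigma> A H t =
     (let K = matrix_inv \<Sigma>; B = A_star \<Gamma> \<Sigma> A in
        Sigma_star \<Gamma> \<Sigma> (A + t *\<^sub>R H)
        ** (transpose H ** K
            - (transpose H ** K ** A + transpose A ** K ** H + t *\<^sub>R (transpose H ** K ** H)) ** B))"

text \<open>The matrix of W \<mapsto> A_star_diff(W \<Gamma>i) on vectorized \<open>W\<close>: the
  rescaled estimation error is asymptotically \<open>W ** \<Gamma>i\<close> with \<open>W\<close>
  the limit of the noise cross products. The commutation matrix produces the transpose of
  \<open>W\<close> in the first two terms of the differential.\<close>

definition limit_map :: "real ^ 'l ^ 'l \<Rightarrow> real ^ 'd ^ 'd \<Rightarrow> real ^ 'l ^ 'd \<Rightarrow> real ^ ('l \<times> 'd) ^ ('d \<times> 'l)" where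
  "limit_map \<Gamma> \<Sigma> A =
     (let S = Sigma_star \<Gamma> \<Sigma> A; B = A_star \<Gamma> \<Sigma> A; \<Gamma>i = matrix_inv \<Gamma> in
        kron (transpose (matrix_inv \<Sigma> ** (mat 1 - A ** B))) (S ** \<Gamma>i) ** commutation
        - kron (transpose (\<Gamma>i ** B)) B)"

lemma A_star_quotient_0: "A_star_quotient \<Gamma> \<Sigma> A H 0 = A_star_diff \<Gamma> \<Sigma> A H"
  by (simp add: A_star_quotient_def A_star_diff_def A_star_def Let_def matrix_ring_simps algebra_simps)

context
  fixes \<Gamma> :: "real ^ 'l ^ 'l" and \<Sigma> :: "real ^ 'd ^ 'd"
  assumes \<Gamma>: "pos_def_matrix \<Gamma>" and \<Sigma>: "pos_def_matrix \<Sigma>"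
begin

lemma Sigma_star_inv:
  "invertible (matrix_inv \<Gamma> + transpose A ** matrix_inv \<Sigma> ** A)"
  "Sigma_star \<Gamma> \<Sigma> A ** (matrix_inv \<Gamma> + transpose A ** matrix_inv \<Sigma> ** A) = mat 1"
  "(matrix_inv \<Gamma> + transpose A ** matrix_inv \<Sigma> ** A) ** Sigma_star \<Gamma> \<Sigma> A = mat 1"
proof -
  show *: "invertible (matrix_inv \<Gamma> + transpose A ** matrix_inv \<Sigma> ** A)"
    by (intro pos_def_matrix_invertible pos_def_matrix_add_congruence pos_def_matrix_inv \<Gamma> \<Sigma>)
  show "Sigma_star \<Gamma> \<Sigma> A ** (matrix_inv \<Gamma> + transpose A ** matrix_inv \<Sigma> ** A) = mat 1"
    "(matrix_inv \<Gamma> + transpose A ** matrix_inv \<Sigma> ** A) ** Sigma_star \<Gamma> \<Sigma> A = mat 1"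
    unfolding Sigma_star_def by (simp_all only: matrix_inv[OF *])
qed

lemma A_star_increment:
  "A_star \<Gamma> \<Sigma> (A + t *\<^sub>R H) = A_star \<Gamma> \<Sigma> A + t *\<^sub>R A_star_quotient \<Gamma> \<Sigma> A H t"
proof -
  define K where "K = matrix_inv \<Sigma>"
  define B where "B = A_star \<Gamma> \<Sigma> A"
  define M where "M A' = matrix_inv \<Gamma> + transpose A' ** K ** A'" for A' :: "real ^ 'l ^ 'd"
  define R where "R = transpose H ** K
    - (transpose H ** K ** A + transpose A ** K ** H + t *\<^sub>R (transpose H ** K ** H)) ** B"
  let ?A = "A + t *\<^sub>R H"
  let ?S = "Sigma_star \<Gamma> \<Sigma> ?A"
  have "M A ** B = (M A ** Sigma_star \<Gamma> \<Sigma> A) ** transpose A ** K"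
    by (simp add: B_def A_star_def K_def matrix_mul_assoc)
  then have MB: "M A ** B = transpose A ** K"
    using Sigma_star_inv(3)[of A] by (simp add: M_def K_def)
  have Mt: "M ?A = M A + t *\<^sub>R (transpose H ** K ** A + transpose A ** K ** H
      + t *\<^sub>R (transpose H ** K ** H))"
    by (simp add: M_def matrix_ring_simps transpose_simps scaleR_add_right)
  \<comment> \<open>\<open>R\<close> collects what must be added when the equation
    \<open>M A ** B = transpose A ** K\<close> is perturbed from \<open>A\<close> to
    \<open>?A\<close>. Multiplying by the inverse of \<open>M ?A\<close> then gives the increment
    exactly, for all \<open>t\<close>.\<close>
  have "M ?A ** B + t *\<^sub>R R = transpose ?A ** K"
    by (simp add: Mt R_def MB matrix_ring_simps(1,2,5) transpose_simps scaleR_add_right scaleR_diff_right)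
  then have "A_star \<Gamma> \<Sigma> ?A = ?S ** (M ?A ** B + t *\<^sub>R R)"
    by (simp add: A_star_def K_def matrix_mul_assoc)
  also have "\<dots> = (?S ** M ?A) ** B + t *\<^sub>R (?S ** R)"
    by (simp add: matrix_ring_simps)
  also have "?S ** M ?A = mat 1"
    using Sigma_star_inv(2)[of ?A] by (simp add: M_def K_def)
  finally show ?thesis
    by (simp add: A_star_quotient_def Let_def R_def K_def B_def)
qed

lemma limit_map_vec_of:
  "limit_map \<Gamma> \<Sigma> A *v vec_of W = vec_of (A_star_diff \<Gamma> \<Sigma> A (W ** matrix_inv \<Gamma>))"
proof -
  have "transpose (matrix_inv \<Gamma>) = matrix_inv \<Gamma>"
    using pos_def_matrix_inv[OF \<Gamma>] by (rule pos_def_matrixD)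
  then show ?thesis
    by (simp add: limit_map_def A_star_diff_def Let_def matrix_vector_mult_diff_rdistrib
        matrix_vector_mul_assoc[symmetric] commutation_vec_of kron_vec_of vec_of_simps[symmetric]
        matrix_ring_simps transpose_simps)
qed

text \<open>The covariance of a linear image, tested on \<open>vec_of U\<close>. The right-hand side
  becomes the differential in an explicit direction, the left-hand side a sum of matrix products,
  and the two are compared term by term.\<close>

lemma Theta_eq_limit_map:
  "Theta \<Gamma> \<Sigma> A = limit_map \<Gamma> \<Sigma> A ** kron \<Gamma> \<Sigma> ** transpose (limit_map \<Gamma> \<Sigma> A)"
proof (rule matrix_eqI_vec_of)
  fix U :: "real ^ 'd ^ 'l"
  define Gi where "Gi = matrix_inv \<Gamma>"
  define K where "K = matrix_inv \<Sigma>"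
  define S where "S = Sigma_star \<Gamma> \<Sigma> A"
  define B where "B = A_star \<Gamma> \<Sigma> A"
  have tr: "transpose \<Gamma> = \<Gamma>" "transpose \<Sigma> = \<Sigma>" "transpose Gi = Gi" "transpose K = K"
    using pos_def_matrixD(1)[OF \<Gamma>] pos_def_matrixD(1)[OF \<Sigma>]
      pos_def_matrixD(1)[OF pos_def_matrix_inv[OF \<Gamma>]] pos_def_matrixD(1)[OF pos_def_matrix_inv[OF \<Sigma>]]
    by (simp_all add: Gi_def K_def)
  have trS: "transpose S = S"
  proof -
    have "transpose S = matrix_inv (transpose (Gi + transpose A ** K ** A))"
      unfolding S_def Sigma_star_def Gi_def K_def by (rule transpose_matrix_inv[OF Sigma_star_inv(1)])
    then show ?thesis
      by (simp add: S_def Sigma_star_def transpose_simps tr Gi_def[symmetric] K_def[symmetric] matrix_mul_assoc)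
  qed
  have inv: "\<Gamma> ** Gi = mat 1" "Gi ** \<Gamma> = mat 1" "\<Sigma> ** K = mat 1" "K ** \<Sigma> = mat 1"
    unfolding Gi_def K_def by (simp_all add: matrix_inv pos_def_matrix_invertible \<Gamma> \<Sigma>)
  have B: "B = S ** transpose A ** K"
    by (simp add: B_def S_def A_star_def K_def)
  have KAB: "transpose (K ** A ** B) = K ** A ** B"
    by (simp add: B transpose_simps tr trS matrix_mul_assoc)
  \<comment> \<open>Obtained by multiplying the defining identity of the inverse \<open>S\<close> by
    \<open>B\<close> on the right, since \<open>S ** transpose A ** K\<close> is
    \<open>B\<close>.\<close>
  have BAB: "B - B ** A ** B = S ** Gi ** B"
  proof -
    have "S ** (Gi + transpose A ** K ** A) ** B = B"
      using Sigma_star_inv(2)[of A] by (simp add: S_def Gi_def K_def)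
    then have "S ** Gi ** B + B ** A ** B = B"
      unfolding B by (simp add: matrix_ring_simps)
    then show ?thesis
      by (metis add_diff_cancel_right')
  qed
  \<comment> \<open>The matrix form of the adjoint of the linearization at \<open>U\<close>.\<close>
  define G where "G = K ** (mat 1 - A ** B) ** transpose U ** S ** Gi - transpose B ** U ** transpose B ** Gi"
  have "transpose (limit_map \<Gamma> \<Sigma> A)
      = commutation ** kron (K ** (mat 1 - A ** B)) (Gi ** S) - kron (Gi ** B) (transpose B)"
    unfolding limit_map_def Let_def Gi_def[symmetric] K_def[symmetric] S_def[symmetric] B_def[symmetric]
    by (simp add: transpose_simps transpose_kron transpose_commutation tr trS)
  then have "transpose (limit_map \<Gamma> \<Sigma> A) *v vec_of U = vec_of G"
    by (simp add: matrix_vector_mult_diff_rdistrib matrix_vector_mul_assoc[symmetric] kron_vec_of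
        commutation_vec_of vec_of_simps[symmetric] G_def transpose_simps tr trS matrix_mul_assoc
        del: transpose_matrix_vector)
  then have "(limit_map \<Gamma> \<Sigma> A ** kron \<Gamma> \<Sigma> ** transpose (limit_map \<Gamma> \<Sigma> A)) *v vec_of U
      = limit_map \<Gamma> \<Sigma> A *v (kron \<Gamma> \<Sigma> *v vec_of G)"
    by (simp only: matrix_vector_mul_assoc[symmetric])
  also have "\<dots> = vec_of (A_star_diff \<Gamma> \<Sigma> A (\<Sigma> ** G ** \<Gamma> ** Gi))"
    by (simp add: kron_vec_of limit_map_vec_of tr Gi_def)
  \<comment> \<open>The covariance contributes \<Gamma> on the right, and the limit map multiplies
    by its inverse.\<close>
  also have "\<Sigma> ** G ** \<Gamma> ** Gi = \<Sigma> ** G"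
    by (simp add: matrix_mul_assoc[symmetric] inv)
  also have "\<Sigma> ** G = (mat 1 - A ** B) ** transpose U ** S ** Gi
      - \<Sigma> ** transpose B ** U ** transpose B ** Gi"
    by (simp add: G_def matrix_ring_simps inv)
  finally have R: "(limit_map \<Gamma> \<Sigma> A ** kron \<Gamma> \<Sigma> ** transpose (limit_map \<Gamma> \<Sigma> A)) *v vec_of U
      = vec_of (A_star_diff \<Gamma> \<Sigma> A ((mat 1 - A ** B) ** transpose U ** S ** Gi
      - \<Sigma> ** transpose B ** U ** transpose B ** Gi))" .
  have "Theta \<Gamma> \<Sigma> A *v vec_of U
     = vec_of (S ** Gi ** S ** U ** transpose (K + transpose B ** transpose A ** K ** A ** B - 2 *\<^sub>R (K ** A ** B))
        + B ** \<Sigma> ** transpose B ** U ** transpose (transpose B ** Gi ** B)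
        - 2 *\<^sub>R (S ** Gi ** (B ** transpose U ** B) - S ** Gi ** (B ** transpose U ** B) ** transpose (transpose B ** transpose A)))"
    unfolding Theta_def Let_def Gi_def[symmetric] K_def[symmetric] S_def[symmetric] B_def[symmetric]
      matrix_inv_commutation
    by (simp add: matrix_vector_mult_diff_rdistrib matrix_vector_mult_add_rdistrib
        matrix_vector_mul_assoc[symmetric] kron_vec_of scaleR_matrix_vector_assoc[symmetric]
        commutation_vec_of vec_of_simps transpose_simps matrix_mul_assoc del: transpose_matrix_vector)
  also have "\<dots> = vec_of (A_star_diff \<Gamma> \<Sigma> A ((mat 1 - A ** B) ** transpose U ** S ** Gi
      - \<Sigma> ** transpose B ** U ** transpose B ** Gi))"
  proof -
    define H where "H = (mat 1 - A ** B) ** transpose U ** S ** Gi - \<Sigma> ** transpose B ** U ** transpose B ** Gi"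
    \<comment> \<open>Both \<open>r1\<close> and \<open>r2\<close> carry an arbitrary left factor
      \<open>X\<close>, so that they still match inside products associated to the left.\<close>
    have r1: "X ** transpose B ** transpose A ** K = X ** K ** A ** B" for X :: "real ^ 'd ^ 'l"
    proof -
      have "transpose B ** transpose A ** K = K ** A ** B"
        using KAB by (simp add: transpose_simps tr matrix_mul_assoc)
      then show ?thesis
        by (metis matrix_mul_assoc)
    qed
    have r2: "X ** \<Sigma> ** K = X" for X :: "real ^ 'd ^ 'l"
      by (metis inv(3) matrix_mul_assoc matrix_mul_rid)
    have tH: "transpose H = Gi ** S ** U ** (mat 1 - transpose B ** transpose A) - Gi ** B ** transpose U ** B ** \<Sigma>"
      by (simp add: H_def transpose_simps tr trS matrix_mul_assoc)
    have "B ** H ** B = (B - B ** A ** B) ** transpose U ** (S ** Gi ** B)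
        - B ** \<Sigma> ** transpose B ** U ** transpose B ** Gi ** B"
      by (simp add: H_def matrix_ring_simps)
    \<comment> \<open>By \<open>BAB\<close>, both expressions contain \<open>S ** Gi ** B\<close> on
      either side of \<open>transpose U\<close>, so the two factors may be exchanged. This makes the
      two cross terms equal and explains the coefficient 2 in \<open>Theta\<close>.\<close>
    also have "\<dots> = S ** Gi ** B ** transpose U ** (B - B ** A ** B)
        - B ** \<Sigma> ** transpose B ** U ** transpose B ** Gi ** B"
      by (simp add: BAB)
    finally have BHB: "B ** H ** B = \<dots>" .
    have "A_star_diff \<Gamma> \<Sigma> A H = S ** transpose H ** K - S ** transpose H ** K ** A ** B - B ** H ** B"
      by (simp add: A_star_diff_def Let_def S_def K_def B_def)
    then show ?thesis
      unfolding H_def[symmetric] BHB tH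
      by (intro arg_cong[where f=vec_of])
        (simp add: transpose_simps tr matrix_ring_simps r1 r2 scaleR_2[where 'a="real ^ 'd ^ 'l"] algebra_simps)
  qed
  finally show "Theta \<Gamma> \<Sigma> A *v vec_of U
      = (limit_map \<Gamma> \<Sigma> A ** kron \<Gamma> \<Sigma> ** transpose (limit_map \<Gamma> \<Sigma> A)) *v vec_of U"
    using R by simp
qed

end

section \<open>Continuity of the matrix operations, of \<open>A_star\<close> and of
  \<open>Theta\<close>\<close>

lemma tendsto_matrix_mult [tendsto_intros]:
  fixes f :: "'x \<Rightarrow> real ^ 'n ^ 'm" and g :: "'x \<Rightarrow> real ^ 'p ^ 'n"
  shows "(f \<longlongrightarrow> P) F \<Longrightarrow> (g \<longlongrightarrow> Q) F \<Longrightarrow> ((\<lambda>x. f x ** g x) \<longlongrightarrow> P ** Q) F"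
  by (rule bounded_bilinear.tendsto[OF bounded_bilinear_matrix_mult])

lemma tendsto_matrix_vector_mult [tendsto_intros]:
  fixes f :: "'x \<Rightarrow> real ^ 'n ^ 'm" and g :: "'x \<Rightarrow> real ^ 'n"
  shows "(f \<longlongrightarrow> P) F \<Longrightarrow> (g \<longlongrightarrow> q) F \<Longrightarrow> ((\<lambda>x. f x *v g x) \<longlongrightarrow> P *v q) F"
  unfolding matrix_vector_mult_def by (intro tendsto_intros)

lemma tendsto_transpose [tendsto_intros]:
  fixes f :: "'x \<Rightarrow> real ^ 'n ^ 'm"
  shows "(f \<longlongrightarrow> P) F \<Longrightarrow> ((\<lambda>x. transpose (f x)) \<longlongrightarrow> transpose P) F"
  by (rule bounded_linear.tendsto[OF bounded_linear_transpose])

lemma tendsto_vec_of [tendsto_intros]: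
  fixes f :: "'x \<Rightarrow> real ^ 'n ^ 'm"
  shows "(f \<longlongrightarrow> P) F \<Longrightarrow> ((\<lambda>x. vec_of (f x)) \<longlongrightarrow> vec_of P) F"
  by (rule bounded_linear.tendsto[OF bounded_linear_vec_of])

lemma tendsto_mat_of [tendsto_intros]:
  fixes f :: "'x \<Rightarrow> real ^ ('n::finite \<times> 'm::finite)"
  shows "(f \<longlongrightarrow> p) F \<Longrightarrow> ((\<lambda>x. mat_of (f x)) \<longlongrightarrow> mat_of p) F"
  by (rule bounded_linear.tendsto[OF bounded_linear_mat_of])

lemma tendsto_kron [tendsto_intros]:
  fixes f :: "'x \<Rightarrow> real ^ 'n ^ 'm" and g :: "'x \<Rightarrow> real ^ 'q ^ 'p"
  shows "(f \<longlongrightarrow> P) F \<Longrightarrow> (g \<longlongrightarrow> Q) F \<Longrightarrow> ((\<lambda>x. kron (f x) (g x)) \<longlongrightarrow> kron P Q) F"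
  unfolding kron_def by (intro tendsto_intros)

lemma tendsto_matrix_inv:
  fixes f :: "'x \<Rightarrow> real ^ 'n ^ 'n"
  shows "(f \<longlongrightarrow> P) F \<Longrightarrow> invertible P \<Longrightarrow> ((\<lambda>x. matrix_inv (f x)) \<longlongrightarrow> matrix_inv P) F"
  using isCont_tendsto_compose[OF isCont_matrix_inv] .

lemma eventually_invertible:
  fixes P :: "real ^ 'n ^ 'n"
  assumes "invertible P"
  shows "eventually invertible (nhds P)"
proof -
  have "open {Q :: real ^ 'n ^ 'n. det Q \<noteq> 0}"
    by (intro open_Collect_neq continuous_on_det continuous_on_const)
  then show ?thesis
    using assms unfolding eventually_nhds by (intro exI[of _ "{Q. det Q \<noteq> 0}"]) (simp add: invertible_det_nz)
qed

lemma tendsto_A_star_diff: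
  assumes "(h \<longlongrightarrow> H) F"
  shows "((\<lambda>x. A_star_diff \<Gamma> \<Sigma> A (h x)) \<longlongrightarrow> A_star_diff \<Gamma> \<Sigma> A H) F"
  unfolding A_star_diff_def Let_def by (intro tendsto_intros assms)

lemma continuous_on_A_star_diff: "continuous_on UNIV (A_star_diff \<Gamma> \<Sigma> A)"
  unfolding continuous_on_def by (auto intro!: tendsto_A_star_diff tendsto_ident_at)

lemma A_star_diff_scaleR: "A_star_diff \<Gamma> \<Sigma> A (c *\<^sub>R H) = c *\<^sub>R A_star_diff \<Gamma> \<Sigma> A H"
  by (simp add: A_star_diff_def Let_def transpose_simps matrix_ring_simps scaleR_diff_right)

context
  fixes \<Gamma> :: "real ^ 'l ^ 'l" and \<Sigma> :: "real ^ 'd ^ 'd"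
  assumes \<Gamma>: "pos_def_matrix \<Gamma>" and \<Sigma>: "pos_def_matrix \<Sigma>"
begin

lemma tendsto_Sigma_star:
  assumes "(f \<longlongrightarrow> A) F"
  shows "((\<lambda>x. Sigma_star \<Gamma> \<Sigma> (f x)) \<longlongrightarrow> Sigma_star \<Gamma> \<Sigma> A) F"
  unfolding Sigma_star_def
  by (intro tendsto_matrix_inv Sigma_star_inv[OF \<Gamma> \<Sigma>] tendsto_intros assms)

lemma tendsto_A_star:
  assumes "(f \<longlongrightarrow> A) F"
  shows "((\<lambda>x. A_star \<Gamma> \<Sigma> (f x)) \<longlongrightarrow> A_star \<Gamma> \<Sigma> A) F"
  unfolding A_star_def by (intro tendsto_Sigma_star tendsto_intros assms)

lemma tendsto_Theta:
  assumes "(f \<longlongrightarrow> A) F"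
  shows "((\<lambda>x. Theta \<Gamma> \<Sigma> (f x)) \<longlongrightarrow> Theta \<Gamma> \<Sigma> A) F"
  unfolding Theta_def Let_def by (intro tendsto_Sigma_star tendsto_A_star tendsto_intros assms)

lemma tendsto_A_star_quotient:
  assumes "(h \<longlongrightarrow> H) F" "(t \<longlongrightarrow> s) F"
  shows "((\<lambda>x. A_star_quotient \<Gamma> \<Sigma> A (h x) (t x)) \<longlongrightarrow> A_star_quotient \<Gamma> \<Sigma> A H s) F"
  unfolding A_star_quotient_def Let_def by (intro tendsto_Sigma_star tendsto_intros assms)

lemma continuous_on_A_star: "continuous_on UNIV (A_star \<Gamma> \<Sigma>)"
  unfolding continuous_on_def by (auto intro!: tendsto_A_star tendsto_ident_at)

lemma continuous_on_Theta: "continuous_on UNIV (Theta \<Gamma> \<Sigma>)"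
  unfolding continuous_on_def by (auto intro!: tendsto_Theta tendsto_ident_at)

text \<open>A vector annihilated by the transposed limit map is annihilated by \<open>Theta\<close>,
  hence is zero; strictness is then inherited from \<open>kron \<Gamma> \<Sigma>\<close>.\<close>

lemma pos_def_matrix_Theta:
  assumes "invertible (Theta \<Gamma> \<Sigma> A)"
  shows "pos_def_matrix (Theta \<Gamma> \<Sigma> A)"
  unfolding pos_def_matrix_def
proof (intro conjI allI impI)
  let ?L = "limit_map \<Gamma> \<Sigma> A"
  have V: "pos_def_matrix (kron \<Gamma> \<Sigma>)"
    by (rule pos_def_matrix_kron[OF \<Gamma> \<Sigma>])
  show "transpose (Theta \<Gamma> \<Sigma> A) = Theta \<Gamma> \<Sigma> A"
    by (simp add: Theta_eq_limit_map[OF \<Gamma> \<Sigma>] matrix_transpose_mul matrix_mul_assoc pos_def_matrixD(1)[OF V])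
  fix u :: "real ^ ('d \<times> 'l)" assume "u \<noteq> 0"
  have "transpose ?L *v u \<noteq> 0"
  proof
    assume "transpose ?L *v u = 0"
    then have "Theta \<Gamma> \<Sigma> A *v u = 0"
      by (simp only: Theta_eq_limit_map[OF \<Gamma> \<Sigma>] matrix_vector_mul_assoc[symmetric] matrix_vector_mult_0_right)
    then show False
      using \<open>u \<noteq> 0\<close> injD[OF inj_matrix_vector_mult[OF assms], of u 0] by simp
  qed
  from pos_def_matrixD(2)[OF V this] show "u \<bullet> (Theta \<Gamma> \<Sigma> A *v u) > 0"
    by (simp only: Theta_eq_limit_map[OF \<Gamma> \<Sigma>] matrix_vector_mul_assoc[symmetric] dot_matrix_vector_transpose[of u])
qed

end

section \<open>Gaussian vectors\<close>

text \<open>Treats the degenerate and the nondegenerate case alike, so that characteristic functions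
  and moments need no further case distinction.\<close>

lemma normal_measure_0_eq_distr:
  assumes "v \<ge> 0"
  shows "normal_measure 0 v = distr std_normal_distribution borel (\<lambda>x. sqrt v * x)"
proof (cases "v = 0")
  case True
  interpret prob_space std_normal_distribution
    by (rule prob_space_normal_density) simp
  show ?thesis
    using True by (simp add: normal_measure_def)
next
  case False
  with assms have v: "v > 0"
    by simp
  interpret prob_space std_normal_distribution
    by (rule prob_space_normal_density) simp
  have "distributed std_normal_distribution lborel (\<lambda>x. x) std_normal_density"
    by (auto simp: distributed_def distr_id2 intro!: measure_eqI simp: emeasure_distr)
  from normal_density_affine[OF this, of "sqrt v" 0] v
  have "distributed std_normal_distribution lborel (\<lambda>x. sqrt v * x) (normal_density 0 (sqrt v))"
    by simp
  then have "distr std_normal_distribution lborel (\<lambda>x. sqrt v * x) = density lborel (normal_density 0 (sqrt v))"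
    by (simp add: distributed_def)
  moreover have "distr std_normal_distribution lborel (\<lambda>x. sqrt v * x)
      = distr std_normal_distribution borel (\<lambda>x. sqrt v * x)"
    by (rule distr_cong) auto
  ultimately show ?thesis
    using v by (simp add: normal_measure_def)
qed

lemma real_distribution_normal_measure: "v \<ge> 0 \<Longrightarrow> real_distribution (normal_measure 0 v)"
  using prob_space.real_distribution_distr[OF prob_space_normal_density[of 1 0], of "\<lambda>x. sqrt v * x"]
  by (simp add: normal_measure_0_eq_distr)

lemma char_normal_measure:
  assumes "v \<ge> 0"
  shows "char (normal_measure 0 v) t = complex_of_real (exp (- (v * t\<^sup>2) / 2))"
proof -
  have "char (normal_measure 0 v) t = char std_normal_distribution (sqrt v * t)"
    using assms by (simp add: normal_measure_0_eq_distr char_def integral_distr mult_ac)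
  then show ?thesis
    using assms by (simp add: char_std_normal_distribution power_mult_distrib)
qed

lemma normal_measure_moments:
  fixes f :: "'o \<Rightarrow> real"
  assumes f: "f \<in> borel_measurable M" and D: "distr M borel f = normal_measure 0 v" and v: "v \<ge> 0"
  shows "integrable M (\<lambda>x. f x ^ k)" "(\<integral>x. f x \<partial>M) = 0" "(\<integral>x. (f x)\<^sup>2 \<partial>M) = v"
proof -
  have "integrable std_normal_distribution (\<lambda>x. (sqrt v * x) ^ k)"
    by (simp add: power_mult_distrib integrable_std_normal_distribution_moment)
  then have "integrable (distr M borel f) (\<lambda>x. x ^ k)"
    by (simp add: D normal_measure_0_eq_distr[OF v] integrable_distr_eq)
  then show "integrable M (\<lambda>x. f x ^ k)"
    using f by (simp add: integrable_distr_eq)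
  have "(\<integral>x. f x \<partial>M) = (\<integral>x. x \<partial>distr M borel f)"
    using f by (simp add: integral_distr)
  also have "\<dots> = sqrt v * (\<integral>x. x \<partial>std_normal_distribution)"
    by (simp add: D normal_measure_0_eq_distr[OF v] integral_distr)
  finally show "(\<integral>x. f x \<partial>M) = 0"
    using integral_std_normal_distribution_moment_odd[of 1] by simp
  have "(\<integral>x. (f x)\<^sup>2 \<partial>M) = (\<integral>x. x\<^sup>2 \<partial>distr M borel f)"
    using f by (simp add: integral_distr)
  also have "\<dots> = v * (\<integral>x. x\<^sup>2 \<partial>std_normal_distribution)"
    using v by (simp add: D normal_measure_0_eq_distr[OF v] integral_distr power_mult_distrib)
  finally show "(\<integral>x. (f x)\<^sup>2 \<partial>M) = v"
    using std_normal_distribution_even_moments(1)[of 1] by simp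
qed

lemma borel_measurable_vecI:
  fixes f :: "'o \<Rightarrow> 'a::euclidean_space ^ 'n"
  assumes "\<And>i. (\<lambda>x. f x $ i) \<in> borel_measurable M"
  shows "f \<in> borel_measurable M"
proof (subst borel_measurable_euclidean_space, rule ballI)
  fix b :: "'a ^ 'n" assume "b \<in> Basis"
  then obtain i u where "b = axis i u"
    by (auto simp: Basis_vec_def)
  then show "(\<lambda>x. f x \<bullet> b) \<in> borel_measurable M"
    using assms[of i] by (simp add: inner_axis)
qed

definition std_gaussian :: "(real ^ 'n) measure" where
  "std_gaussian = distr (\<Pi>\<^sub>M i\<in>UNIV. std_normal_distribution) borel (\<lambda>x. \<chi> i. x i)"

lemma measurable_vec_lambda_PiM:
  "(\<lambda>x. \<chi> i. x i) \<in> borel_measurable (\<Pi>\<^sub>M i\<in>(UNIV :: 'n::finite set). std_normal_distribution)"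
proof (rule borel_measurable_vecI)
  fix i :: 'n
  have "(\<lambda>x. x i) \<in> measurable (\<Pi>\<^sub>M i\<in>(UNIV :: 'n::finite set). std_normal_distribution) std_normal_distribution"
    by (rule measurable_component_singleton) simp
  then show "(\<lambda>x. (\<chi> i. x i) $ i) \<in> borel_measurable (\<Pi>\<^sub>M i\<in>(UNIV :: 'n::finite set). std_normal_distribution)"
    by simp
qed

lemma prob_space_PiM_std_normal: "prob_space (\<Pi>\<^sub>M i\<in>I. std_normal_distribution)"
  by (intro prob_space_PiM prob_space_normal_density) simp

text \<open>The characteristic function of a projection factors over the independent coordinates
  into that of a normal law; Levy's uniqueness theorem identifies the law.\<close>

lemma mv_normal_std_gaussian: "mv_normal (std_gaussian :: (real ^ 'n) measure) 0 (mat 1)"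
  unfolding mv_normal_def
proof (intro conjI allI)
  note meas = measurable_vec_lambda_PiM[where 'n='n]
  interpret PiM: prob_space "\<Pi>\<^sub>M i\<in>(UNIV :: 'n set). std_normal_distribution"
    by (rule prob_space_PiM_std_normal)
  show ps: "prob_space (std_gaussian :: (real ^ 'n) measure)"
    unfolding std_gaussian_def by (rule PiM.prob_space_distr[OF meas])
  show sets: "sets (std_gaussian :: (real ^ 'n) measure) = sets borel"
    by (simp add: std_gaussian_def)
  fix u :: "real ^ 'n"
  have u_meas: "(\<lambda>x. u \<bullet> x) \<in> borel_measurable (std_gaussian :: (real ^ 'n) measure)"
    by (simp add: measurable_cong_sets[OF sets refl])
  interpret product_sigma_finite "\<lambda>i :: 'n. std_normal_distribution"
    by (simp add: product_sigma_finite_def prob_space_imp_sigma_finite prob_space_normal_density)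
  have "distr std_gaussian borel (\<lambda>x. u \<bullet> x) = normal_measure 0 (u \<bullet> u)"
  proof (rule Levy_uniqueness)
    show "real_distribution (distr std_gaussian borel (\<lambda>x. u \<bullet> x))"
      using prob_space.real_distribution_distr[OF ps u_meas] .
    show "real_distribution (normal_measure 0 (u \<bullet> u))"
      by (rule real_distribution_normal_measure) simp
    show "char (distr std_gaussian borel (\<lambda>x. u \<bullet> x)) = char (normal_measure 0 (u \<bullet> u))"
    proof
      fix t
      have "char (distr std_gaussian borel (\<lambda>x. u \<bullet> x)) t
          = (CLINT x|std_gaussian. iexp (t * (u \<bullet> x)))"
        unfolding char_def using u_meas by (subst integral_distr) auto
      also have "\<dots> = (CLINT x|(\<Pi>\<^sub>M i\<in>(UNIV :: 'n set). std_normal_distribution). iexp (t * (u \<bullet> (\<chi> i. x i))))"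
        unfolding std_gaussian_def by (subst integral_distr[OF meas]) auto
      also have "\<dots> = (CLINT x|(\<Pi>\<^sub>M i\<in>(UNIV :: 'n set). std_normal_distribution). \<Prod>i\<in>UNIV. iexp (t * (u $ i) * x i))"
        by (simp add: inner_vec_def sum_distrib_left exp_sum mult_ac)
      also have "\<dots> = (\<Prod>i\<in>UNIV. CLINT x|std_normal_distribution. iexp (t * (u $ i) * x))"
        by (rule product_integral_prod)
          (auto intro!: prob_space.integrable_iexp prob_space_normal_density)
      also have "\<dots> = (\<Prod>i\<in>UNIV. char std_normal_distribution (t * (u $ i)))"
        by (simp add: char_def)
      also have "\<dots> = complex_of_real (exp (\<Sum>i\<in>UNIV. - (t * (u $ i))\<^sup>2 / 2))"
        by (simp add: char_std_normal_distribution exp_sum)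
      also have "(\<Sum>i\<in>UNIV. - (t * (u $ i))\<^sup>2 / 2) = - ((u \<bullet> u) * t\<^sup>2) / 2"
        by (simp add: inner_vec_def sum_negf sum_divide_distrib[symmetric] sum_distrib_right
            sum_distrib_left power2_eq_square mult_ac)
      finally show "char (distr std_gaussian borel (\<lambda>x. u \<bullet> x)) t = char (normal_measure 0 (u \<bullet> u)) t"
        by (simp add: char_normal_measure)
    qed
  qed
  then show "distr std_gaussian borel (\<lambda>x. u \<bullet> x) = normal_measure (u \<bullet> 0) (u \<bullet> (mat 1 *v u))"
    by simp
qed auto

lemma mv_normal_linear_image:
  fixes L :: "real ^ 'n ^ 'm"
  assumes P: "mv_normal P m V"
  shows "mv_normal (distr P borel (\<lambda>x. L *v x)) (L *v m) (L ** V ** transpose L)"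
  unfolding mv_normal_def
proof (intro conjI allI)
  note D = P[unfolded mv_normal_def]
  interpret prob_space P
    using D by simp
  have sets: "sets P = sets borel"
    using D by simp
  have meas: "(\<lambda>x. L *v x) \<in> borel_measurable P"
    by (simp add: measurable_cong_sets[OF sets refl] borel_measurable_continuous_onI
        matrix_vector_mult_linear_continuous_on)
  show "prob_space (distr P borel (\<lambda>x. L *v x))"
    by (rule prob_space_distr[OF meas])
  show "transpose (L ** V ** transpose L) = L ** V ** transpose L"
    using D by (simp add: matrix_transpose_mul matrix_mul_assoc)
  have form: "u \<bullet> ((L ** V ** transpose L) *v u) = (transpose L *v u) \<bullet> (V *v (transpose L *v u))" for u
    by (simp only: matrix_vector_mul_assoc[symmetric] dot_matrix_vector_transpose[of u])
  show "0 \<le> u \<bullet> ((L ** V ** transpose L) *v u)" for u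
    unfolding form using D by blast
  fix u
  have "distr (distr P borel (\<lambda>x. L *v x)) borel (\<lambda>x. u \<bullet> x) = distr P borel (\<lambda>x. (transpose L *v u) \<bullet> x)"
    by (subst distr_distr[OF _ meas]) (auto simp: comp_def dot_matrix_vector_transpose[of u])
  also have "\<dots> = normal_measure ((transpose L *v u) \<bullet> m) ((transpose L *v u) \<bullet> (V *v (transpose L *v u)))"
    using D by blast
  finally show "distr (distr P borel (\<lambda>x. L *v x)) borel (\<lambda>x. u \<bullet> x)
      = normal_measure (u \<bullet> (L *v m)) (u \<bullet> ((L ** V ** transpose L) *v u))"
    by (simp only: form dot_matrix_vector_transpose[of u L m])
qed simp

lemma mv_normal_exists:
  fixes V :: "real ^ 'n ^ 'n"
  assumes "pos_def_matrix V"
  obtains P where "mv_normal P 0 V"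
proof -
  obtain F :: "real ^ 'n ^ 'n" where F: "F ** transpose F = V"
    using pos_def_matrix_factor[OF assms] .
  then show thesis
    using mv_normal_linear_image[OF mv_normal_std_gaussian, of F] that by simp
qed

text \<open>The Cramer-Wold theorem for a constant sequence: all projections have equal laws, and a
  constant sequence has only one limit.\<close>

lemma mv_normal_unique:
  fixes f :: "real ^ 'n \<Rightarrow> real"
  assumes P: "mv_normal P m V" and Q: "mv_normal Q m V"
    and f: "continuous_on UNIV f" "\<And>x. \<bar>f x\<bar> \<le> B"
  shows "integral\<^sup>L P f = integral\<^sup>L Q f"
proof -
  have "(\<lambda>N::nat. integral\<^sup>L P f) \<longlonglongrightarrow> integral\<^sup>L Q f"
  proof (rule cramer_wold[where P="\<lambda>_. P", OF _ _ _ _ _ f])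
    show "weak_conv_m (\<lambda>N. distr P borel (\<lambda>x. u \<bullet> x)) (distr Q borel (\<lambda>x. u \<bullet> x))" for u
      using P Q by (simp add: mv_normal_def weak_conv_m_def weak_conv_def)
  qed (use P Q in \<open>simp_all add: mv_normal_def\<close>)
  then show ?thesis
    by (simp add: LIMSEQ_const_iff)
qed

text \<open>Only the index sets differ, an initial segment of the naturals against the type
  \<open>'n\<close>; a bijection between them reindexes the product measure.\<close>

lemma chi_square_eq_distr:
  "chi_square CARD('n) = distr (std_gaussian :: (real ^ 'n) measure) borel (\<lambda>x. x \<bullet> x)"
proof -
  let ?N = std_normal_distribution
  obtain h where h: "bij_betw h {..<CARD('n)} (UNIV :: 'n set)"
    using ex_bij_betw_nat_finite[of "UNIV :: 'n set"] by (auto simp: lessThan_atLeast0)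
  let ?r = "\<lambda>\<omega> :: 'n \<Rightarrow> real. \<lambda>n\<in>{..<CARD('n)}. \<omega> (h n)"
  let ?P = "\<Pi>\<^sub>M i\<in>{..<CARD('n)}. ?N"
  have P: "distr (\<Pi>\<^sub>M i\<in>UNIV. ?N) ?P ?r = ?P"
    using h by (intro distr_PiM_reindex) (auto simp: bij_betw_def intro!: prob_space_normal_density)
  have r: "?r \<in> measurable (\<Pi>\<^sub>M i\<in>UNIV. ?N) ?P"
    by (intro measurable_restrict measurable_component_singleton) simp
  have "(\<lambda>x. \<Sum>i<CARD('n). (x i)\<^sup>2) \<in> borel_measurable ?P"
    by measurable
  from distr_distr[OF this r] have "chi_square CARD('n)
      = distr (\<Pi>\<^sub>M i\<in>UNIV. ?N) borel (\<lambda>x. \<Sum>i<CARD('n). (?r x i)\<^sup>2)"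
    by (simp only: P chi_square_def comp_def)
  also have "(\<lambda>x :: 'n \<Rightarrow> real. \<Sum>i<CARD('n). (?r x i)\<^sup>2) = (\<lambda>x. (\<chi> i. x i) \<bullet> (\<chi> i. x i))"
    using sum.reindex_bij_betw[OF h, of "\<lambda>j. x j * x j" for x :: "'n \<Rightarrow> real"]
    by (simp add: fun_eq_iff inner_vec_def power2_eq_square)
  also have "distr (\<Pi>\<^sub>M i\<in>UNIV. ?N) borel \<dots> = distr (std_gaussian :: (real ^ 'n) measure) borel (\<lambda>x. x \<bullet> x)"
    unfolding std_gaussian_def
    by (subst distr_distr[OF _ measurable_vec_lambda_PiM]) (auto simp: comp_def)
  finally show ?thesis .
qed

text \<open>By uniqueness \<open>P\<close> may be replaced by the image of the standard Gaussian law
  under a factor \<open>F\<close> of \<open>V\<close>, where the quadratic form becomes the squared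
  norm.\<close>

lemma mv_normal_quadratic_form:
  fixes V :: "real ^ 'n ^ 'n" and f :: "real \<Rightarrow> real"
  assumes P: "mv_normal P 0 V" and V: "pos_def_matrix V"
    and f: "continuous_on UNIV f" "\<And>x. \<bar>f x\<bar> \<le> B"
  shows "(\<integral>x. f (x \<bullet> (matrix_inv V *v x)) \<partial>P) = integral\<^sup>L (chi_square CARD('n)) f"
proof -
  obtain F :: "real ^ 'n ^ 'n" where F: "invertible F" "F ** transpose F = V"
    using pos_def_matrix_factor[OF V] .
  define Q where "Q = distr (std_gaussian :: (real ^ 'n) measure) borel (\<lambda>x. F *v x)"
  have Q: "mv_normal Q 0 V"
    using mv_normal_linear_image[OF mv_normal_std_gaussian, of F] by (simp add: Q_def F)
  have "continuous_on UNIV (\<lambda>x :: real ^ 'n. x \<bullet> (matrix_inv V *v x))"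
    by (intro continuous_intros matrix_vector_mult_linear_continuous_on)
  then have cont: "continuous_on UNIV (\<lambda>x :: real ^ 'n. f (x \<bullet> (matrix_inv V *v x)))"
    by (rule continuous_on_compose2[OF f(1)]) auto
  have sets: "sets (std_gaussian :: (real ^ 'n) measure) = sets borel"
    by (simp add: std_gaussian_def)
  have inv: "matrix_inv V = transpose (matrix_inv F) ** matrix_inv F"
  proof (rule matrix_inv_unique)
    have t: "transpose F ** transpose (matrix_inv F) = mat 1" "transpose (matrix_inv F) ** transpose F = mat 1"
      by (simp_all add: matrix_transpose_mul[symmetric] matrix_inv[OF F(1)])
    have "F ** (transpose F ** transpose (matrix_inv F)) ** matrix_inv F = mat 1"
      by (simp add: t matrix_inv[OF F(1)])
    then show "V ** (transpose (matrix_inv F) ** matrix_inv F) = mat 1"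
      by (simp add: F(2)[symmetric] matrix_mul_assoc)
    have "transpose (matrix_inv F) ** (matrix_inv F ** F) ** transpose F = mat 1"
      by (simp add: t matrix_inv[OF F(1)])
    then show "transpose (matrix_inv F) ** matrix_inv F ** V = mat 1"
      by (simp add: F(2)[symmetric] matrix_mul_assoc)
  qed
  have quad: "(F *v x) \<bullet> (matrix_inv V *v (F *v x)) = x \<bullet> x" for x
  proof -
    have "matrix_inv V *v (F *v x) = transpose (matrix_inv F) *v (matrix_inv F *v (F *v x))"
      by (simp only: inv matrix_vector_mul_assoc matrix_mul_assoc)
    also have "matrix_inv F *v (F *v x) = x"
      by (simp add: matrix_vector_mul_assoc matrix_inv[OF F(1)])
    finally have "(F *v x) \<bullet> (matrix_inv V *v (F *v x)) = (matrix_inv F *v (F *v x)) \<bullet> x"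
      by (simp only: dot_matrix_vector_transpose transpose_transpose)
    then show ?thesis
      by (simp add: matrix_vector_mul_assoc matrix_inv[OF F(1)])
  qed
  have "(\<integral>x. f (x \<bullet> (matrix_inv V *v x)) \<partial>P) = (\<integral>x. f (x \<bullet> (matrix_inv V *v x)) \<partial>Q)"
    using P Q cont f(2) by (rule mv_normal_unique)
  also have "\<dots> = (\<integral>x. f (x \<bullet> x) \<partial>(std_gaussian :: (real ^ 'n) measure))"
    unfolding Q_def using cont
    by (subst integral_distr)
      (auto simp: quad measurable_cong_sets[OF sets refl] borel_measurable_continuous_onI
        matrix_vector_mult_linear_continuous_on)
  also have "\<dots> = integral\<^sup>L (chi_square CARD('n)) f"
    unfolding chi_square_eq_distr using f(1)
    by (subst integral_distr) (auto simp: measurable_cong_sets[OF sets refl] borel_measurable_continuous_onI)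
  finally show ?thesis .
qed

section \<open>Limit theorems for the model\<close>

text \<open>Independence and centring remove the off-diagonal products, so averages have mean square
  of order 1 / N.\<close>

lemma (in prob_space) second_moment_sum_le:
  fixes V :: "nat \<Rightarrow> 'a \<Rightarrow> real"
  assumes indep: "indep_vars (\<lambda>_. borel) V UNIV"
    and mean: "\<And>i. expectation (V i) = 0"
    and sq: "\<And>i. integrable M (\<lambda>x. (V i x)\<^sup>2)" "\<And>i. expectation (\<lambda>x. (V i x)\<^sup>2) \<le> C"
  shows "integrable M (\<lambda>x. (\<Sum>i<N. V i x)\<^sup>2)" "expectation (\<lambda>x. (\<Sum>i<N. V i x)\<^sup>2) \<le> real N * C"
proof -
  have meas: "random_variable borel (V i)" for i
    using indep by (simp add: indep_vars_def2)
  have int: "integrable M (V i)" for i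
    by (rule square_integrable_imp_integrable[OF meas sq(1)])
  have prod: "integrable M (\<lambda>x. V i x * V j x)"
    "expectation (\<lambda>x. V i x * V j x) = (if i = j then expectation (\<lambda>x. (V i x)\<^sup>2) else 0)" for i j
  proof -
    have "integrable M (\<lambda>x. V i x * V j x) \<and>
      expectation (\<lambda>x. V i x * V j x) = (if i = j then expectation (\<lambda>x. (V i x)\<^sup>2) else 0)"
    proof (cases "i = j")
      case True
      then show ?thesis
        using sq(1)[of i] by (simp add: power2_eq_square)
    next
      case False
      have "indep_vars (\<lambda>_. borel) V {i, j}"
        by (rule indep_vars_subset[OF indep]) simp
      from indep_vars_integrable[OF _ this] indep_vars_lebesgue_integral[OF _ this] int mean False
      show ?thesis
        by simp
    qed
    then show "integrable M (\<lambda>x. V i x * V j x)"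
      "expectation (\<lambda>x. V i x * V j x) = (if i = j then expectation (\<lambda>x. (V i x)\<^sup>2) else 0)"
      by auto
  qed
  have eq: "(\<Sum>i<N. V i x)\<^sup>2 = (\<Sum>i<N. \<Sum>j<N. V i x * V j x)" for x
    by (simp add: power2_eq_square sum_product)
  show "integrable M (\<lambda>x. (\<Sum>i<N. V i x)\<^sup>2)"
    unfolding eq by (intro Bochner_Integration.integrable_sum prod)
  have "expectation (\<lambda>x. (\<Sum>i<N. V i x)\<^sup>2) = (\<Sum>i<N. expectation (\<lambda>x. (V i x)\<^sup>2))"
    unfolding eq by (simp add: prod)
  also have "\<dots> \<le> (\<Sum>i<N. C)"
    by (intro sum_mono sq)
  finally show "expectation (\<lambda>x. (\<Sum>i<N. V i x)\<^sup>2) \<le> real N * C"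
    by simp
qed

lemma (in prob_space) tends_in_prob_if_mean_square:
  fixes Z :: "nat \<Rightarrow> 'a \<Rightarrow> 'b::metric_space"
  assumes meas: "\<And>N. Z N \<in> borel_measurable M"
    and int: "\<And>N. integrable M (\<lambda>x. (dist (Z N x) c)\<^sup>2)"
    and lim: "(\<lambda>N. expectation (\<lambda>x. (dist (Z N x) c)\<^sup>2)) \<longlonglongrightarrow> 0"
  shows "tends_in_prob M Z c"
  unfolding tends_in_prob_def
proof (intro conjI allI impI meas)
  fix e :: real assume e: "e > 0"
  have d[measurable]: "(\<lambda>x. dist (Z N x) c) \<in> borel_measurable M" for N
    by (rule measurable_compose[OF meas]) (intro borel_measurable_continuous_onI continuous_intros)
  show "(\<lambda>N. prob {x \<in> space M. dist (Z N x) c > e}) \<longlonglongrightarrow> 0"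
  proof (rule tendsto_sandwich[OF _ _ tendsto_const]; (intro always_eventually allI)?)
    show "(\<lambda>N. expectation (\<lambda>x. (dist (Z N x) c)\<^sup>2) / e\<^sup>2) \<longlonglongrightarrow> 0"
      using tendsto_divide[OF lim tendsto_const, of "e\<^sup>2"] e by simp
    fix N
    have "prob {x \<in> space M. dist (Z N x) c > e} \<le> prob {x \<in> space M. \<bar>dist (Z N x) c\<bar> \<ge> e}"
      by (intro finite_measure_mono) auto
    also have "\<dots> \<le> expectation (\<lambda>x. (dist (Z N x) c)\<^sup>2) / e\<^sup>2"
      by (rule second_moment_method[OF d int e])
    finally show "prob {x \<in> space M. dist (Z N x) c > e} \<le> expectation (\<lambda>x. (dist (Z N x) c)\<^sup>2) / e\<^sup>2" .
  qed simp
qed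

text \<open>Polarization reduces mixed moments to squares of projections, whose laws are known. For
  the square of a product, fourth powers dominate.\<close>

lemma mv_normal_moments:
  fixes Z :: "'o \<Rightarrow> real ^ 'n"
  assumes Z[measurable]: "Z \<in> borel_measurable M" and D: "mv_normal (distr M borel Z) 0 V"
  shows "integrable M (\<lambda>x. (u \<bullet> Z x) ^ k)" "(\<integral>x. u \<bullet> Z x \<partial>M) = 0"
    "integrable M (\<lambda>x. (u \<bullet> Z x) * (w \<bullet> Z x))" "(\<integral>x. (u \<bullet> Z x) * (w \<bullet> Z x) \<partial>M) = u \<bullet> (V *v w)"
    "integrable M (\<lambda>x. ((u \<bullet> Z x) * (w \<bullet> Z x))\<^sup>2)"
proof -
  note D' = D[unfolded mv_normal_def]
  have law: "distr M borel (\<lambda>x. u \<bullet> Z x) = normal_measure 0 (u \<bullet> (V *v u))" for u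
  proof -
    have "distr (distr M borel Z) borel (\<lambda>x. u \<bullet> x) = distr M borel (\<lambda>x. u \<bullet> Z x)"
      by (subst distr_distr) (auto simp: comp_def)
    with D' show ?thesis
      by simp
  qed
  have nonneg: "0 \<le> u \<bullet> (V *v u)" for u
    using D' by blast
  have meas: "(\<lambda>x. u \<bullet> Z x) \<in> borel_measurable M" for u
    by simp
  note mom = normal_measure_moments[OF meas law nonneg]
  show i: "integrable M (\<lambda>x. (u \<bullet> Z x) ^ k)" for u k
    by (rule mom)
  show "(\<integral>x. u \<bullet> Z x \<partial>M) = 0"
    by (rule mom)
  have polar: "(u \<bullet> Z x) * (w \<bullet> Z x) = (((u + w) \<bullet> Z x)\<^sup>2 - ((u - w) \<bullet> Z x)\<^sup>2) / 4" for x
    by (simp add: inner_add_left inner_diff_left power2_eq_square algebra_simps)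
  show "integrable M (\<lambda>x. (u \<bullet> Z x) * (w \<bullet> Z x))"
    unfolding polar by (intro integrable_divide Bochner_Integration.integrable_diff i)
  have "u \<bullet> (V *v w) = w \<bullet> (V *v u)"
    using D' by (metis dot_matrix_vector_transpose inner_commute)
  moreover have "(\<integral>x. ((u + w) \<bullet> Z x)\<^sup>2 - ((u - w) \<bullet> Z x)\<^sup>2 \<partial>M)
      = (u + w) \<bullet> (V *v (u + w)) - (u - w) \<bullet> (V *v (u - w))"
    using Bochner_Integration.integral_diff[OF i[of "u + w" 2] i[of "u - w" 2]] mom(3) by metis
  ultimately show "(\<integral>x. (u \<bullet> Z x) * (w \<bullet> Z x) \<partial>M) = u \<bullet> (V *v w)"
    unfolding polar
    by (simp only: Bochner_Integration.integral_divide)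
      (simp add: algebra_simps inner_add_left inner_diff_left inner_add_right inner_diff_right)
  show "integrable M (\<lambda>x. ((u \<bullet> Z x) * (w \<bullet> Z x))\<^sup>2)"
  proof (rule Bochner_Integration.integrable_bound)
    show "integrable M (\<lambda>x. (u \<bullet> Z x) ^ 4 + (w \<bullet> Z x) ^ 4)"
      by (intro Bochner_Integration.integrable_add i)
    have "(a * b)\<^sup>2 \<le> a ^ 4 + b ^ 4" for a b :: real
    proof -
      have "(a * b)\<^sup>2 \<le> 2 * a\<^sup>2 * b\<^sup>2"
        by (simp add: power_mult_distrib)
      also have "\<dots> \<le> (a\<^sup>2)\<^sup>2 + (b\<^sup>2)\<^sup>2"
        by (rule sum_squares_bound)
      finally show ?thesis
        by simp
    qed
    then show "AE x in M. norm (((u \<bullet> Z x) * (w \<bullet> Z x))\<^sup>2) \<le> norm ((u \<bullet> Z x) ^ 4 + (w \<bullet> Z x) ^ 4)"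
      by (intro AE_I2) (simp add: abs_of_nonneg add_nonneg_nonneg)
  qed measurable
qed

lemma vimage_algebra_contains_sigma_sets:
  fixes h :: "'b::topological_space \<Rightarrow> real"
  assumes "h \<in> borel_measurable borel"
  shows "sigma_sets S {(\<lambda>x. h (W x)) -` A \<inter> S | A. A \<in> sets borel} \<subseteq> sets (vimage_algebra S W borel)"
proof -
  have "{(\<lambda>x. h (W x)) -` A \<inter> S | A. A \<in> sets borel} \<subseteq> sets (vimage_algebra S W borel)"
  proof clarify
    fix A :: "real set" assume "A \<in> sets borel"
    then have "h -` A \<in> sets borel"
      using measurable_sets[OF assms] by simp
    then have "W -` (h -` A) \<inter> S \<in> sets (vimage_algebra S W borel)"
      by (rule in_vimage_algebra)
    then show "(\<lambda>x. h (W x)) -` A \<inter> S \<in> sets (vimage_algebra S W borel)"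
      by (simp add: vimage_def)
  qed
  from sets.sigma_sets_subset[OF this] show ?thesis
    by simp
qed

text \<open>Passes from independence of the generated sigma-algebras, as stated in the model, to
  real functions of the two vectors, for which expectations of products factor.\<close>

lemma (in prob_space) indep_var_if_indep_vimage_algebra:
  fixes f :: "'b::topological_space \<Rightarrow> real" and g :: "'c::topological_space \<Rightarrow> real"
  assumes meas: "random_variable borel Y" "random_variable borel Z"
    and indep: "indep_set (sets (vimage_algebra (space M) Y borel)) (sets (vimage_algebra (space M) Z borel))"
    and fg: "f \<in> borel_measurable borel" "g \<in> borel_measurable borel"
  shows "indep_var borel (\<lambda>x. f (Y x)) borel (\<lambda>x. g (Z x))"
  unfolding indep_var_eq indep_sets2_eq
  using measurable_compose[OF meas(1) fg(1)] measurable_compose[OF meas(2) fg(2)]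
    vimage_algebra_contains_sigma_sets[OF fg(1), of "space M" Y]
    vimage_algebra_contains_sigma_sets[OF fg(2), of "space M" Z]
    indep[unfolded indep_sets2_eq]
  by blast

section \<open>Central limit theorem for the noise cross products and law of large numbers for
  \<open>S N\<close>\<close>

locale linear_gaussian = prob_space M
  for M :: "'o measure" +
  fixes X :: "nat \<Rightarrow> 'o \<Rightarrow> real ^ 'd" and Y :: "nat \<Rightarrow> 'o \<Rightarrow> real ^ 'l"
    and A :: "real ^ 'l ^ 'd" and \<Gamma> :: "real ^ 'l ^ 'l" and \<Sigma> :: "real ^ 'd ^ 'd"
  assumes \<Gamma>: "pos_def_matrix \<Gamma>" and \<Sigma>: "pos_def_matrix \<Sigma>"
    and model: "linear_gaussian_model M A \<Gamma> \<Sigma> X Y"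
begin

definition E :: "nat \<Rightarrow> 'o \<Rightarrow> real ^ 'd" where
  "E i \<omega> = X i \<omega> - A *v Y i \<omega>"

lemma indep_pairs: "indep_vars (\<lambda>_. borel) (\<lambda>i \<omega>. (X i \<omega>, Y i \<omega>)) UNIV"
  using model unfolding linear_gaussian_model_def by blast

lemma pair_measurable: "random_variable borel (\<lambda>\<omega>. (X i \<omega>, Y i \<omega>))"
  using indep_pairs by (simp add: indep_vars_def2)

lemma measurable_of_pair:
  assumes "continuous_on UNIV \<phi>"
  shows "random_variable borel (\<lambda>\<omega>. \<phi> (X i \<omega>, Y i \<omega>))"
  using measurable_compose[OF pair_measurable borel_measurable_continuous_onI[OF assms]] .

lemma X_measurable [measurable]: "random_variable borel (X i)"
  using measurable_of_pair[of fst] by (simp add: continuous_on_fst continuous_on_id)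

lemma Y_measurable [measurable]: "random_variable borel (Y i)"
  using measurable_of_pair[of snd] by (simp add: continuous_on_snd continuous_on_id)

lemma E_measurable [measurable]: "random_variable borel (E i)"
proof -
  have "continuous_on UNIV (\<lambda>p. fst p - A *v snd p)"
    by (intro continuous_intros continuous_on_compose2[OF matrix_vector_mult_linear_continuous_on[of UNIV]]) auto
  from measurable_of_pair[OF this] show ?thesis
    by (simp add: E_def[abs_def])
qed

lemma Y_normal: "mv_normal (distr M borel (Y i)) 0 \<Gamma>"
  and E_normal: "mv_normal (distr M borel (E i)) 0 \<Sigma>"
  using model unfolding linear_gaussian_model_def E_def[abs_def] by blast+

lemma indep_Y_E:
  assumes "f \<in> borel_measurable borel" "g \<in> borel_measurable borel"
  shows "indep_var borel (\<lambda>\<omega>. f (E i \<omega>) :: real) borel (\<lambda>\<omega>. g (Y i \<omega>) :: real)"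
proof -
  have "indep_set (sets (vimage_algebra (space M) (Y i) borel)) (sets (vimage_algebra (space M) (E i) borel))"
    using model unfolding linear_gaussian_model_def E_def[abs_def] by blast
  then have "indep_set (sets (vimage_algebra (space M) (E i) borel)) (sets (vimage_algebra (space M) (Y i) borel))"
    unfolding indep_sets2_eq by (metis Int_commute mult.commute)
  from indep_var_if_indep_vimage_algebra[OF E_measurable Y_measurable this assms] show ?thesis .
qed

text \<open>The entrywise inner product of \<open>U\<close> with the cross product of noise and
  \<open>Y i\<close>, so that projections of \<open>Z N\<close> are normalized sums of
  scores.\<close>

definition score :: "real ^ 'l ^ 'd \<Rightarrow> nat \<Rightarrow> 'o \<Rightarrow> real" where
  "score U i \<omega> = E i \<omega> \<bullet> (U *v Y i \<omega>)"

text \<open>Each term is a function of the noise times a function of \<open>Y i\<close>, so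
  independence can be used termwise.\<close>

lemma score_eq: "score U i \<omega> = (\<Sum>d\<in>UNIV. (axis d 1 \<bullet> E i \<omega>) * (U $ d \<bullet> Y i \<omega>))"
  by (simp add: score_def inner_vec_def[of "E i \<omega>"] matrix_mult_dot inner_axis')

lemma indep_score: "indep_vars (\<lambda>_. borel) (score U) UNIV"
proof -
  have "continuous_on UNIV (\<lambda>p. (fst p - A *v snd p) \<bullet> (U *v snd p))"
    by (intro continuous_intros continuous_on_compose2[OF matrix_vector_mult_linear_continuous_on[of UNIV]]) auto
  from indep_vars_compose2[OF indep_pairs borel_measurable_continuous_onI[OF this]]
  show ?thesis
    by (simp add: score_def[abs_def] E_def)
qed

lemma score_law: "distr M borel (score U i) = distr M borel (score U 0)"
proof -
  have "continuous_on UNIV (\<lambda>p. (fst p - A *v snd p) \<bullet> (U *v snd p))"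
    by (intro continuous_intros continuous_on_compose2[OF matrix_vector_mult_linear_continuous_on[of UNIV]]) auto
  from borel_measurable_continuous_onI[OF this]
  have "distr M borel (score U i) = distr (distr M borel (\<lambda>\<omega>. (X i \<omega>, Y i \<omega>))) borel
      (\<lambda>p. (fst p - A *v snd p) \<bullet> (U *v snd p))" for i
    by (subst distr_distr[OF _ pair_measurable]) (auto simp: comp_def score_def[abs_def] E_def)
  moreover have "distr M borel (\<lambda>\<omega>. (X i \<omega>, Y i \<omega>)) = distr M borel (\<lambda>\<omega>. (X 0 \<omega>, Y 0 \<omega>))"
    using model unfolding linear_gaussian_model_def by blast
  ultimately show ?thesis
    by simp
qed

lemma score_mean: "expectation (score U i) = 0"
proof -
  have int: "integrable M (\<lambda>\<omega>. axis d 1 \<bullet> E i \<omega>)" "integrable M (\<lambda>\<omega>. U $ d \<bullet> Y i \<omega>)" for d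
    using mv_normal_moments(1)[OF E_measurable[of i] E_normal, where u="axis d 1" and k=1]
      mv_normal_moments(1)[OF Y_measurable[of i] Y_normal, where u="U $ d" and k=1] by simp_all
  have indep: "indep_var borel (\<lambda>\<omega>. axis d 1 \<bullet> E i \<omega>) borel (\<lambda>\<omega>. U $ d \<bullet> Y i \<omega>)" for d
    using indep_Y_E[of "\<lambda>e. axis d 1 \<bullet> e" "\<lambda>y. U $ d \<bullet> y" i] by simp
  have "expectation (score U i) = (\<Sum>d\<in>UNIV. expectation (\<lambda>\<omega>. (axis d 1 \<bullet> E i \<omega>) * (U $ d \<bullet> Y i \<omega>)))"
    unfolding score_eq[abs_def]
    by (rule Bochner_Integration.integral_sum) (rule indep_var_integrable[OF indep int])
  also have "\<dots> = (\<Sum>d\<in>UNIV. expectation (\<lambda>\<omega>. axis d 1 \<bullet> E i \<omega>) * expectation (\<lambda>\<omega>. U $ d \<bullet> Y i \<omega>))"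
    by (intro sum.cong refl indep_var_lebesgue_integral indep int)
  also have "\<dots> = 0"
    unfolding mv_normal_moments(2)[OF E_measurable E_normal] by simp
  finally show ?thesis .
qed

lemma score_second_moment:
  "integrable M (\<lambda>\<omega>. (score U i \<omega>)\<^sup>2)"
  "expectation (\<lambda>\<omega>. (score U i \<omega>)\<^sup>2) = vec_of U \<bullet> (kron \<Gamma> \<Sigma> *v vec_of U)"
proof -
  let ?e = "\<lambda>d d' \<omega>. (axis d 1 \<bullet> E i \<omega>) * (axis d' 1 \<bullet> E i \<omega>)"
  let ?y = "\<lambda>d d' \<omega>. (U $ d \<bullet> Y i \<omega>) * (U $ d' \<bullet> Y i \<omega>)"
  have eq: "(score U i \<omega>)\<^sup>2 = (\<Sum>d\<in>UNIV. \<Sum>d'\<in>UNIV. ?e d d' \<omega> * ?y d d' \<omega>)" for \<omega>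
    by (simp add: score_eq power2_eq_square sum_product mult_ac)
  have indep: "indep_var borel (?e d d') borel (?y d d')" for d d'
    by (rule indep_Y_E[of "\<lambda>e. (axis d 1 \<bullet> e) * (axis d' 1 \<bullet> e)" "\<lambda>y. (U $ d \<bullet> y) * (U $ d' \<bullet> y)" i])
      measurable
  note int = mv_normal_moments(3)[OF E_measurable E_normal] mv_normal_moments(3)[OF Y_measurable Y_normal]
  have prod: "integrable M (\<lambda>\<omega>. ?e d d' \<omega> * ?y d d' \<omega>)"
    "expectation (\<lambda>\<omega>. ?e d d' \<omega> * ?y d d' \<omega>) = \<Sigma> $ d $ d' * (U $ d \<bullet> (\<Gamma> *v U $ d'))" for d d'
  proof -
    show "integrable M (\<lambda>\<omega>. ?e d d' \<omega> * ?y d d' \<omega>)"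
      by (rule indep_var_integrable[OF indep int])
    have "axis d 1 \<bullet> (\<Sigma> *v axis d' 1) = \<Sigma> $ d $ d'"
      by (simp add: inner_axis' matrix_vector_mult_basis column_def)
    then show "expectation (\<lambda>\<omega>. ?e d d' \<omega> * ?y d d' \<omega>) = \<Sigma> $ d $ d' * (U $ d \<bullet> (\<Gamma> *v U $ d'))"
      using indep_var_lebesgue_integral[OF indep int]
      by (simp only: mv_normal_moments(4)[OF E_measurable E_normal] mv_normal_moments(4)[OF Y_measurable Y_normal])
  qed
  show "integrable M (\<lambda>\<omega>. (score U i \<omega>)\<^sup>2)"
    unfolding eq by (intro Bochner_Integration.integrable_sum prod)
  have "expectation (\<lambda>\<omega>. (score U i \<omega>)\<^sup>2) = (\<Sum>d\<in>UNIV. \<Sum>d'\<in>UNIV. \<Sigma> $ d $ d' * (U $ d \<bullet> (\<Gamma> *v U $ d')))"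
    unfolding eq by (subst Bochner_Integration.integral_sum | intro Bochner_Integration.integrable_sum prod sum.cong refl)+
  also have "\<dots> = (\<Sum>d\<in>UNIV. U $ d \<bullet> (\<Gamma> *v (\<Sum>d'\<in>UNIV. \<Sigma> $ d $ d' *\<^sub>R U $ d')))"
    by (simp add: linear_sum[OF matrix_vector_mul_linear] inner_sum_right matrix_vector_mult_scaleR)
  also have "\<dots> = (\<Sum>d\<in>UNIV. U $ d \<bullet> (\<Gamma> *v ((\<Sigma> ** U) $ d)))"
  proof -
    have "(\<Sigma> ** U) $ d = (\<Sum>d'\<in>UNIV. \<Sigma> $ d $ d' *\<^sub>R U $ d')" for d
      by (simp add: vec_eq_iff matrix_matrix_mult_def)
    then show ?thesis
      by simp
  qed
  also have "\<dots> = vec_of U \<bullet> (kron \<Gamma> \<Sigma> *v vec_of U)"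
    by (simp add: kron_vec_of inner_vec_of row_mult_transpose)
  finally show "expectation (\<lambda>\<omega>. (score U i \<omega>)\<^sup>2) = vec_of U \<bullet> (kron \<Gamma> \<Sigma> *v vec_of U)" .
qed

definition Z :: "nat \<Rightarrow> 'o \<Rightarrow> real ^ ('l \<times> 'd)" where
  "Z N \<omega> = (1 / sqrt (real N)) *\<^sub>R (\<Sum>i<N. vec_of (\<chi> d l. E i \<omega> $ d * Y i \<omega> $ l))"

lemma inner_Z: "vec_of U \<bullet> Z N \<omega> = (\<Sum>i<N. score U i \<omega>) / sqrt (real N)"
proof -
  have "vec_of U \<bullet> vec_of (\<chi> d l. E i \<omega> $ d * Y i \<omega> $ l) = score U i \<omega>" for i
    by (simp add: inner_vec_of score_eq inner_axis' inner_vec_def[where 'b='l] sum_distrib_left mult_ac)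
  then show ?thesis
    by (simp add: Z_def inner_sum_right)
qed

lemma Z_measurable [measurable]: "random_variable borel (Z N)"
proof (rule borel_measurable_vecI)
  fix p :: "'l \<times> 'd"
  have "(\<lambda>\<omega>. Z N \<omega> $ p) = (\<lambda>\<omega>. (1 / sqrt (real N)) * (\<Sum>i<N. (axis (snd p) 1 \<bullet> E i \<omega>) * (axis (fst p) 1 \<bullet> Y i \<omega>)))"
    by (simp add: Z_def vec_of_def inner_axis')
  then show "random_variable borel (\<lambda>\<omega>. Z N \<omega> $ p)"
    by simp
qed

text \<open>The central limit theorem requires positive variance, which positive definiteness
  provides for nonzero \<open>u\<close>; for \<open>u = 0\<close> both laws are the point mass at 0.
  The change of scale by \<open>sqrt v\<close> is made on characteristic functions, where it only
  changes the argument.\<close>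

lemma Z_projection_weak_conv:
  "weak_conv_m (\<lambda>N. distr M borel (\<lambda>\<omega>. u \<bullet> Z N \<omega>)) (normal_measure 0 (u \<bullet> (kron \<Gamma> \<Sigma> *v u)))"
proof (cases "u = 0")
  case True
  then show ?thesis
    by (simp add: normal_measure_def weak_conv_m_def weak_conv_def)
next
  case False
  define U where "U = mat_of u"
  have u: "u = vec_of U"
    by (simp add: U_def)
  define v where "v = u \<bullet> (kron \<Gamma> \<Sigma> *v u)"
  have v: "v > 0"
    unfolding v_def by (rule pos_def_matrixD(2)[OF pos_def_matrix_kron[OF \<Gamma> \<Sigma>] False])
  have sm: "integrable M (\<lambda>\<omega>. (score U i \<omega>)\<^sup>2)" "expectation (\<lambda>\<omega>. (score U i \<omega>)\<^sup>2) = v" for i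
    by (simp_all add: score_second_moment v_def u)
  let ?S = "\<lambda>N \<omega>. (\<Sum>i<N. score U i \<omega>) / sqrt (real N * (sqrt v)\<^sup>2)"
  have clt: "weak_conv_m (\<lambda>N. distr M borel (?S N)) std_normal_distribution"
    using v sm by (intro central_limit_theorem_zero_mean[OF indep_score score_mean _ _ _ score_law])
      (simp_all add: score_mean)
  have [measurable]: "random_variable borel (score U i)" for i
    unfolding score_eq[abs_def] by measurable
  have rescale: "u \<bullet> Z N \<omega> = sqrt v * ?S N \<omega>" for N \<omega>
    using v by (simp add: u inner_Z real_sqrt_mult)
  have "weak_conv_m (\<lambda>N. distr M borel (\<lambda>\<omega>. u \<bullet> Z N \<omega>)) (normal_measure 0 v)"
  proof (rule levy_continuity)
    show "real_distribution (distr M borel (\<lambda>\<omega>. u \<bullet> Z N \<omega>))" for N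
      by (intro real_distribution_distr) measurable
    show "real_distribution (normal_measure 0 v)"
      using v by (simp add: real_distribution_normal_measure)
    fix t
    have "(\<lambda>N. char (distr M borel (?S N)) (t * sqrt v)) \<longlonglongrightarrow> char std_normal_distribution (t * sqrt v)"
      by (intro levy_continuity1[OF _ real_dist_normal_dist clt] real_distribution_distr) measurable
    moreover have "char (distr M borel (?S N)) (t * sqrt v) = char (distr M borel (\<lambda>\<omega>. u \<bullet> Z N \<omega>)) t" for N
      by (simp add: char_def integral_distr rescale mult_ac)
    moreover have "char std_normal_distribution (t * sqrt v) = char (normal_measure 0 v) t"
      using v by (simp add: char_std_normal_distribution char_normal_measure power_mult_distrib mult_ac)
    ultimately show "(\<lambda>N. char (distr M borel (\<lambda>\<omega>. u \<bullet> Z N \<omega>)) t) \<longlonglongrightarrow> char (normal_measure 0 v) t"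
      by simp
  qed
  then show ?thesis
    by (simp add: v_def)
qed

lemma Z_weak_conv:
  assumes Q: "mv_normal Q 0 (kron \<Gamma> \<Sigma>)"
  shows "weak_conv_vec (\<lambda>N. distr M borel (Z N)) Q"
  unfolding weak_conv_vec_def
proof (intro allI impI)
  fix f :: "real ^ ('l \<times> 'd) \<Rightarrow> real" assume f: "continuous_on UNIV f \<and> bounded (range f)"
  then obtain B where B: "\<And>x. \<bar>f x\<bar> \<le> B"
    by (auto simp: bounded_iff)
  note Q' = Q[unfolded mv_normal_def]
  show "(\<lambda>N. integral\<^sup>L (distr M borel (Z N)) f) \<longlonglongrightarrow> integral\<^sup>L Q f"
  proof (rule cramer_wold[OF _ _ _ _ _ conjunct1[OF f] B])
    show "prob_space (distr M borel (Z N))" for N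
      by (rule prob_space_distr) measurable
    show "prob_space Q" "sets Q = sets borel"
      using Q' by blast+
    show "weak_conv_m (\<lambda>N. distr (distr M borel (Z N)) borel (\<lambda>x. u \<bullet> x)) (distr Q borel (\<lambda>x. u \<bullet> x))" for u
    proof -
      have "distr (distr M borel (Z N)) borel (\<lambda>x. u \<bullet> x) = distr M borel (\<lambda>\<omega>. u \<bullet> Z N \<omega>)" for N
        by (subst distr_distr) (auto simp: comp_def)
      moreover have "distr Q borel (\<lambda>x. u \<bullet> x) = normal_measure (u \<bullet> 0) (u \<bullet> (kron \<Gamma> \<Sigma> *v u))"
        using Q' by blast
      ultimately show ?thesis
        using Z_projection_weak_conv[of u] by simp
    qed
  qed simp
qed

definition S :: "nat \<Rightarrow> 'o \<Rightarrow> real ^ 'l ^ 'l" where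
  "S N \<omega> = (1 / real N) *\<^sub>R (\<chi> l m. \<Sum>i<N. Y i \<omega> $ l * Y i \<omega> $ m)"

lemma S_measurable [measurable]: "random_variable borel (S N)"
proof (intro borel_measurable_vecI)
  fix l m :: 'l
  have "(\<lambda>\<omega>. S N \<omega> $ l $ m) = (\<lambda>\<omega>. (1 / real N) * (\<Sum>i<N. (axis l 1 \<bullet> Y i \<omega>) * (axis m 1 \<bullet> Y i \<omega>)))"
    by (simp add: S_def inner_axis')
  then show "random_variable borel (\<lambda>\<omega>. S N \<omega> $ l $ m)"
    by simp
qed

lemma S_entry_mean_square:
  fixes l m :: 'l
  shows "integrable M (\<lambda>\<omega>. (S N \<omega> $ l $ m - \<Gamma> $ l $ m)\<^sup>2)"
    "(\<lambda>N. expectation (\<lambda>\<omega>. (S N \<omega> $ l $ m - \<Gamma> $ l $ m)\<^sup>2)) \<longlonglongrightarrow> 0"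
proof -
  define V where "V i \<omega> = (axis l 1 \<bullet> Y i \<omega>) * (axis m 1 \<bullet> Y i \<omega>) - \<Gamma> $ l $ m" for i \<omega>
  note mom = mv_normal_moments[OF Y_measurable Y_normal]
  have "continuous_on UNIV (\<lambda>p. (axis l 1 \<bullet> snd p) * (axis m 1 \<bullet> snd p) - \<Gamma> $ l $ m :: real)"
    by (intro continuous_intros)
  from indep_vars_compose2[OF indep_pairs borel_measurable_continuous_onI[OF this]]
  have indep: "indep_vars (\<lambda>_. borel) V UNIV"
    by (simp add: V_def[abs_def])
  have mean: "expectation (V i) = 0" for i
  proof -
    have "expectation (V i) = axis l 1 \<bullet> (\<Gamma> *v axis m 1) - \<Gamma> $ l $ m"
      unfolding V_def[abs_def]
      by (subst Bochner_Integration.integral_diff) (simp_all add: mom(3,4) prob_space del: inner_axis')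
    then show ?thesis
      by (simp add: matrix_vector_mult_basis column_def inner_axis')
  qed
  have V2: "(V i \<omega>)\<^sup>2 = ((axis l 1 \<bullet> Y i \<omega>) * (axis m 1 \<bullet> Y i \<omega>))\<^sup>2
      - 2 * \<Gamma> $ l $ m * ((axis l 1 \<bullet> Y i \<omega>) * (axis m 1 \<bullet> Y i \<omega>)) + (\<Gamma> $ l $ m)\<^sup>2" for i \<omega>
    by (simp add: V_def power2_eq_square algebra_simps)
  have int: "integrable M (\<lambda>\<omega>. (V i \<omega>)\<^sup>2)" for i
    unfolding V2 by (intro Bochner_Integration.integrable_add Bochner_Integration.integrable_diff
        integrable_mult_right mom(3,5) integrable_const)
  define C where "C = expectation (\<lambda>\<omega>. (V 0 \<omega>)\<^sup>2)"
  have C: "expectation (\<lambda>\<omega>. (V i \<omega>)\<^sup>2) \<le> C" for i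
  proof -
    let ?\<phi> = "\<lambda>p. ((axis l 1 \<bullet> snd p) * (axis m 1 \<bullet> snd p) - \<Gamma> $ l $ m)\<^sup>2 :: real"
    have "continuous_on UNIV (?\<phi> :: (real ^ 'd) \<times> (real ^ 'l) \<Rightarrow> real)"
      by (intro continuous_intros)
    from borel_measurable_continuous_onI[OF this]
    have "expectation (\<lambda>\<omega>. (V i \<omega>)\<^sup>2) = integral\<^sup>L (distr M borel (\<lambda>\<omega>. (X i \<omega>, Y i \<omega>))) ?\<phi>" for i
      by (subst integral_distr[OF pair_measurable]) (simp_all add: V_def)
    moreover have "distr M borel (\<lambda>\<omega>. (X i \<omega>, Y i \<omega>)) = distr M borel (\<lambda>\<omega>. (X 0 \<omega>, Y 0 \<omega>))"
      using model unfolding linear_gaussian_model_def by blast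
    ultimately show ?thesis
      by (simp add: C_def)
  qed
  have eq: "S N \<omega> $ l $ m - \<Gamma> $ l $ m = (1 / real N) * (\<Sum>i<N. V i \<omega>)" if "N > 0" for N \<omega>
    using that by (simp add: S_def V_def sum_subtractf inner_axis' field_simps)
  \<comment> \<open>Division by zero yields 0, so \<open>S 0\<close> is the zero matrix;
    integrability is required for this index too.\<close>
  have eq0: "S 0 \<omega> $ l $ m - \<Gamma> $ l $ m = - \<Gamma> $ l $ m" for \<omega>
    by (simp add: S_def)
  note sum = second_moment_sum_le[OF indep mean int C]
  show "integrable M (\<lambda>\<omega>. (S N \<omega> $ l $ m - \<Gamma> $ l $ m)\<^sup>2)"
    using sum(1)[of N] by (cases "N = 0") (simp_all add: eq eq0 power_mult_distrib power_divide)
  show "(\<lambda>N. expectation (\<lambda>\<omega>. (S N \<omega> $ l $ m - \<Gamma> $ l $ m)\<^sup>2)) \<longlonglongrightarrow> 0"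
  proof (rule tendsto_sandwich[OF _ _ tendsto_const])
    show "(\<lambda>N. C / real N) \<longlonglongrightarrow> 0"
      by (rule lim_const_over_n)
    show "eventually (\<lambda>N. expectation (\<lambda>\<omega>. (S N \<omega> $ l $ m - \<Gamma> $ l $ m)\<^sup>2) \<le> C / real N) sequentially"
      using eventually_gt_at_top[of 0]
    proof eventually_elim
      case (elim N)
      have "expectation (\<lambda>\<omega>. (S N \<omega> $ l $ m - \<Gamma> $ l $ m)\<^sup>2) = expectation (\<lambda>\<omega>. (\<Sum>i<N. V i \<omega>)\<^sup>2) / (real N)\<^sup>2"
        using elim by (simp add: eq power_divide)
      also have "\<dots> \<le> real N * C / (real N)\<^sup>2"
        using sum(2)[of N] by (intro divide_right_mono) simp_all
      also have "\<dots> = C / real N"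
        using elim by (simp add: power2_eq_square)
      finally show ?case .
    qed
  qed (simp add: integral_nonneg_AE)
qed

text \<open>The deterministic step is paired with \<open>S N\<close>, so that Slutsky's lemma sees a
  single parameter. Squared distances add in the product, and the step contributes 1 / N.\<close>

lemma S_inverse_sqrt_tends_in_prob:
  "tends_in_prob M (\<lambda>N \<omega>. (S N \<omega>, 1 / sqrt (real N))) (\<Gamma>, 0)"
proof (rule tends_in_prob_if_mean_square)
  show "random_variable borel (\<lambda>\<omega>. (S N \<omega>, 1 / sqrt (real N)))" for N
    by (rule borel_measurable_Pair) measurable
  have eq: "(dist (S N \<omega>, 1 / sqrt (real N)) (\<Gamma>, 0))\<^sup>2
      = (\<Sum>l\<in>UNIV. \<Sum>m\<in>UNIV. (S N \<omega> $ l $ m - \<Gamma> $ l $ m)\<^sup>2) + 1 / real N" for N \<omega>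
    by (simp add: dist_Pair_Pair dist_sq_matrix sum_nonneg power_divide)
  have int: "integrable M (\<lambda>\<omega>. \<Sum>l\<in>UNIV. \<Sum>m\<in>UNIV. (S N \<omega> $ l $ m - \<Gamma> $ l $ m)\<^sup>2)" for N
    by (intro Bochner_Integration.integrable_sum S_entry_mean_square)
  show "integrable M (\<lambda>\<omega>. (dist (S N \<omega>, 1 / sqrt (real N)) (\<Gamma>, 0))\<^sup>2)" for N
    unfolding eq using int by simp
  have "(\<lambda>N. (\<Sum>l\<in>UNIV. \<Sum>m\<in>UNIV. expectation (\<lambda>\<omega>. (S N \<omega> $ l $ m - \<Gamma> $ l $ m)\<^sup>2)) + 1 / real N)
      \<longlonglongrightarrow> (\<Sum>l\<in>(UNIV :: 'l set). \<Sum>m\<in>(UNIV :: 'l set). 0) + 0"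
    by (intro tendsto_add tendsto_sum S_entry_mean_square lim_const_over_n)
  then show "(\<lambda>N. expectation (\<lambda>\<omega>. (dist (S N \<omega>, 1 / sqrt (real N)) (\<Gamma>, 0))\<^sup>2)) \<longlonglongrightarrow> 0"
    unfolding eq using int S_entry_mean_square(1) by (simp add: prob_space)
qed

end

section \<open>The least squares estimator and the delta method\<close>

lemma borel_measurable_cross_products:
  fixes f :: "nat \<Rightarrow> 'o \<Rightarrow> real ^ 'm" and g :: "nat \<Rightarrow> 'o \<Rightarrow> real ^ 'n"
  assumes [measurable]: "\<And>i. f i \<in> borel_measurable M" "\<And>i. g i \<in> borel_measurable M"
  shows "(\<lambda>\<omega>. \<chi> a b. \<Sum>i<N. f i \<omega> $ a * g i \<omega> $ b) \<in> borel_measurable M"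
proof (intro borel_measurable_vecI)
  fix a b
  have "(\<lambda>\<omega>. \<Sum>i<N. (axis a 1 \<bullet> f i \<omega>) * (axis b 1 \<bullet> g i \<omega>)) \<in> borel_measurable M"
    by measurable
  then show "(\<lambda>\<omega>. (\<chi> a b. \<Sum>i<N. f i \<omega> $ a * g i \<omega> $ b) $ a $ b) \<in> borel_measurable M"
    by (simp add: inner_axis')
qed

context linear_gaussian
begin

definition A_hat :: "nat \<Rightarrow> 'o \<Rightarrow> real ^ 'l ^ 'd" where
  "A_hat N \<omega> = least_squares N (\<lambda>i. X i \<omega>) (\<lambda>i. Y i \<omega>)"

text \<open>Substituting the regression equation into the cross products. Nothing is cancelled, so
  the formula also holds when \<open>S N\<close> is singular.\<close>

lemma A_hat_eq:
  assumes "N > 0"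
  shows "A_hat N \<omega> = (A ** (real N *\<^sub>R S N \<omega>) + sqrt (real N) *\<^sub>R mat_of (Z N \<omega>))
    ** matrix_inv (real N *\<^sub>R S N \<omega>)"
proof -
  have yy: "(\<chi> l m. \<Sum>i<N. Y i \<omega> $ l * Y i \<omega> $ m) = real N *\<^sub>R S N \<omega>"
    using assms by (simp add: S_def)
  have "(\<Sum>i<N. X i \<omega> $ d * Y i \<omega> $ l)
      = (A ** (real N *\<^sub>R S N \<omega>) + sqrt (real N) *\<^sub>R mat_of (Z N \<omega>)) $ d $ l" for d l
  proof -
    have "(A ** (real N *\<^sub>R S N \<omega>)) $ d $ l = (\<Sum>i<N. (A *v Y i \<omega>) $ d * Y i \<omega> $ l)"
      unfolding yy[symmetric]
      by (simp add: matrix_matrix_mult_def matrix_vector_mult_def sum_distrib_left sum_distrib_right mult_ac)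
        (rule sum.swap)
    moreover have "(sqrt (real N) *\<^sub>R mat_of (Z N \<omega>)) $ d $ l = (\<Sum>i<N. E i \<omega> $ d * Y i \<omega> $ l)"
      using assms by (simp add: mat_of_def Z_def vec_of_def)
    ultimately show ?thesis
      by (simp add: sum.distrib[symmetric] E_def algebra_simps)
  qed
  then have "(\<chi> d l. \<Sum>i<N. X i \<omega> $ d * Y i \<omega> $ l)
      = A ** (real N *\<^sub>R S N \<omega>) + sqrt (real N) *\<^sub>R mat_of (Z N \<omega>)"
    by (simp only: vec_eq_iff vec_lambda_beta) simp
  then show ?thesis
    by (simp only: A_hat_def least_squares_def yy)
qed

lemma A_hat_measurable [measurable]: "random_variable borel (A_hat N)"
proof -
  have "continuous_on UNIV (\<lambda>p :: (real ^ 'l ^ 'd) \<times> (real ^ 'l ^ 'l). fst p ** snd p)"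
    by (intro bounded_bilinear.continuous_on[OF bounded_bilinear_matrix_mult] continuous_intros)
  from borel_measurable_continuous_Pair[OF borel_measurable_cross_products[OF X_measurable Y_measurable]
      measurable_compose[OF borel_measurable_cross_products[OF Y_measurable Y_measurable]
        borel_measurable_matrix_inv] this]
  show ?thesis
    by (simp only: A_hat_def[abs_def] least_squares_def)
qed

text \<open>
  \<open>\<Phi> t B\<close> is a statistic of the estimator \<open>B\<close> with \<open>t = 1 / sqrt N\<close>, and \<open>G H t\<close> is its continuous
  expression in the rescaled error \<open>H = (B - A) / t\<close>.  The second branch of \<open>rep\<close> reproduces the
  least squares estimator built from the junk value of \<open>matrix_inv\<close>, which makes \<open>rep_eq\<close> exact
  on the whole sample space.
\<close>
context
  fixes \<Phi> :: "real \<Rightarrow> real ^ 'l ^ 'd \<Rightarrow> 'c::metric_space" and G :: "real ^ 'l ^ 'd \<Rightarrow> real \<Rightarrow> 'c"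
  assumes \<Phi>_increment: "\<And>t H. t \<noteq> 0 \<Longrightarrow> \<Phi> t (A + t *\<^sub>R H) = G H t"
    and G_cont: "\<And>H. isCont (case_prod G) (H, 0)"
begin

definition rep :: "real ^ ('l \<times> 'd) \<Rightarrow> (real ^ 'l ^ 'l) \<times> real \<Rightarrow> 'c" where
  "rep w c = (let s = fst c; t = snd c in
     if invertible s then G (mat_of w ** matrix_inv s) t
     else \<Phi> t ((A ** (inverse (t\<^sup>2) *\<^sub>R s) + inverse t *\<^sub>R mat_of w) ** matrix_inv (inverse (t\<^sup>2) *\<^sub>R s)))"

lemma rep_eq:
  assumes "N > 0"
  shows "\<Phi> (1 / sqrt (real N)) (A_hat N \<omega>) = rep (Z N \<omega>) (S N \<omega>, 1 / sqrt (real N))"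
proof (cases "invertible (S N \<omega>)")
  case False
  then show ?thesis
    using assms by (simp add: rep_def Let_def A_hat_eq power_divide)
next
  case True
  have "A ** (real N *\<^sub>R S N \<omega>) ** matrix_inv (real N *\<^sub>R S N \<omega>) = A"
    using assms True by (simp add: matrix_mul_assoc[symmetric] matrix_inv scalar_invertible)
  moreover have "(sqrt (real N) *\<^sub>R mat_of (Z N \<omega>)) ** matrix_inv (real N *\<^sub>R S N \<omega>)
      = (1 / sqrt (real N)) *\<^sub>R (mat_of (Z N \<omega>) ** matrix_inv (S N \<omega>))"
    using assms True by (simp add: matrix_inv_scaleR matrix_ring_simps real_div_sqrt field_simps)
  ultimately have "A_hat N \<omega> = A + (1 / sqrt (real N)) *\<^sub>R (mat_of (Z N \<omega>) ** matrix_inv (S N \<omega>))"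
    using assms by (simp only: A_hat_eq matrix_ring_simps(1))
  then show ?thesis
    using assms True by (simp add: rep_def \<Phi>_increment)
qed

lemma rep_limit: "rep w (\<Gamma>, 0) = G (mat_of w ** matrix_inv \<Gamma>) 0"
  by (simp add: rep_def pos_def_matrix_invertible[OF \<Gamma>])

lemma isCont_rep: "isCont (case_prod rep) (w, (\<Gamma>, 0))"
proof -
  note inv = pos_def_matrix_invertible[OF \<Gamma>]
  \<comment> \<open>Invertibility is an open condition satisfied by \<Gamma>, so close to the point
    only the first branch of \<open>rep\<close> occurs.\<close>
  have "eventually (\<lambda>p. invertible (fst (snd p))) (nhds (w, (\<Gamma>, 0 :: real)))"
  proof (rule eventually_compose_filterlim[OF eventually_invertible[OF inv]])
    have "isCont (\<lambda>p. fst (snd p)) (w, (\<Gamma>, 0 :: real))"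
      by (intro continuous_intros)
    then show "filterlim (\<lambda>p. fst (snd p)) (nhds \<Gamma>) (nhds (w, (\<Gamma>, 0 :: real)))"
      using tendsto_at_iff_tendsto_nhds[of "\<lambda>p. fst (snd p)" "(w, (\<Gamma>, 0 :: real))"] by (simp add: isCont_def)
  qed
  then have "eventually (\<lambda>p. case_prod rep p
      = case_prod G (mat_of (fst p) ** matrix_inv (fst (snd p)), snd (snd p))) (nhds (w, (\<Gamma>, 0 :: real)))"
    by eventually_elim (simp add: rep_def case_prod_unfold Let_def)
  moreover have "isCont (\<lambda>p. case_prod G (mat_of (fst p) ** matrix_inv (fst (snd p)), snd (snd p))) (w, (\<Gamma>, 0 :: real))"
  proof -
    have "((\<lambda>p. (mat_of (fst p) ** matrix_inv (fst (snd p)), snd (snd p))) \<longlongrightarrow> (mat_of w ** matrix_inv \<Gamma>, 0))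
        (at (w, (\<Gamma>, 0 :: real)))"
      by (intro tendsto_Pair tendsto_matrix_mult tendsto_mat_of tendsto_matrix_inv inv)
        (auto intro!: tendsto_eq_intros)
    from isCont_tendsto_compose[OF G_cont this] show ?thesis
      by (simp add: isCont_def)
  qed
  ultimately show ?thesis
    by (subst isCont_cong)
qed

text \<open>The source of every limit below: a use consists in naming \<open>\<Phi>\<close> and
  \<open>G\<close>, and the derivative enters only as the value of \<open>G\<close> at step 0. If
  that value does not depend on \<open>H\<close>, the limit is deterministic and the conclusion is
  consistency.\<close>

lemma delta_method:
  assumes Q: "mv_normal Q 0 (kron \<Gamma> \<Sigma>)"
    and T: "\<And>N. random_variable borel (T N)" "\<And>N \<omega>. N > 0 \<Longrightarrow> T N \<omega> = \<Phi> (1 / sqrt (real N)) (A_hat N \<omega>)"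
  shows "continuous_on UNIV f \<Longrightarrow> bounded (range f) \<Longrightarrow> (\<lambda>N. integral\<^sup>L (distr M borel (T N)) f)
      \<longlonglongrightarrow> integral\<^sup>L (distr Q borel (\<lambda>w. G (mat_of w ** matrix_inv \<Gamma>) 0)) (f :: 'c \<Rightarrow> real)"
    and "(\<And>H. G H 0 = a) \<Longrightarrow> tends_in_prob M T a"
proof -
  have Q': "prob_space Q" "sets Q = sets borel"
    using Q by (auto simp: mv_normal_def)
  have ev: "eventually (\<lambda>N. \<forall>\<omega>\<in>space M. T N \<omega> = rep (Z N \<omega>) (S N \<omega>, 1 / sqrt (real N))) sequentially"
    using eventually_gt_at_top[of 0] by eventually_elim (simp add: T(2) rep_eq)
  note common = prob_space_axioms Q' Z_measurable Z_weak_conv[OF Q] S_inverse_sqrt_tends_in_prob T(1) ev isCont_rep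
  show "(\<lambda>N. integral\<^sup>L (distr M borel (T N)) f)
      \<longlonglongrightarrow> integral\<^sup>L (distr Q borel (\<lambda>w. G (mat_of w ** matrix_inv \<Gamma>) 0)) f"
    if "continuous_on UNIV f" "bounded (range f)" for f :: "'c \<Rightarrow> real"
    using slutsky[OF common that] by (simp only: rep_limit)
  show "tends_in_prob M T a" if "\<And>H. G H 0 = a"
    using slutsky_in_prob[OF common] by (simp only: rep_limit that)
qed

end

lemma Theta_A_hat_measurable: "random_variable borel (\<lambda>\<omega>. Theta \<Gamma> \<Sigma> (A_hat N \<omega>))"
  by (rule measurable_compose[OF A_hat_measurable borel_measurable_continuous_onI[OF continuous_on_Theta[OF \<Gamma> \<Sigma>]]])

definition err :: "nat \<Rightarrow> 'o \<Rightarrow> real ^ ('d \<times> 'l)" where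
  "err N \<omega> = vec_of (A_star \<Gamma> \<Sigma> (A_hat N \<omega>)) - vec_of (A_star \<Gamma> \<Sigma> A)"

lemma err_measurable [measurable]: "random_variable borel (err N)"
proof -
  have "continuous_on UNIV (\<lambda>B. vec_of (A_star \<Gamma> \<Sigma> B) - vec_of (A_star \<Gamma> \<Sigma> A))"
    by (intro continuous_intros bounded_linear.continuous_on[OF bounded_linear_vec_of] continuous_on_A_star[OF \<Gamma> \<Sigma>])
  from measurable_compose[OF A_hat_measurable borel_measurable_continuous_onI[OF this]] show ?thesis
    by (simp only: err_def[abs_def])
qed

lemma A_star_rescaled_increment:
  "t \<noteq> 0 \<Longrightarrow> inverse t *\<^sub>R (vec_of (A_star \<Gamma> \<Sigma> (A + t *\<^sub>R H)) - vec_of (A_star \<Gamma> \<Sigma> A))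
    = vec_of (A_star_quotient \<Gamma> \<Sigma> A H t)"
  by (simp add: A_star_increment[OF \<Gamma> \<Sigma>] vec_of_simps)

lemma limit_map_eq:
  "vec_of (A_star_diff \<Gamma> \<Sigma> A (mat_of w ** matrix_inv \<Gamma>)) = limit_map \<Gamma> \<Sigma> A *v w"
  using limit_map_vec_of[OF \<Gamma> \<Sigma>, of A "mat_of w"] by simp

text \<open>The differential is homogeneous, so \<open>G\<close> does not involve the step. The
  limit law agrees with that of \<open>err\<close> because \<open>A_star_quotient\<close> at step 0
  is the differential.\<close>

lemma linearization_tendsto:
  assumes Q: "mv_normal Q 0 (kron \<Gamma> \<Sigma>)"
  shows "weak_conv_vec (\<lambda>N. distr M borel (\<lambda>\<omega>. sqrt (real N) *\<^sub>R vec_of (A_star_diff \<Gamma> \<Sigma> A (A_hat N \<omega> - A))))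
    (distr Q borel (\<lambda>w. limit_map \<Gamma> \<Sigma> A *v w))"
  unfolding weak_conv_vec_def limit_map_eq[symmetric]
proof (intro allI impI, elim conjE)
  let ?T = "\<lambda>N \<omega>. sqrt (real N) *\<^sub>R vec_of (A_star_diff \<Gamma> \<Sigma> A (A_hat N \<omega> - A))"
  fix f :: "real ^ ('d \<times> 'l) \<Rightarrow> real" assume f: "continuous_on UNIV f" "bounded (range f)"
  have cont: "continuous_on UNIV (\<lambda>B. sqrt (real N) *\<^sub>R vec_of (A_star_diff \<Gamma> \<Sigma> A (B - A)))" for N
    by (intro continuous_intros bounded_linear.continuous_on[OF bounded_linear_vec_of]
        continuous_on_compose2[OF continuous_on_A_star_diff]) auto
  show "(\<lambda>N. integral\<^sup>L (distr M borel (?T N)) f) \<longlonglongrightarrow>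
      integral\<^sup>L (distr Q borel (\<lambda>w. vec_of (A_star_diff \<Gamma> \<Sigma> A (mat_of w ** matrix_inv \<Gamma>)))) f"
  proof (rule delta_method(1)[where G="\<lambda>H t. vec_of (A_star_diff \<Gamma> \<Sigma> A H)"
        and \<Phi>="\<lambda>t B. inverse t *\<^sub>R vec_of (A_star_diff \<Gamma> \<Sigma> A (B - A))", OF _ _ Q _ _ f])
    show "random_variable borel (?T N)" for N
      by (rule measurable_compose[OF A_hat_measurable borel_measurable_continuous_onI[OF cont]])
    show "isCont (\<lambda>(H, t). vec_of (A_star_diff \<Gamma> \<Sigma> A H)) (H, 0 :: real)" for H
      unfolding isCont_def case_prod_unfold
      by (intro tendsto_vec_of tendsto_A_star_diff) (auto intro!: tendsto_eq_intros tendsto_fst[OF tendsto_ident_at] tendsto_snd[OF tendsto_ident_at])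
  qed (simp_all add: A_star_diff_scaleR vec_of_simps)
qed

lemma err_tendsto:
  assumes Q: "mv_normal Q 0 (kron \<Gamma> \<Sigma>)"
  shows "weak_conv_vec (\<lambda>N. distr M borel (\<lambda>\<omega>. sqrt (real N) *\<^sub>R err N \<omega>))
    (distr Q borel (\<lambda>w. limit_map \<Gamma> \<Sigma> A *v w))"
  unfolding weak_conv_vec_def limit_map_eq[symmetric] A_star_quotient_0[symmetric]
proof (intro allI impI, elim conjE)
  fix f :: "real ^ ('d \<times> 'l) \<Rightarrow> real" assume f: "continuous_on UNIV f" "bounded (range f)"
  show "(\<lambda>N. integral\<^sup>L (distr M borel (\<lambda>\<omega>. sqrt (real N) *\<^sub>R err N \<omega>)) f) \<longlonglongrightarrow>
      integral\<^sup>L (distr Q borel (\<lambda>w. vec_of (A_star_quotient \<Gamma> \<Sigma> A (mat_of w ** matrix_inv \<Gamma>) 0))) f"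
  proof (rule delta_method(1)[where G="\<lambda>H t. vec_of (A_star_quotient \<Gamma> \<Sigma> A H t)"
        and \<Phi>="\<lambda>t B. inverse t *\<^sub>R (vec_of (A_star \<Gamma> \<Sigma> B) - vec_of (A_star \<Gamma> \<Sigma> A))", OF _ _ Q _ _ f])
    show "isCont (\<lambda>(H, t). vec_of (A_star_quotient \<Gamma> \<Sigma> A H t)) (H, 0)" for H
      unfolding isCont_def case_prod_unfold
      by (intro tendsto_vec_of tendsto_A_star_quotient[OF \<Gamma> \<Sigma>]) (auto intro!: tendsto_eq_intros)
    show "random_variable borel (\<lambda>\<omega>. sqrt (real N) *\<^sub>R err N \<omega>)" for N
      by measurable
  qed (simp_all add: A_star_rescaled_increment err_def)
qed

lemma Theta_A_hat_tends_in_prob: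
  "tends_in_prob M (\<lambda>N \<omega>. Theta \<Gamma> \<Sigma> (A_hat N \<omega>)) (Theta \<Gamma> \<Sigma> A)"
proof -
  obtain Q where Q: "mv_normal Q 0 (kron \<Gamma> \<Sigma>)"
    using mv_normal_exists[OF pos_def_matrix_kron[OF \<Gamma> \<Sigma>]] .
  show ?thesis
  proof (rule delta_method(2)[where G="\<lambda>H t. Theta \<Gamma> \<Sigma> (A + t *\<^sub>R H)" and \<Phi>="\<lambda>t B. Theta \<Gamma> \<Sigma> B", OF _ _ Q])
    show "isCont (\<lambda>(H, t). Theta \<Gamma> \<Sigma> (A + t *\<^sub>R H)) (H, 0)" for H
      unfolding isCont_def case_prod_unfold
      by (intro tendsto_Theta[OF \<Gamma> \<Sigma>]) (auto intro!: tendsto_eq_intros tendsto_fst[OF tendsto_ident_at] tendsto_snd[OF tendsto_ident_at])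
  qed (simp_all add: Theta_A_hat_measurable)
qed

text \<open>The factor N is shared as sqrt N by the two occurrences of \<open>err\<close>.
  Invertibility of \<open>Theta\<close> at \<open>A\<close> gives continuity of
  \<open>matrix_inv\<close> there, hence that of \<open>?G\<close> at step 0.\<close>

lemma quadratic_form_weak_conv:
  assumes inv: "invertible (Theta \<Gamma> \<Sigma> A)"
  shows "weak_conv_m (\<lambda>N. distr M borel (\<lambda>\<omega>. real N * (err N \<omega> \<bullet> (matrix_inv (Theta \<Gamma> \<Sigma> (A_hat N \<omega>)) *v err N \<omega>))))
    (chi_square (CARD('d) * CARD('l)))"
proof -
  let ?T = "\<lambda>N \<omega>. real N * (err N \<omega> \<bullet> (matrix_inv (Theta \<Gamma> \<Sigma> (A_hat N \<omega>)) *v err N \<omega>))"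
  let ?L = "limit_map \<Gamma> \<Sigma> A"
  let ?q = "\<lambda>H t. vec_of (A_star_quotient \<Gamma> \<Sigma> A H t)"
  let ?G = "\<lambda>H t. ?q H t \<bullet> (matrix_inv (Theta \<Gamma> \<Sigma> (A + t *\<^sub>R H)) *v ?q H t)"
  let ?\<Phi> = "\<lambda>t B. let e = inverse t *\<^sub>R (vec_of (A_star \<Gamma> \<Sigma> B) - vec_of (A_star \<Gamma> \<Sigma> A))
    in e \<bullet> (matrix_inv (Theta \<Gamma> \<Sigma> B) *v e)"
  obtain Q where Q: "mv_normal Q 0 (kron \<Gamma> \<Sigma>)"
    using mv_normal_exists[OF pos_def_matrix_kron[OF \<Gamma> \<Sigma>]] .
  define P where "P = distr Q borel (\<lambda>w. ?L *v w)"
  have P: "mv_normal P 0 (Theta \<Gamma> \<Sigma> A)"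
    using mv_normal_linear_image[OF Q, of ?L] by (simp add: P_def Theta_eq_limit_map[OF \<Gamma> \<Sigma>])
  have sets_Q: "sets Q = sets borel"
    using Q by (simp add: mv_normal_def)
  have L_meas: "(\<lambda>w. ?L *v w) \<in> borel_measurable Q"
    by (simp add: measurable_cong_sets[OF sets_Q refl] borel_measurable_continuous_onI
        matrix_vector_mult_linear_continuous_on)
  have quad_cont: "continuous_on UNIV (\<lambda>x :: real ^ ('d \<times> 'l). x \<bullet> (W *v x))" for W
    by (intro continuous_intros matrix_vector_mult_linear_continuous_on)
  have T_meas: "random_variable borel (?T N)" for N
  proof -
    have "continuous_on UNIV (\<lambda>p :: (real ^ ('d \<times> 'l)) \<times> (real ^ ('d \<times> 'l) ^ ('d \<times> 'l)).
        real N * (fst p \<bullet> (snd p *v fst p)))"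
      unfolding matrix_vector_mult_def by (intro continuous_intros)
    from borel_measurable_continuous_Pair[OF err_measurable
        measurable_compose[OF Theta_A_hat_measurable borel_measurable_matrix_inv] this]
    show ?thesis .
  qed
  have card: "CARD('d) * CARD('l) = CARD('d \<times> 'l)"
    by simp
  show ?thesis
    unfolding card
  proof (rule integral_bdd_continuous_conv_imp_weak_conv)
    show "real_distribution (distr M borel (?T N))" for N
      by (rule real_distribution_distr[OF T_meas])
    show "real_distribution (chi_square CARD('d \<times> 'l))"
    proof -
      have std: "prob_space (std_gaussian :: (real ^ ('d \<times> 'l)) measure)"
        "sets (std_gaussian :: (real ^ ('d \<times> 'l)) measure) = sets borel"
        using mv_normal_std_gaussian[where 'n="'d \<times> 'l"] unfolding mv_normal_def by blast+
      have "(\<lambda>x. x \<bullet> x) \<in> borel_measurable (std_gaussian :: (real ^ ('d \<times> 'l)) measure)"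
        by (simp add: measurable_cong_sets[OF std(2) refl])
      from prob_space.real_distribution_distr[OF std(1) this] show ?thesis
        by (simp only: chi_square_eq_distr)
    qed
    fix f :: "real \<Rightarrow> real" assume f: "\<And>x. isCont f x" "\<And>x. \<bar>f x\<bar> \<le> 1"
    then have cont: "continuous_on UNIV f"
      by (simp add: continuous_on_eq_continuous_at)
    have "(\<lambda>N. integral\<^sup>L (distr M borel (?T N)) f)
        \<longlonglongrightarrow> integral\<^sup>L (distr Q borel (\<lambda>w. ?G (mat_of w ** matrix_inv \<Gamma>) 0)) f"
    proof (rule delta_method(1)[where \<Phi>="?\<Phi>", OF _ _ Q T_meas _ cont])
      show "?\<Phi> t (A + t *\<^sub>R H) = ?G H t" if "t \<noteq> 0" for t H
        by (simp only: A_star_rescaled_increment[OF that] Let_def)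
      show "isCont (\<lambda>(H, t). ?G H t) (H, 0)" for H
      proof -
        have fst: "((\<lambda>p. fst p) \<longlongrightarrow> H) (at (H, 0 :: real))"
          by (rule tendsto_eq_rhs[OF tendsto_fst[OF tendsto_ident_at]]) simp
        have snd: "((\<lambda>p. snd p) \<longlongrightarrow> 0) (at (H, 0 :: real))"
          by (rule tendsto_eq_rhs[OF tendsto_snd[OF tendsto_ident_at]]) simp
        show ?thesis
          unfolding isCont_def case_prod_unfold fst_conv snd_conv
          by (intro tendsto_inner tendsto_vec_of tendsto_matrix_vector_mult tendsto_matrix_inv
              tendsto_Theta[OF \<Gamma> \<Sigma>] tendsto_A_star_quotient[OF \<Gamma> \<Sigma>] tendsto_add tendsto_scaleR
              tendsto_const fst snd) (simp add: inv)
      qed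
      show "?T N \<omega> = ?\<Phi> (1 / sqrt (real N)) (A_hat N \<omega>)" for N \<omega>
      proof -
        have e: "inverse (1 / sqrt (real N)) *\<^sub>R (vec_of (A_star \<Gamma> \<Sigma> (A_hat N \<omega>)) - vec_of (A_star \<Gamma> \<Sigma> A))
            = sqrt (real N) *\<^sub>R err N \<omega>"
          by (simp add: err_def)
        show ?thesis
          unfolding Let_def e by (simp add: matrix_vector_mult_scaleR)
      qed
      show "bounded (range f)"
        using f(2) by (intro boundedI[of _ 1]) auto
    qed
    also have "(\<lambda>w. ?G (mat_of w ** matrix_inv \<Gamma>) 0)
        = (\<lambda>w. (?L *v w) \<bullet> (matrix_inv (Theta \<Gamma> \<Sigma> A) *v (?L *v w)))"
      by (simp add: A_star_quotient_0 limit_map_eq)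
    \<comment> \<open>A change of variables to the Gaussian law \<open>P\<close> of the
      linearization, whose covariance is the very matrix inverted in the form.\<close>
    also have "integral\<^sup>L (distr Q borel \<dots>) f = (\<integral>x. f (x \<bullet> (matrix_inv (Theta \<Gamma> \<Sigma> A) *v x)) \<partial>P)"
    proof -
      have "continuous_on UNIV (\<lambda>x. f (x \<bullet> (matrix_inv (Theta \<Gamma> \<Sigma> A) *v x)))"
        by (rule continuous_on_compose2[OF cont quad_cont]) simp
      moreover have "(\<lambda>w. (?L *v w) \<bullet> (matrix_inv (Theta \<Gamma> \<Sigma> A) *v (?L *v w))) \<in> borel_measurable Q"
        by (rule measurable_compose[OF L_meas borel_measurable_continuous_onI[OF quad_cont]])
      ultimately show ?thesis
        unfolding P_def using L_meas cont
        by (simp add: integral_distr borel_measurable_continuous_onI)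
    qed
    also have "\<dots> = integral\<^sup>L (chi_square CARD('d \<times> 'l)) f"
      by (rule mv_normal_quadratic_form[OF P pos_def_matrix_Theta[OF \<Gamma> \<Sigma> inv] cont f(2)])
    finally show "(\<lambda>N. integral\<^sup>L (distr M borel (?T N)) f) \<longlonglongrightarrow> integral\<^sup>L (chi_square CARD('d \<times> 'l)) f" .
  qed
qed

end

text \<open>\<open>Theta\<close> can be singular: for D = L = 1 and A = \<Gamma> = \<Sigma> = 1 the
  map is a / (1 + a^2), its derivative vanishes at 1, and the limit law is a point mass. Hence the
  chi-square part is conditional on invertibility, whereas the Gaussian limit allows degenerate
  laws.\<close>

theorem theorem3:
  fixes M :: "'o measure"
    and X :: "nat \<Rightarrow> 'o \<Rightarrow> real ^ 'd"
    and Y :: "nat \<Rightarrow> 'o \<Rightarrow> real ^ 'l"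
    and A :: "real ^ 'l ^ 'd"
    and \<Gamma> :: "real ^ 'l ^ 'l"
    and \<Sigma> :: "real ^ 'd ^ 'd"
  assumes "prob_space M"
    and "pos_def_matrix \<Gamma>"
    and "pos_def_matrix \<Sigma>"
    and "\<forall>i j. i \<noteq> j \<longrightarrow> \<Sigma> $ i $ j = 0"
    and "linear_gaussian_model M A \<Gamma> \<Sigma> X Y"
  shows
    "let A_hat = (\<lambda>N \<omega>. least_squares N (\<lambda>i. X i \<omega>) (\<lambda>i. Y i \<omega>));
         err = (\<lambda>N \<omega>. vec_of (A_star \<Gamma> \<Sigma> (A_hat N \<omega>)) - vec_of (A_star \<Gamma> \<Sigma> A))
     in (\<exists>P. mv_normal P 0 (Theta \<Gamma> \<Sigma> A) \<and>
             weak_conv_vec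
               (\<lambda>N. distr M borel
                  (\<lambda>\<omega>. sqrt (real N) *\<^sub>R vec_of (A_star_diff \<Gamma> \<Sigma> A (A_hat N \<omega> - A)))) P \<and>
             weak_conv_vec (\<lambda>N. distr M borel (\<lambda>\<omega>. sqrt (real N) *\<^sub>R err N \<omega>)) P) \<and>
        tends_in_prob M (\<lambda>N \<omega>. Theta \<Gamma> \<Sigma> (A_hat N \<omega>)) (Theta \<Gamma> \<Sigma> A) \<and>
        (invertible (Theta \<Gamma> \<Sigma> A) \<longrightarrow>
           weak_conv_m
             (\<lambda>N. distr M borel
                (\<lambda>\<omega>. real N * (err N \<omega> \<bullet> (matrix_inv (Theta \<Gamma> \<Sigma> (A_hat N \<omega>)) *v err N \<omega>))))
             (chi_square (CARD('d) * CARD('l))))"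
proof -
  interpret prob_space M
    by (rule assms)
  interpret linear_gaussian M X Y A \<Gamma> \<Sigma>
    by unfold_locales (rule assms)+
  obtain Q where Q: "mv_normal Q 0 (kron \<Gamma> \<Sigma>)"
    using mv_normal_exists[OF pos_def_matrix_kron[OF \<Gamma> \<Sigma>]] .
  have "mv_normal (distr Q borel (\<lambda>w. limit_map \<Gamma> \<Sigma> A *v w)) 0 (Theta \<Gamma> \<Sigma> A)"
    using mv_normal_linear_image[OF Q, of "limit_map \<Gamma> \<Sigma> A"] by (simp add: Theta_eq_limit_map[OF \<Gamma> \<Sigma>])
  then show ?thesis
    unfolding Let_def A_hat_def[symmetric] err_def[symmetric]
    by (intro conjI impI exI[of _ "distr Q borel (\<lambda>w. limit_map \<Gamma> \<Sigma> A *v w)"]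
        linearization_tendsto[OF Q] err_tendsto[OF Q] Theta_A_hat_tends_in_prob quadratic_form_weak_conv)
qed

end
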